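(* Let $T>0$, let $\{X_s,\ s\ge 0\}$ be a real-valued Lévy process with Lévy exponent $\psi_X$, and set $$c(u)=\sqrt{\frac{\|\psi_X(u)\|^2}{2\,\mathrm{Re}[\psi_X(u)]}}$$ for $u\in\mathbb R$ with $\mathrm{Re}[\psi_X(u)]\neq0$. Let $\theta\in\mathbb R$ be such that $\mathrm{Re}[\psi_X(\theta)]\,\mathrm{Re}[\psi_X(2\theta)]\neq 0$. For $\varepsilon>0$ define $$x_\varepsilon^\theta(t)=\varepsilon\,c(\theta)\int_0^{\frac{2t}{\varepsilon^2}}e^{i\theta X_s}\,ds,\qquad t\in[0,T],$$ and let $P_\varepsilon^\theta$ be the image law of $x_\varepsilon^\theta$ in the Banach space $\mathcal C([0,T],\mathbb C)$ of continuous functions on $[0,T]$. Then $P_\varepsilon^\theta$ converges weakly, as $\varepsilon$ tends to zero, towards the law on $\mathcal C([0,T],\mathbb C)$ of a complex Brownian motion.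
   Context: A Lévy process $X$ has stationary and independent increments, is continuous in probability, is càdlàg and satisfies $X_0=0$. Its Lévy exponent $\psi_X$ is defined (with this sign convention) by $E(e^{iuX_t})=e^{-t\psi_X(u)}$ for $u\in\mathbb R$, $t\ge0$. $\|z\|$ is the modulus of a complex number $z$ and $\mathrm{Re}$ denotes the real part. A complex Brownian motion $\{B_t,\ t\in[0,T]\}$ is a $\mathbb C$-valued process whose real and imaginary parts are two independent standard Brownian motions (started at $0$). *)

theory Defs
  imports "HOL-Probability.Probability"
begin

section \<open>Real-valued Levy processes\<close>

text \<open>A process is a family of functions indexed by all reals; only the indices
  \<open>t \<ge> 0\<close> are constrained. The path properties hold for every \<open>\<omega>\<close>.\<close>

locale levy_process = prob_space +
  fixes X :: "real \<Rightarrow> 'a \<Rightarrow> real"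
  assumes random_variable: "0 \<le> t \<Longrightarrow> random_variable borel (X t)"
    and start: "\<omega> \<in> space M \<Longrightarrow> X 0 \<omega> = 0"
    and stationary_increments:
      "0 \<le> s \<Longrightarrow> s \<le> t \<Longrightarrow>
        distr M borel (\<lambda>\<omega>. X t \<omega> - X s \<omega>) = distr M borel (\<lambda>\<omega>. X (t - s) \<omega> - X 0 \<omega>)"
    and independent_increments:
      "0 \<le> \<tau> 0 \<Longrightarrow> mono_on {..n} \<tau> \<Longrightarrow>
        indep_vars (\<lambda>_. borel) (\<lambda>k \<omega>. X (\<tau> (Suc k)) \<omega> - X (\<tau> k) \<omega>) {..<n::nat}"
    and continuous_in_probability:
      "0 \<le> t \<Longrightarrow> 0 < a \<Longrightarrow>
        ((\<lambda>s. prob {\<omega> \<in> space M. a < \<bar>X s \<omega> - X t \<omega>\<bar>}) \<longlongrightarrow> 0) (at t within {0..})"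
    and right_continuous:
      "\<omega> \<in> space M \<Longrightarrow> 0 \<le> t \<Longrightarrow> ((\<lambda>s. X s \<omega>) \<longlongrightarrow> X t \<omega>) (at_right t)"
    and left_limits:
      "\<omega> \<in> space M \<Longrightarrow> 0 < t \<Longrightarrow> \<exists>l. ((\<lambda>s. X s \<omega>) \<longlongrightarrow> l) (at_left t)"

text \<open>The exponent is uniquely determined by this property, because it is required for
  all \<open>t \<ge> 0\<close>.\<close>

definition levy_exponent :: "'a measure \<Rightarrow> (real \<Rightarrow> 'a \<Rightarrow> real) \<Rightarrow> (real \<Rightarrow> complex) \<Rightarrow> bool" where
  "levy_exponent M X \<psi> \<longleftrightarrow>
    (\<forall>u. \<forall>t\<ge>0. (CLINT \<omega>|M. iexp (u * X t \<omega>)) = exp (- (of_real t * \<psi> u)))"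

section \<open>Complex Brownian motion on a compact interval\<close>

locale std_brownian_motion = prob_space +
  fixes T :: real and W :: "real \<Rightarrow> 'a \<Rightarrow> real"
  assumes random_variable: "t \<in> {0..T} \<Longrightarrow> random_variable borel (W t)"
    and start: "\<omega> \<in> space M \<Longrightarrow> W 0 \<omega> = 0"
    and independent_increments:
      "0 \<le> \<tau> 0 \<Longrightarrow> \<tau> n \<le> T \<Longrightarrow> mono_on {..n} \<tau> \<Longrightarrow>
        indep_vars (\<lambda>_. borel) (\<lambda>k \<omega>. W (\<tau> (Suc k)) \<omega> - W (\<tau> k) \<omega>) {..<n::nat}"
    and gaussian_increments:
      "0 \<le> s \<Longrightarrow> s < t \<Longrightarrow> t \<le> T \<Longrightarrow>
        distributed M lborel (\<lambda>\<omega>. W t \<omega> - W s \<omega>) (normal_density 0 (sqrt (t - s)))"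
    and continuous_paths: "\<omega> \<in> space M \<Longrightarrow> continuous_on {0..T} (\<lambda>t. W t \<omega>)"

text \<open>Independence of the real and imaginary parts is independence of the two processes,
  that is, of the two random elements of the product space indexed by \<open>[0, T]\<close>.\<close>

definition complex_brownian_motion :: "'a measure \<Rightarrow> real \<Rightarrow> (real \<Rightarrow> 'a \<Rightarrow> complex) \<Rightarrow> bool" where
  "complex_brownian_motion M T B \<longleftrightarrow>
    std_brownian_motion M T (\<lambda>t \<omega>. Re (B t \<omega>)) \<and>
    std_brownian_motion M T (\<lambda>t \<omega>. Im (B t \<omega>)) \<and>
    prob_space.indep_var M
      (\<Pi>\<^sub>M t\<in>{0..T}. borel) (\<lambda>\<omega>. \<lambda>t\<in>{0..T}. Re (B t \<omega>))
      (\<Pi>\<^sub>M t\<in>{0..T}. borel) (\<lambda>\<omega>. \<lambda>t\<in>{0..T}. Im (B t \<omega>))"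

section \<open>Laws on the space of continuous paths and weak convergence\<close>

text \<open>Elements of \<open>cfunspace\<close> are extensional, so a path is restricted to \<open>[0, T]\<close> before it
  is regarded as a point of \<open>C([0, T], \<complex>)\<close>, which carries the supremum metric.\<close>

definition path_space :: "real \<Rightarrow> (real \<Rightarrow> complex) metric" where
  "path_space T = cfunspace (top_of_set {0..T}) euclidean_metric"

definition metric_borel :: "'a metric \<Rightarrow> 'a measure" where
  "metric_borel m = sigma (mspace m) {U. openin (mtopology_of m) U}"

definition path_law :: "'a measure \<Rightarrow> real \<Rightarrow> (real \<Rightarrow> 'a \<Rightarrow> complex) \<Rightarrow> (real \<Rightarrow> complex) measure" where
  "path_law M T Y = distr M (metric_borel (path_space T)) (\<lambda>\<omega>. \<lambda>t\<in>{0..T}. Y t \<omega>)"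

definition weakly_converges ::
    "'a metric \<Rightarrow> ('i \<Rightarrow> 'a measure) \<Rightarrow> 'a measure \<Rightarrow> 'i filter \<Rightarrow> bool" where
  "weakly_converges m P Q F \<longleftrightarrow>
    (\<forall>f. continuous_map (mtopology_of m) euclideanreal f \<and> bounded (f ` mspace m) \<longrightarrow>
      ((\<lambda>i. LINT x|P i. f x) \<longlongrightarrow> (LINT x|Q. f x)) F)"

section \<open>The approximating processes\<close>

definition levy_coeff :: "(real \<Rightarrow> complex) \<Rightarrow> real \<Rightarrow> real" where
  "levy_coeff \<psi> u = sqrt ((cmod (\<psi> u))\<^sup>2 / (2 * Re (\<psi> u)))"

definition levy_approx ::
    "(real \<Rightarrow> 'a \<Rightarrow> real) \<Rightarrow> (real \<Rightarrow> complex) \<Rightarrow> real \<Rightarrow> real \<Rightarrow> real \<Rightarrow> 'a \<Rightarrow> complex" where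
  "levy_approx X \<psi> \<theta> \<epsilon> t \<omega> =
    of_real (\<epsilon> * levy_coeff \<psi> \<theta>) * (CLBINT s:{0..2 * t / \<epsilon>\<^sup>2}. iexp (\<theta> * X s \<omega>))"

end

theory Submission
  imports Defs "HOL-Real_Asymp.Real_Asymp"
begin

text \<open>Sample the process with mesh \<open>h = \<epsilon>\<^sup>4\<close>. The factors
  \<open>V\<^sub>i = exp (\<i>\<theta>(X\<^bsub>(i+1)h\<^esub> - X\<^bsub>ih\<^esub>))\<close> are i.i.d. on the unit circle, so with
  \<open>p = E V\<^sub>i\<close> and \<open>U\<^sub>k = V\<^sub>0 \<dots> V\<^bsub>k-1\<^esub>\<close> the Riemann sum of \<open>exp (\<i>\<theta>X)\<close> differs by a bounded term
  from the martingale \<open>\<Sum>\<^bsub>i<k\<^esub> U\<^sub>i D\<^sub>i\<close>, where \<open>D\<^sub>i = (V\<^sub>i - p) / (1 - p)\<close>. Conditionally on the past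
  the increment \<open>U\<^sub>i D\<^sub>i\<close> has the constant second absolute moment \<open>E \<bar>D\<bar>\<^sup>2\<close>, while its second moment
  \<open>U\<^sub>i\<^sup>2 E D\<^sup>2\<close> averages out because \<open>\<bar>E V\<^sub>i\<^sup>2\<bar> < 1\<close>; this is where \<open>Re (\<psi>(2\<theta>)) \<noteq> 0\<close> enters. An
  expansion of the characteristic function to second order then gives the joint characteristic
  functions of the increments, and Doob's inequality with a fourth moment bound controls the
  oscillation between grid points.

  To pass from there to weak convergence on the path space without Prokhorov's theorem, it suffices
  to test against Lipschitz functionals. The oscillation bound allows to replace a path by its linear
  interpolation on a grid, hence the functional by a function of finitely many increments \<open>u\<close>. After
  the further replacement of \<open>u\<close> by \<open>R sin (u / R)\<close>, the Stone-Weierstrass theorem on a compact box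
  approximates the functional uniformly by a trigonometric polynomial in \<open>u\<close>.\<close>

section \<open>Weak convergence through Lipschitz functionals\<close>

text \<open>Sampling leaves a sequence of independent factors, so conditioning on the past is only
  ever a factorisation of an expectation. The constant \<open>c(\<theta>)\<close> comes from
  \<open>E |D|^2 = (1 - |p|^2) / |1 - p|^2\<close>, which behaves like
  \<open>2 Re (\<psi> \<theta>) / (h |\<psi> \<theta>|^2)\<close>: scaled by
  \<open>\<epsilon> c(\<theta>) h\<close>, about \<open>2t / (\<epsilon>^2 h)\<close> steps
  accumulate the second moment \<open>2t = E |B t|^2\<close>. The mesh has to be fine relative to
  \<open>\<epsilon>\<close>: values of \<open>exp (i \<theta> X)\<close> within a cell differ in
  mean by at most order \<open>sqrt h\<close>, which over the time \<open>2T / \<epsilon>^2\<close>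
  and with the factor \<open>\<epsilon>\<close> gives a Riemann error of order
  \<open>sqrt h / \<epsilon>\<close>. The power \<open>h = \<epsilon>^4\<close> makes this of order
  \<open>\<epsilon>\<close>. Fourth moments enter because a second moment bounds the probability of
  a large move within a cell of length \<open>T / n\<close> only by order \<open>1 / n\<close>,
  which does not vanish when summed over \<open>n\<close> cells; the fourth moment gives order
  \<open>1 / n^2\<close> in the limit.\<close>

definition lip_on :: "'a metric \<Rightarrow> real \<Rightarrow> ('a \<Rightarrow> real) \<Rightarrow> bool" where
  "lip_on m L f \<longleftrightarrow> (\<forall>x\<in>mspace m. \<forall>y\<in>mspace m. \<bar>f x - f y\<bar> \<le> L * mdist m x y)"

text \<open>The Pasch-Hausdorff envelope: for \<open>f\<close> bounded below and
  \<open>k \<ge> 0\<close> it is the greatest \<open>k\<close>-Lipschitz minorant of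
  \<open>f\<close>.\<close>

definition lip_env :: "'a metric \<Rightarrow> ('a \<Rightarrow> real) \<Rightarrow> real \<Rightarrow> 'a \<Rightarrow> real" where
  "lip_env m f k x = (INF y\<in>mspace m. f y + k * mdist m x y)"

text \<open>The sign of \<open>L\<close> is left open in \<open>lip_on\<close>;
  \<open>\<bar>L\<bar> + 1\<close> is a positive constant by which later choices of a radius can
  divide.\<close>

lemma lip_on_bound:
  assumes "lip_on m L f" "x \<in> mspace m" "y \<in> mspace m" "mdist m x y \<le> d"
  shows "\<bar>f x - f y\<bar> \<le> (\<bar>L\<bar> + 1) * d"
proof -
  have "\<bar>f x - f y\<bar> \<le> L * mdist m x y" using assms unfolding lip_on_def by blast
  also have "\<dots> \<le> (\<bar>L\<bar> + 1) * mdist m x y" by (intro mult_right_mono) auto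
  also have "\<dots> \<le> (\<bar>L\<bar> + 1) * d" using assms(4) by (intro mult_left_mono) auto
  finally show ?thesis .
qed

lemma bdd_below_lip_env:
  assumes "\<And>y. y \<in> mspace m \<Longrightarrow> a \<le> f y" "0 \<le> k"
  shows "bdd_below ((\<lambda>y. f y + k * mdist m x y) ` mspace m)"
proof (rule bdd_belowI2)
  fix y assume "y \<in> mspace m"
  then show "a \<le> f y + k * mdist m x y"
    using assms(1)[of y] assms(2) by (simp add: add_increasing2)
qed

lemma lip_env_le:
  assumes "\<And>y. y \<in> mspace m \<Longrightarrow> a \<le> f y" "0 \<le> k" "x \<in> mspace m" "y \<in> mspace m"
  shows "lip_env m f k x \<le> f y + k * mdist m x y"
  unfolding lip_env_def using bdd_below_lip_env[where f = f and a = a and m = m] assms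
  by (intro cINF_lower) auto

lemma lip_env_le_self:
  assumes "\<And>y. y \<in> mspace m \<Longrightarrow> a \<le> f y" "0 \<le> k" "x \<in> mspace m"
  shows "lip_env m f k x \<le> f x"
  using lip_env_le[of m a f k x x] assms Metric_space.mdist_zero[OF Metric_space_mspace_mdist, of x m] by simp

lemma lip_env_ge:
  assumes "\<And>y. y \<in> mspace m \<Longrightarrow> a \<le> f y" "0 \<le> k" "x \<in> mspace m"
  shows "a \<le> lip_env m f k x"
  unfolding lip_env_def using assms by (intro cINF_greatest) (auto simp: add_increasing2)

lemma lip_on_lip_env:
  assumes "\<And>y. y \<in> mspace m \<Longrightarrow> a \<le> f y" "0 \<le> k"
  shows "lip_on m k (lip_env m f k)"
proof -
  interpret Metric_space "mspace m" "mdist m" by simp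
  have *: "lip_env m f k x - k * mdist m x y \<le> lip_env m f k y"
    if "x \<in> mspace m" "y \<in> mspace m" for x y
    unfolding lip_env_def[of m f k y]
  proof (rule cINF_greatest)
    fix z assume z: "z \<in> mspace m"
    have "lip_env m f k x \<le> f z + k * mdist m x z"
      using lip_env_le[of m a f k x z] assms that z by simp
    also have "k * mdist m x z \<le> k * (mdist m x y + mdist m y z)"
      using assms(2) that z by (intro mult_left_mono triangle)
    finally show "lip_env m f k x - k * mdist m x y \<le> f z + k * mdist m y z"
      by (simp add: algebra_simps)
  qed (use that in auto)
  show ?thesis
    unfolding lip_on_def
  proof (intro ballI)
    fix x y assume "x \<in> mspace m" "y \<in> mspace m"
    then show "\<bar>lip_env m f k x - lip_env m f k y\<bar> \<le> k * mdist m x y"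
      using *[of x y] *[of y x] by (simp add: commute[of y x] abs_le_iff)
  qed
qed

lemma continuous_lower_ball:
  fixes f :: "'a \<Rightarrow> real"
  assumes f: "continuous_map (mtopology_of m) euclideanreal f" and x: "x \<in> mspace m" and e: "0 < e"
  obtains r where "0 < r" "\<And>y. y \<in> mspace m \<Longrightarrow> mdist m x y < r \<Longrightarrow> f x - e < f y"
proof -
  interpret Metric_space "mspace m" "mdist m" by simp
  have "openin mtopology {y \<in> topspace mtopology. f y \<in> {f x - e<..}}"
    using f unfolding mtopology_of_def by (intro openin_continuous_map_preimage) auto
  then obtain r where "r > 0" "mball x r \<subseteq> {y \<in> topspace mtopology. f y \<in> {f x - e<..}}"
    using x e unfolding openin_mtopology by force
  then show ?thesis
    using x by (intro that[of r]) (auto simp: mball_def subset_eq)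
qed

text \<open>Competitors near \<open>x\<close> stay above \<open>f x - e/2\<close> by continuity; one
  at distance at least \<open>r\<close> pays a penalty that, for large \<open>n\<close>, outweighs
  the whole possible drop \<open>f x - a\<close>.\<close>

lemma lip_env_tendsto:
  assumes f: "continuous_map (mtopology_of m) euclideanreal f"
    and a: "\<And>y. y \<in> mspace m \<Longrightarrow> a \<le> f y" and x: "x \<in> mspace m"
  shows "(\<lambda>n. lip_env m f (real n) x) \<longlonglongrightarrow> f x"
proof (rule LIMSEQ_I)
  fix e :: real assume "0 < e"
  then obtain r where r: "0 < r" "\<And>y. y \<in> mspace m \<Longrightarrow> mdist m x y < r \<Longrightarrow> f x - e/2 < f y"
    using continuous_lower_ball[OF f x, of "e/2"] by auto
  obtain n0 :: nat where n0: "(f x - a) / r \<le> real n0"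
    using real_arch_simple by blast
  have "f x - e/2 \<le> lip_env m f (real n) x" if "n \<ge> n0" for n
    unfolding lip_env_def
  proof (rule cINF_greatest)
    fix y assume y: "y \<in> mspace m"
    show "f x - e/2 \<le> f y + real n * mdist m x y"
    proof (cases "mdist m x y < r")
      case True
      then have "f x - e/2 < f y" using r y by blast
      then show ?thesis by (simp add: add_increasing2)
    next
      case False
      have "f x - a \<le> real n0 * r" using n0 r(1) by (simp add: field_simps)
      also have "\<dots> \<le> real n * mdist m x y"
        using False r(1) that by (intro mult_mono) auto
      finally show ?thesis using a[OF y] \<open>0 < e\<close> by linarith
    qed
  qed (use x in auto)
  moreover have "lip_env m f (real n) x \<le> f x" for n
    using lip_env_le_self[of m a f "real n" x] a x by auto
  ultimately have "norm (lip_env m f (real n) x - f x) < e" if "n \<ge> n0" for n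
    using \<open>0 < e\<close> that by (smt (verit) field_sum_of_halves real_norm_def)
  then show "\<exists>no. \<forall>n\<ge>no. norm (lip_env m f (real n) x - f x) < e" by blast
qed

lemma lip_on_continuous_map:
  assumes "lip_on m L f" 
  shows "continuous_map (mtopology_of m) euclideanreal f"
proof -
  interpret Metric_space "mspace m" "mdist m" by simp
  show ?thesis
    unfolding continuous_map_def
  proof (intro conjI allI impI)
    fix U :: "real set" assume "openin euclideanreal U"
    then have U: "open U" by simp
    show "openin (mtopology_of m) {x \<in> topspace (mtopology_of m). f x \<in> U}"
      unfolding mtopology_of_def openin_mtopology
    proof (intro conjI allI impI)
      fix x assume x: "x \<in> {x \<in> topspace mtopology. f x \<in> U}"
      then obtain e where e: "e > 0" "ball (f x) e \<subseteq> U"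
        using U open_contains_ball by blast
      have "mball x (e / (\<bar>L\<bar> + 1)) \<subseteq> {x \<in> topspace mtopology. f x \<in> U}"
      proof
        fix y assume y: "y \<in> mball x (e / (\<bar>L\<bar> + 1))"
        then have d: "mdist m x y * (\<bar>L\<bar> + 1) < e" and ym: "y \<in> mspace m"
          by (auto simp: field_simps)
        have "\<bar>f x - f y\<bar> \<le> L * mdist m x y"
          using assms x ym unfolding lip_on_def by auto
        also have "\<dots> \<le> (\<bar>L\<bar> + 1) * mdist m x y"
          by (intro mult_right_mono) auto
        finally have "f y \<in> ball (f x) e"
          using d by (simp add: dist_real_def mult.commute)
        then show "y \<in> {x \<in> topspace mtopology. f x \<in> U}" using e ym by auto
      qed
      then show "\<exists>r>0. mball x r \<subseteq> {x \<in> topspace mtopology. f x \<in> U}"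
        using e by (intro exI[of _ "e / (\<bar>L\<bar> + 1)"]) (auto intro!: divide_pos_pos)
    qed auto
  qed auto
qed

section \<open>Borel sets of a metric space and tests by Lipschitz functions\<close>

lemma space_metric_borel [simp]: "space (metric_borel m) = mspace m"
  unfolding metric_borel_def by (rule space_measure_of) (use openin_subset[of "mtopology_of m"] in auto)

lemma sets_metric_borel: "sets (metric_borel m) = sigma_sets (mspace m) {U. openin (mtopology_of m) U}"
  unfolding metric_borel_def by (rule sets_measure_of) (use openin_subset[of "mtopology_of m"] in auto)

lemma continuous_map_metric_borel:
  fixes f :: "'a \<Rightarrow> real"
  assumes "continuous_map (mtopology_of m) euclideanreal f"
  shows "f \<in> borel_measurable (metric_borel m)"
proof (rule borel_measurableI)
  fix S :: "real set" assume "open S"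
  then have "openin (mtopology_of m) {x \<in> topspace (mtopology_of m). f x \<in> S}"
    using assms by (intro openin_continuous_map_preimage) auto
  moreover have "{x \<in> topspace (mtopology_of m). f x \<in> S} = f -` S \<inter> space (metric_borel m)" by auto
  ultimately show "f -` S \<inter> space (metric_borel m) \<in> sets (metric_borel m)"
    unfolding sets_metric_borel by (auto intro!: sigma_sets.Basic)
qed

text \<open>Open sets generate the Borel sets, and each open set is the positivity set of a
  Lipschitz function. This reduces measurability of a path map to real-valued functionals, which are
  accessible as limits of functions of finitely many increments.\<close>

lemma measurable_metric_borelI_lip:
  assumes Y: "\<And>w. w \<in> space M \<Longrightarrow> Y w \<in> mspace m"
    and lip: "\<And>L f. lip_on m L f \<Longrightarrow> (\<lambda>w. f (Y w)) \<in> borel_measurable M"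
  shows "Y \<in> measurable M (metric_borel m)"
  unfolding metric_borel_def
proof (rule measurable_measure_of)
  interpret Metric_space "mspace m" "mdist m" by simp
  fix U assume "U \<in> {U. openin (mtopology_of m) U}"
  then have U: "openin mtopology U" by (simp add: mtopology_of_def)
  txt \<open>This envelope is positive exactly on the open set \<open>U\<close>.\<close>
  define g where "g = lip_env m (indicator U) 1"
  have [measurable]: "(\<lambda>w. g (Y w)) \<in> borel_measurable M"
    unfolding g_def by (rule lip[OF lip_on_lip_env[where a = 0]]) auto
  have g: "0 < g x \<longleftrightarrow> x \<in> U" if x: "x \<in> mspace m" for x
  proof
    assume "x \<in> U"
    then obtain r where r: "r > 0" "mball x r \<subseteq> U"
      using U unfolding openin_mtopology by blast
    have "min 1 r \<le> g x"
      unfolding g_def lip_env_def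
    proof (rule cINF_greatest)
      fix y assume "y \<in> mspace m"
      then show "min 1 r \<le> indicator U y + 1 * mdist m x y"
        using r x by (cases "mdist m x y < r") (auto simp: indicator_def subset_eq intro: add_increasing2)
    qed (use x in auto)
    then show "0 < g x" using r by auto
  next
    assume "0 < g x"
    then show "x \<in> U"
      using lip_env_le_self[of m 0 "indicator U" 1 x] x by (cases "x \<in> U") (auto simp: g_def)
  qed
  have "Y -` U \<inter> space M = {w \<in> space M. 0 < g (Y w)}"
    using g Y by auto
  then show "Y -` U \<inter> space M \<in> sets M" by simp
qed (use Y openin_subset[of "mtopology_of m"] in auto)

text \<open>Lipschitz envelopes approach \<open>f\<close> from below, so convergence for one of them
  bounds the limit inferior of the integrals of \<open>f\<close>; the same bound for
  \<open>- f\<close> controls the limit superior.\<close>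

lemma weakly_convergesI_lip:
  assumes P: "\<And>i. prob_space (P i)" "\<And>i. sets (P i) = sets (metric_borel m)"
    and Q: "prob_space Q" "sets Q = sets (metric_borel m)"
    and lim: "\<And>L K f. lip_on m L f \<Longrightarrow> (\<And>x. x \<in> mspace m \<Longrightarrow> \<bar>f x\<bar> \<le> K)
      \<Longrightarrow> ((\<lambda>i. LINT x|P i. f x) \<longlongrightarrow> (LINT x|Q. f x)) F"
  shows "weakly_converges m P Q F"
proof -
  have sp: "space (P i) = mspace m" "space Q = mspace m" for i
    using sets_eq_imp_space_eq[OF P(2)] sets_eq_imp_space_eq[OF Q(2)] by auto
  have int: "integrable (P i) f" "integrable Q f"
    if "continuous_map (mtopology_of m) euclideanreal f" "\<And>x. x \<in> mspace m \<Longrightarrow> \<bar>f x\<bar> \<le> K" for f K i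
  proof -
    interpret P: prob_space "P i" by (rule P)
    interpret Q: prob_space Q by (rule Q)
    note m = continuous_map_metric_borel[OF that(1)]
    have "f \<in> borel_measurable (P i)" "f \<in> borel_measurable Q"
      using m measurable_cong_sets[OF P(2) refl] measurable_cong_sets[OF Q(2) refl] by blast+
    then show "integrable (P i) f" "integrable Q f"
      using that(2) sp
      by (auto intro!: P.integrable_const_bound[where B = K] Q.integrable_const_bound[where B = K])
  qed
  have lower: "\<forall>\<^sub>F i in F. (LINT x|Q. f x) - e < (LINT x|P i. f x)"
    if f: "continuous_map (mtopology_of m) euclideanreal f"
      and K: "\<And>x. x \<in> mspace m \<Longrightarrow> \<bar>f x\<bar> \<le> K" and e: "0 < e" for f K and e :: real
  proof -
    have fK: "- K \<le> f x" if "x \<in> mspace m" for x using K[OF that] by linarith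
    define g where "g n = lip_env m f (real n)" for n
    have gl: "lip_on m (real n) (g n)" for n
      unfolding g_def using fK by (intro lip_on_lip_env[where a = "-K"]) auto
    have gle: "g n x \<le> f x" if "x \<in> mspace m" for n x
      unfolding g_def using fK that by (intro lip_env_le_self[where a = "-K"]) auto
    have gge: "- K \<le> g n x" if "x \<in> mspace m" for n x
      unfolding g_def using fK that by (intro lip_env_ge) auto
    have gb: "\<bar>g n x\<bar> \<le> K" if "x \<in> mspace m" for n x
      using gle[OF that, of n] gge[OF that, of n] K[OF that] by (simp add: abs_le_iff)
    interpret Q: prob_space Q by (rule Q)
    have "(\<lambda>n. LINT x|Q. g n x) \<longlonglongrightarrow> (LINT x|Q. f x)"
    proof (rule integral_dominated_convergence[where w = "\<lambda>_. K"])
      show "f \<in> borel_measurable Q" using int(2)[OF f K] by auto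
      show "g n \<in> borel_measurable Q" for n
        using int(2)[OF lip_on_continuous_map[OF gl] gb] by auto
      show "AE x in Q. (\<lambda>n. g n x) \<longlonglongrightarrow> f x"
        using lip_env_tendsto[OF f fK] sp by (auto simp: g_def)
    qed (use gb sp in auto)
    then obtain n where n: "(LINT x|Q. f x) - e/2 < (LINT x|Q. g n x)"
      using e by (auto dest!: order_tendstoD(1)[where a = "(LINT x|Q. f x) - e/2"] eventually_happens)
    have "\<forall>\<^sub>F i in F. (LINT x|Q. g n x) - e/2 < (LINT x|P i. g n x)"
      using lim[OF gl gb, of n] e by (intro order_tendstoD(1)) auto
    then show ?thesis
    proof eventually_elim
      case (elim i)
      have "(LINT x|P i. g n x) \<le> (LINT x|P i. f x)"
        using gle sp by (intro integral_mono int(1)[OF f K] int(1)[OF lip_on_continuous_map[OF gl] gb]) auto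
      then show ?case using elim n by linarith
    qed
  qed
  show ?thesis
    unfolding weakly_converges_def
  proof (intro allI impI, elim conjE)
    fix f assume f: "continuous_map (mtopology_of m) euclideanreal f" and "bounded (f ` mspace m)"
    then obtain K where K: "\<And>x. x \<in> mspace m \<Longrightarrow> \<bar>f x\<bar> \<le> K"
      unfolding bounded_iff by auto
    show "((\<lambda>i. LINT x|P i. f x) \<longlongrightarrow> (LINT x|Q. f x)) F"
    proof (rule order_tendstoI)
      fix a assume "a < (LINT x|Q. f x)"
      then show "\<forall>\<^sub>F i in F. a < (LINT x|P i. f x)"
        using lower[OF f K, of "(LINT x|Q. f x) - a"] by simp
    next
      fix a assume a: "(LINT x|Q. f x) < a"
      have "\<forall>\<^sub>F i in F. (LINT x|Q. - f x) - (a - (LINT x|Q. f x)) < (LINT x|P i. - f x)"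
        using f K a by (intro lower[where K = K]) (auto intro!: continuous_intros)
      then show "\<forall>\<^sub>F i in F. (LINT x|P i. f x) < a" by simp
    qed
  qed
qed

section \<open>Continuous paths and their linear interpolations\<close>

lemma continuous_on_restrict_iff: "continuous_on S (restrict f S) \<longleftrightarrow> continuous_on S f"
  by (rule continuous_on_cong) auto

text \<open>Compactness of \<open>{0..T}\<close> makes the boundedness built into
  \<open>cfunspace\<close> automatic.\<close>

lemma mspace_path_space:
  "x \<in> mspace (path_space T) \<longleftrightarrow> x \<in> extensional {0..T} \<and> continuous_on {0..T} x"
proof -
  have "compactin (top_of_set {0..T}) (topspace (top_of_set {0..T}))"
    by (simp add: compactin_subtopology)
  then show ?thesis
    unfolding path_space_def by (subst compactin_mspace_cfunspace) auto
qed

lemma path_space_dist_le: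
  assumes "0 \<le> T" "x \<in> mspace (path_space T)" "y \<in> mspace (path_space T)"
    "\<And>t. t \<in> {0..T} \<Longrightarrow> norm (x t - y t) \<le> a"
  shows "mdist (path_space T) x y \<le> a"
  using assms cfunspace_mdist_le[of x "top_of_set {0..T}" euclidean_metric y a]
  unfolding path_space_def by (auto simp: dist_norm)

lemma grid_point:
  assumes "0 < T" "r \<le> n"
  shows "T * real r / real n \<in> {0..T}"
proof -
  have "T * real r \<le> T * real n" using assms by (intro mult_left_mono) auto
  then show ?thesis using assms by (cases "n = 0") (auto simp: pos_divide_le_eq)
qed

text \<open>Parametrised by increments instead of values: the clipped ramp multiplying
  \<open>u r\<close> is 0 before cell \<open>r\<close>, linear across it and 1 afterwards. The
  resulting path starts at 0, is linear in \<open>u\<close>, and is visibly continuous in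
  \<open>t\<close>.\<close>

definition interp :: "real \<Rightarrow> nat \<Rightarrow> (nat \<Rightarrow> complex) \<Rightarrow> real \<Rightarrow> complex" where
  "interp T n u = (\<lambda>t\<in>{0..T}. \<Sum>r<n. of_real (max 0 (min 1 (real n * t / T - real r))) * u r)"

definition grid_incr :: "real \<Rightarrow> nat \<Rightarrow> (real \<Rightarrow> complex) \<Rightarrow> nat \<Rightarrow> complex" where
  "grid_incr T n x r = x (T * real (Suc r) / real n) - x (T * real r / real n)"

lemma interp_in_path_space: "0 < T \<Longrightarrow> interp T n u \<in> mspace (path_space T)"
  unfolding mspace_path_space interp_def continuous_on_restrict_iff
  by (auto intro!: continuous_intros)

lemma interp_dist_le:
  assumes "0 < T"
  shows "mdist (path_space T) (interp T n u) (interp T n v) \<le> (\<Sum>r<n. norm (u r - v r))"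
proof (rule path_space_dist_le)
  fix t assume t: "t \<in> {0..T}"
  let ?c = "\<lambda>r. max 0 (min 1 (real n * t / T - real r))"
  have "norm (interp T n u t - interp T n v t) = norm (\<Sum>r<n. of_real (?c r) * (u r - v r))"
    using t by (simp add: interp_def sum_subtractf algebra_simps)
  also have "\<dots> \<le> (\<Sum>r<n. norm (u r - v r))"
  proof (rule sum_norm_le)
    fix r
    have "\<bar>?c r\<bar> * norm (u r - v r) \<le> 1 * norm (u r - v r)"
      by (intro mult_right_mono) auto
    then show "norm (of_real (?c r) * (u r - v r)) \<le> norm (u r - v r)"
      by (simp add: norm_mult)
  qed
  finally show "norm (interp T n u t - interp T n v t) \<le> (\<Sum>r<n. norm (u r - v r))" .
qed (use assms interp_in_path_space in auto)

lemma lip_interp_bound: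
  assumes f: "lip_on (path_space T) L f" and T: "0 < T"
  shows "\<bar>f (interp T n u) - f (interp T n v)\<bar> \<le> (\<bar>L\<bar> + 1) * (\<Sum>r<n. norm (u r - v r))"
  by (rule lip_on_bound[OF f]) (auto simp: interp_in_path_space interp_dist_le T)

text \<open>A one-sided substitute for the modulus of continuity: displacements are measured from
  the left end of a cell only, which is the quantity a maximal inequality controls.\<close>

definition grid_osc_le :: "real \<Rightarrow> nat \<Rightarrow> real \<Rightarrow> (real \<Rightarrow> complex) \<Rightarrow> bool" where
  "grid_osc_le T n d x \<longleftrightarrow> (\<forall>j<n. \<forall>t\<in>{T * real j / real n..T * real (Suc j) / real n}.
      norm (x t - x (T * real j / real n)) \<le> d)"

lemma grid_osc_le_incr:
  assumes "grid_osc_le T n d x" "j < n" "0 < T"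
  shows "norm (grid_incr T n x j) \<le> d"
  using assms unfolding grid_osc_le_def grid_incr_def
  by (auto simp: field_simps)

lemma sum_grid_incr:
  assumes "x 0 = 0" "j \<le> n"
  shows "(\<Sum>r<j. grid_incr T n x r) = x (T * real j / real n)"
  using sum_lessThan_telescope[of "\<lambda>r. x (T * real r / real n)" j] assms
  by (simp add: grid_incr_def)

lemma grid_cell:
  assumes "0 < T" "0 < n" "t \<in> {0..T}"
  obtains j where "j < n" "t \<in> {T * real j / real n..T * real (Suc j) / real n}"
proof (cases "t = T")
  case True
  \<comment> \<open>The floor formula would assign index \<open>n\<close> to the right end point; it
    belongs to the last closed cell.\<close>
  then show ?thesis using assms by (intro that[of "n - 1"]) (auto simp: field_simps of_nat_diff)
next
  case False
  define j where "j = nat \<lfloor>real n * t / T\<rfloor>"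
  have nn: "0 \<le> real n * t / T" using assms by auto
  have *: "real j \<le> real n * t / T" "real n * t / T < real (Suc j)"
    using nn of_nat_floor[OF nn] by (auto simp: j_def) linarith
  have "real n * t / T < real n" using False assms by (auto simp: field_simps)
  then have "j < n" using * by linarith
  then show ?thesis using * assms by (intro that[of j]) (auto simp: field_simps)
qed

text \<open>The interpolation agrees with \<open>x\<close> at the left end of the cell. From there
  \<open>x\<close> moves by at most \<open>d\<close>, and the interpolation by a fraction of the
  cell increment, again at most \<open>d\<close>.\<close>

lemma interp_close:
  assumes T: "0 < T" and n: "0 < n" and x: "x 0 = 0" and osc: "grid_osc_le T n d x" and t: "t \<in> {0..T}"
  shows "norm (x t - interp T n (grid_incr T n x) t) \<le> 2 * d"
proof -
  obtain j where j: "j < n" "t \<in> {T * real j / real n..T * real (Suc j) / real n}"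
    using grid_cell[OF T n t] by blast
  then have s: "real j \<le> real n * t / T" "real n * t / T \<le> real (Suc j)"
    using T n by (auto simp: field_simps)
  define c where "c r = max 0 (min 1 (real n * t / T - real r))" for r
  have c1: "c r = 1" if "r < j" for r using that s by (auto simp: c_def)
  have c0: "c r = 0" if "j < r" for r using that s by (auto simp: c_def)
  let ?u = "grid_incr T n x"
  have "interp T n ?u t = (\<Sum>r<n. of_real (c r) * ?u r)"
    using t by (simp add: interp_def c_def)
  also have "\<dots> = (\<Sum>r<Suc j. of_real (c r) * ?u r)"
    using j c0 by (intro sum.mono_neutral_right) auto
  also have "\<dots> = (\<Sum>r<j. ?u r) + of_real (c j) * ?u j"
    using c1 by simp
  also have "(\<Sum>r<j. ?u r) = x (T * real j / real n)"
    using sum_grid_incr[of x j n T, OF x] j by simp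
  finally have "x t - interp T n ?u t = (x t - x (T * real j / real n)) - of_real (c j) * ?u j"
    by simp
  also have "norm \<dots> \<le> norm (x t - x (T * real j / real n)) + norm (of_real (c j) * ?u j)"
    by (rule norm_triangle_ineq4)
  also have "\<dots> \<le> d + 1 * d"
  proof (rule add_mono)
    show "norm (x t - x (T * real j / real n)) \<le> d"
      using osc j unfolding grid_osc_le_def by auto
    show "norm (of_real (c j) * ?u j) \<le> 1 * d"
      unfolding norm_mult using grid_osc_le_incr[OF osc j(1) T]
      by (intro mult_mono) (auto simp: c_def)
  qed
  finally show ?thesis by simp
qed

lemma continuous_grid_osc:
  assumes T: "0 < T" and x: "continuous_on {0..T} x" and d: "0 < d"
  shows "\<exists>n0. \<forall>n\<ge>n0. grid_osc_le T n d x"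
proof -
  have "uniformly_continuous_on {0..T} x"
    using x by (intro compact_uniformly_continuous) auto
  then obtain e where e: "e > 0" "\<And>s t. s \<in> {0..T} \<Longrightarrow> t \<in> {0..T} \<Longrightarrow> dist t s < e \<Longrightarrow> dist (x t) (x s) < d"
    using d unfolding uniformly_continuous_on_def by metis
  obtain n0 :: nat where n0: "T / e < real n0" using reals_Archimedean2 by blast
  have "grid_osc_le T n d x" if n: "n \<ge> n0" for n
    unfolding grid_osc_le_def
  proof (intro allI impI ballI)
    fix j t assume j: "j < n" and t: "t \<in> {T * real j / real n..T * real (Suc j) / real n}"
    have n0': "0 < real n" using j by auto
    have "T / e < real n" using n n0 by linarith
    then have Tn: "T / real n < e" using e n0' by (simp add: field_simps)
    have "T * real (Suc j) \<le> T * real n" using T j by (intro mult_left_mono) auto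
    then have *: "0 \<le> T * real j / real n" "T * real (Suc j) / real n \<le> T"
      using T n0' by (auto simp: field_simps)
    have "T * real (Suc j) / real n = T * real j / real n + T / real n"
      by (simp add: ring_distribs add_divide_distrib)
    then have "t - T * real j / real n \<le> T / real n" using t by auto
    then have "dist t (T * real j / real n) < e" using t Tn by (auto simp: dist_real_def)
    moreover have "T * real j / real n \<le> T"
      using * t by auto
    ultimately have "dist (x t) (x (T * real j / real n)) < d"
      using * t by (intro e(2)) auto
    then show "norm (x t - x (T * real j / real n)) \<le> d" by (simp add: dist_norm)
  qed
  then show ?thesis by blast
qed

text \<open>Vectors of increments live in \<open>nat \<Rightarrow> complex\<close> with the product
  topology for every grid size. The bound involves finitely many coordinates, each of which is
  continuous for that topology.\<close>

lemma continuous_coordinates_lipschitz: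
  fixes F :: "(nat \<Rightarrow> complex) \<Rightarrow> real"
  assumes "\<And>u v. \<bar>F u - F v\<bar> \<le> L * (\<Sum>r<n. norm (u r - v r))"
  shows "continuous_on UNIV F"
  unfolding continuous_on_def
proof
  fix u :: "nat \<Rightarrow> complex"
  have c: "isCont (\<lambda>v :: nat \<Rightarrow> complex. v r) u" for r
  proof -
    have "continuous_on UNIV (\<lambda>v :: nat \<Rightarrow> complex. v r)" by (rule continuous_on_product_coordinates)
    then show ?thesis unfolding continuous_on_eq_continuous_at[OF open_UNIV] by simp
  qed
  have "((\<lambda>v. L * (\<Sum>r<n. norm (v r - u r))) \<longlongrightarrow> L * (\<Sum>r<n. norm (u r - u r))) (at u)"
    using c unfolding continuous_within by (intro tendsto_intros) 
  then have "((\<lambda>v. L * (\<Sum>r<n. norm (v r - u r))) \<longlongrightarrow> 0) (at u)" by simp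
  then have "((\<lambda>v. F v - F u) \<longlongrightarrow> 0) (at u)"
    by (rule Lim_null_comparison[rotated]) (use assms in auto)
  then show "(F \<longlongrightarrow> F u) (at u within UNIV)" by (simp add: LIM_zero_iff)
qed

lemma measurable_fun_nat:
  fixes U :: "'a \<Rightarrow> nat \<Rightarrow> complex"
  assumes "continuous_on UNIV (F :: (nat \<Rightarrow> complex) \<Rightarrow> real)" "\<And>r. (\<lambda>w. U w r) \<in> borel_measurable M"
  shows "(\<lambda>w. F (U w)) \<in> borel_measurable M"
proof -
  have "U \<in> measurable M borel"
    by (rule measurable_coordinatewise_then_product) (use assms in auto)
  then show ?thesis
    using borel_measurable_continuous_onI[OF assms(1)] by simp
qed

section \<open>Random continuous paths, their increments and their laws\<close>

locale path_process = prob_space +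
  fixes T :: real and Y :: "real \<Rightarrow> 'a \<Rightarrow> complex"
  assumes T: "0 < T"
    and Y_measurable: "t \<in> {0..T} \<Longrightarrow> Y t \<in> borel_measurable M"
    and Y_continuous: "w \<in> space M \<Longrightarrow> continuous_on {0..T} (\<lambda>t. Y t w)"
    and Y_start: "w \<in> space M \<Longrightarrow> Y 0 w = 0"
begin

definition path :: "'a \<Rightarrow> real \<Rightarrow> complex" where "path w = (\<lambda>t\<in>{0..T}. Y t w)"

text \<open>Padding by 0 from index \<open>n\<close> on keeps the increments of all grids in one
  type and inside a compact box after squashing.\<close>

definition incr :: "nat \<Rightarrow> 'a \<Rightarrow> nat \<Rightarrow> complex" where
  "incr n w = (\<lambda>r. if r < n then grid_incr T n (\<lambda>t. Y t w) r else 0)"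

lemma path_in_space: "w \<in> space M \<Longrightarrow> path w \<in> mspace (path_space T)"
  using Y_continuous unfolding mspace_path_space path_def continuous_on_restrict_iff by auto

lemma incr_measurable [measurable]: "(\<lambda>w. incr n w r) \<in> borel_measurable M"
proof (cases "r < n")
  case True
  then have "T * real (Suc r) / real n \<in> {0..T}" "T * real r / real n \<in> {0..T}"
    by (auto intro!: grid_point T simp del: of_nat_Suc atLeastAtMost_iff)
  then show ?thesis
    using True Y_measurable by (simp add: incr_def grid_incr_def borel_measurable_diff del: atLeastAtMost_iff of_nat_Suc)
qed (simp add: incr_def)

lemma path_dist_interp:
  assumes "w \<in> space M" "0 < n" "grid_osc_le T n d (\<lambda>t. Y t w)"
  shows "mdist (path_space T) (path w) (interp T n (incr n w)) \<le> 2 * d"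
proof (rule path_space_dist_le)
  fix t assume t: "t \<in> {0..T}"
  have "interp T n (incr n w) = interp T n (grid_incr T n (\<lambda>t. Y t w))"
    unfolding interp_def incr_def by (intro ext) auto
  then show "norm (path w t - interp T n (incr n w) t) \<le> 2 * d"
    using interp_close[OF T assms(2) Y_start[OF assms(1)] assms(3) t] t by (simp add: path_def)
qed (use T assms path_in_space interp_in_path_space in auto)

lemma lip_interp_continuous:
  assumes f: "lip_on (path_space T) L f"
  shows "continuous_on UNIV (\<lambda>u. f (interp T n u))"
  by (rule continuous_coordinates_lipschitz) (rule lip_interp_bound[OF f T])

lemma lip_interp_tendsto:
  assumes f: "lip_on (path_space T) L f" and w: "w \<in> space M"
  shows "(\<lambda>n. f (interp T n (incr n w))) \<longlonglongrightarrow> f (path w)"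
proof (rule LIMSEQ_I)
  fix e :: real assume "0 < e"
  define d where "d = e / (4 * (\<bar>L\<bar> + 1))"
  have d: "d > 0" using \<open>0 < e\<close> by (simp add: d_def)
  then obtain n0 where n0: "\<And>n. n \<ge> n0 \<Longrightarrow> grid_osc_le T n d (\<lambda>t. Y t w)"
    using continuous_grid_osc[OF T Y_continuous[OF w]] by blast
  have "norm (f (interp T n (incr n w)) - f (path w)) < e" if "n \<ge> Suc n0" for n
  proof -
    have "\<bar>f (path w) - f (interp T n (incr n w))\<bar> \<le> (\<bar>L\<bar> + 1) * (2 * d)"
      using path_dist_interp[OF w _ n0] that
      by (intro lip_on_bound[OF f] path_in_space[OF w] interp_in_path_space[OF T]) auto
    also have "\<dots> = e / 2" using abs_ge_zero[of L] by (simp add: d_def divide_simps)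
    also have "\<dots> < e" using \<open>0 < e\<close> by simp
    finally show ?thesis by (simp add: abs_minus_commute)
  qed
  then show "\<exists>no. \<forall>n\<ge>no. norm (f (interp T n (incr n w)) - f (path w)) < e" by blast
qed

text \<open>Evaluated at an interpolated path, \<open>f\<close> is a continuous function of
  measurable increments; measurability then passes to the limit of finer grids.\<close>

lemma lip_path_measurable:
  assumes f: "lip_on (path_space T) L f"
  shows "(\<lambda>w. f (path w)) \<in> borel_measurable M"
  by (rule borel_measurable_LIMSEQ_real[OF lip_interp_tendsto[OF f]])
     (auto intro!: measurable_fun_nat[OF lip_interp_continuous[OF f]])

lemma path_measurable: "path \<in> measurable M (metric_borel (path_space T))"
  by (rule measurable_metric_borelI_lip) (auto simp: path_in_space intro: lip_path_measurable)

lemma path_law_eq: "path_law M T Y = distr M (metric_borel (path_space T)) path"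
  unfolding path_law_def path_def by simp

lemma prob_space_path_law: "prob_space (path_law M T Y)"
  unfolding path_law_eq by (rule prob_space_distr[OF path_measurable])

lemma integral_path_law:
  assumes "lip_on (path_space T) L f"
  shows "(LINT x|path_law M T Y. f x) = expectation (\<lambda>w. f (path w))"
  unfolding path_law_eq
  by (rule integral_distr[OF path_measurable continuous_map_metric_borel[OF lip_on_continuous_map[OF assms]]])

lemma lip_interp_expectation_tendsto:
  assumes f: "lip_on (path_space T) L f" and K: "\<And>x. x \<in> mspace (path_space T) \<Longrightarrow> \<bar>f x\<bar> \<le> K"
  shows "(\<lambda>n. expectation (\<lambda>w. f (interp T n (incr n w)))) \<longlonglongrightarrow> expectation (\<lambda>w. f (path w))"
proof (rule integral_dominated_convergence[where w = "\<lambda>_. K"])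
  show "(\<lambda>w. f (interp T n (incr n w))) \<in> borel_measurable M" for n
    by (intro measurable_fun_nat[OF lip_interp_continuous[OF f]]) simp
qed (use lip_path_measurable[OF f] lip_interp_tendsto[OF f] K interp_in_path_space[OF T] in auto)

end

section \<open>Trigonometric approximation\<close>

text \<open>Trigonometric polynomials in \<open>n\<close> plane vectors:
  \<open>Re (cnj (\<mu> r) * u r)\<close> is the real inner product, so their expectations are
  linear combinations of values of a characteristic function.\<close>

inductive_set trig :: "nat \<Rightarrow> ((nat \<Rightarrow> complex) \<Rightarrow> complex) set" for n where
  cis: "(\<lambda>u. c * cis (\<Sum>r<n. Re (cnj (\<mu> r) * u r))) \<in> trig n"
| add: "f \<in> trig n \<Longrightarrow> g \<in> trig n \<Longrightarrow> (\<lambda>u. f u + g u) \<in> trig n"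

lemma trig_const: "(\<lambda>u. c) \<in> trig n"
  using trig.cis[of c "\<lambda>_. 0" n] by simp

lemma trig_mult_cis:
  assumes "f \<in> trig n"
  shows "(\<lambda>u. f u * (c * cis (\<Sum>r<n. Re (cnj (\<mu> r) * u r)))) \<in> trig n"
  using assms
proof induction
  case (cis c' \<mu>')
  have "(\<lambda>u. c' * cis (\<Sum>r<n. Re (cnj (\<mu>' r) * u r)) * (c * cis (\<Sum>r<n. Re (cnj (\<mu> r) * u r))))
    = (\<lambda>u. (c' * c) * cis (\<Sum>r<n. Re (cnj (\<mu>' r + \<mu> r) * u r)))"
    by (rule ext) (simp only: complex_cnj_add ring_distribs plus_complex.simps sum.distrib flip: cis_mult, simp)
  then show ?case by (simp only: trig.cis)
next
  case (add f g)
  show ?case using trig.add[OF add.IH] by (simp only: ring_distribs)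
qed

lemma trig_mult:
  assumes f: "f \<in> trig n" and g: "g \<in> trig n"
  shows "(\<lambda>u. f u * g u) \<in> trig n"
  using g
proof induction
  case (cis c \<mu>)
  show ?case by (rule trig_mult_cis[OF f])
next
  case (add g h)
  show ?case using trig.add[OF add.IH] by (simp only: ring_distribs)
qed

text \<open>Euler's formula, with the frequencies \<open>\<mu>\<close> and
  \<open>- \<mu>\<close>.\<close>

lemma trig_sin:
  assumes \<mu>: "\<And>u. (\<Sum>r<n. Re (cnj (\<mu> r) * u r)) = a u"
  shows "(\<lambda>u. of_real (R * sin (a u))) \<in> trig n"
proof -
  have "(\<lambda>u. of_real (R * sin (a u))) = (\<lambda>u. (of_real R / (2 * \<i>)) * cis (\<Sum>r<n. Re (cnj (\<mu> r) * u r))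
      + (- of_real R / (2 * \<i>)) * cis (\<Sum>r<n. Re (cnj (- \<mu> r) * u r)))"
  proof
    fix u
    have "(\<Sum>r<n. Re (cnj (- \<mu> r) * u r)) = - a u"
      unfolding \<mu>[symmetric] sum_negf[symmetric] by simp
    then show "of_real (R * sin (a u)) = (of_real R / (2 * \<i>)) * cis (\<Sum>r<n. Re (cnj (\<mu> r) * u r))
      + (- of_real R / (2 * \<i>)) * cis (\<Sum>r<n. Re (cnj (- \<mu> r) * u r))"
      unfolding \<mu> by (simp add: complex_eq_iff cis.code)
  qed
  then show ?thesis by (simp only:) (intro trig.add trig.cis)
qed

text \<open>A sine serves better than a sharp truncation: it is bounded, close to the identity for
  large \<open>R\<close>, and itself a trigonometric polynomial, so that polynomials in squashed
  coordinates stay in \<open>trig n\<close>.\<close>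

definition squash :: "real \<Rightarrow> nat \<Rightarrow> (nat \<Rightarrow> complex) \<Rightarrow> nat \<Rightarrow> complex" where
  "squash R n u r = (if r < n then Complex (R * sin (Re (u r) / R)) (R * sin (Im (u r) / R)) else 0)"

lemma trig_squash_coordinate:
  assumes "r < n"
  shows "(\<lambda>u. of_real (R * sin (Re (cnj a * u r)))) \<in> trig n"
proof (rule trig_sin)
  fix u
  have "(\<Sum>s<n. Re (cnj (if s = r then a else 0) * u s)) = (\<Sum>s\<in>{r}. Re (cnj (if s = r then a else 0) * u s))"
    using assms by (intro sum.mono_neutral_right) auto
  then show "(\<Sum>s<n. Re (cnj (if s = r then a else 0) * u s)) = Re (cnj a * u r)" by simp
qed

lemma trig_squash_Re: "r < n \<Longrightarrow> (\<lambda>u. of_real (Re (squash R n u r))) \<in> trig n"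
  using trig_squash_coordinate[of r n R "of_real (1 / R)"] by (simp add: squash_def)

lemma trig_squash_Im: "r < n \<Longrightarrow> (\<lambda>u. of_real (Im (squash R n u r))) \<in> trig n"
  using trig_squash_coordinate[of r n R "\<i> * of_real (1 / R)"] by (simp add: squash_def)

lemma squash_measurable [measurable]:
  assumes [measurable]: "\<And>r. (\<lambda>w. u w r) \<in> borel_measurable M"
  shows "(\<lambda>w. squash R n (u w) r) \<in> borel_measurable M"
  unfolding squash_def Complex_eq by measurable

lemma squash_continuous: "continuous_on UNIV (squash R n)"
proof (rule continuous_on_coordinatewise_then_product)
  fix r
  have "continuous_on UNIV (\<lambda>u :: nat \<Rightarrow> complex. u r)" by (rule continuous_on_product_coordinates)
  then show "continuous_on UNIV (\<lambda>u. squash R n u r)"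
    unfolding squash_def Complex_eq divide_inverse by (cases "r < n") (auto intro!: continuous_intros)
qed

text \<open>Taylor expansion of the sine with quadratic remainder, applied to real and imaginary
  parts; the two squares add up to the squared modulus.\<close>

lemma squash_close:
  assumes "0 < R" "r < n"
  shows "norm (squash R n u r - u r) \<le> (norm (u r))^2 / (2 * R)"
proof -
  have *: "\<bar>R * sin (x / R) - x\<bar> \<le> x^2 / (2 * R)" for x
  proof -
    have "\<bar>sin (x / R) - (\<Sum>m<2. sin_coeff m * (x / R) ^ m)\<bar> \<le> inverse (fact 2) * \<bar>x / R\<bar> ^ 2"
      by (rule Maclaurin_sin_bound)
    then have "\<bar>sin (x / R) - x / R\<bar> \<le> (x / R)^2 / 2"
      by (simp add: numeral_2_eq_2 sin_coeff_def)
    then have "R * \<bar>sin (x / R) - x / R\<bar> \<le> R * ((x / R)^2 / 2)"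
      using assms by (intro mult_left_mono) auto
    moreover have "R * \<bar>sin (x / R) - x / R\<bar> = \<bar>R * sin (x / R) - x\<bar>"
      using assms by (simp add: abs_mult_pos' right_diff_distrib)
    ultimately show ?thesis using assms by (simp add: power2_eq_square divide_simps mult_ac)
  qed
  have "norm (squash R n u r - u r) \<le> \<bar>Re (squash R n u r - u r)\<bar> + \<bar>Im (squash R n u r - u r)\<bar>"
    by (rule cmod_le)
  also have "\<dots> \<le> (Re (u r))^2 / (2 * R) + (Im (u r))^2 / (2 * R)"
    using assms *[of "Re (u r)"] *[of "Im (u r)"] by (simp add: squash_def)
  finally show ?thesis by (simp add: cmod_power2 add_divide_distrib)
qed

lemma norm_squash_le: "0 < R \<Longrightarrow> norm (squash R n u r) \<le> 2 * R"
proof -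
  assume R: "0 < R"
  have "\<bar>R * sin x\<bar> \<le> R * 1" for x
    unfolding abs_mult using R by (intro mult_mono) auto
  from this[of "Re (u r) / R"] this[of "Im (u r) / R"] show ?thesis
    using cmod_le[of "squash R n u r"] R by (auto simp: squash_def)
qed

text \<open>Stone-Weierstrass is applied to the algebra \<open>Q\<close> of functions that become
  trigonometric polynomials when composed with \<open>squash R n\<close>. Since squashing maps every
  \<open>u\<close> into the box \<open>S\<close>, uniform approximation on \<open>S\<close> gives a
  bound for all \<open>u\<close>.\<close>

lemma trig_dense_squash:
  fixes F :: "(nat \<Rightarrow> complex) \<Rightarrow> real"
  assumes F: "continuous_on UNIV F" and R: "0 < R" and e: "0 < e"
  obtains h where "h \<in> trig n" "\<And>u. \<bar>F (squash R n u) - Re (h u)\<bar> < e"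
proof -
  \<comment> \<open>The factor \<open>{0}\<close> for coordinates from \<open>n\<close> on keeps
    \<open>S\<close> compact and leaves only the first \<open>n\<close> coordinates to separate
    points.\<close>
  define S :: "(nat \<Rightarrow> complex) set" where "S = PiE UNIV (\<lambda>r. if r < n then cball 0 (2 * R) else {0})"
  define Q :: "((nat \<Rightarrow> complex) \<Rightarrow> real) set"
    where "Q = {g. continuous_on S g \<and> (\<lambda>u. of_real (g (squash R n u))) \<in> trig n}"
  have sq: "squash R n u \<in> S" for u
  proof -
    have "squash R n u r = 0" if "\<not> r < n" for r using that by (simp add: squash_def)
    then show ?thesis using norm_squash_le[OF R, of n u] by (auto simp: S_def)
  qed
  have cmp: "compact S"
  proof -
    have "compactin (product_topology (\<lambda>_. euclidean) UNIV) S"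
      unfolding S_def by (auto simp: compactin_PiE)
    then show ?thesis by (simp add: euclidean_product_topology)
  qed
  have coord: "continuous_on S (\<lambda>w :: nat \<Rightarrow> complex. w r)" for r
    by (rule continuous_on_subset[OF continuous_on_product_coordinates]) simp
  interpret function_ring_on Q S
  proof
    fix f g assume "f \<in> Q" "g \<in> Q"
    then show "(\<lambda>x. f x + g x) \<in> Q" "(\<lambda>x. f x * g x) \<in> Q"
      by (auto simp: Q_def intro!: continuous_intros trig.add trig_mult)
  next
    fix x y assume xy: "x \<in> S" "y \<in> S" "x \<noteq> y"
    then obtain r where r: "x r \<noteq> y r" by blast
    have "r < n"
    proof (rule ccontr)
      assume "\<not> r < n"
      then have "x r = 0" "y r = 0"
        using PiE_mem[OF xy(1)[unfolded S_def], of r] PiE_mem[OF xy(2)[unfolded S_def], of r] by auto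
      then show False using r by simp
    qed
    then have "(\<lambda>w. Re (w r)) \<in> Q" "(\<lambda>w. Im (w r)) \<in> Q"
      by (auto simp: Q_def trig_squash_Re trig_squash_Im intro!: continuous_intros coord)
    moreover have "Re (x r) \<noteq> Re (y r) \<or> Im (x r) \<noteq> Im (y r)"
      using r by (auto simp: complex_eq_iff)
    ultimately show "\<exists>f\<in>Q. f x \<noteq> f y" by (auto intro: bexI[of _ "\<lambda>w. Re (w r)"] bexI[of _ "\<lambda>w. Im (w r)"])
  qed (auto simp: Q_def cmp trig_const)
  have "\<exists>G\<in>UNIV \<rightarrow> Q. LIM n sequentially. G n :> uniformly_on S F"
    by (rule Stone_Weierstrass) (rule continuous_on_subset[OF F], simp)
  then obtain G where G: "\<And>k. G k \<in> Q" "uniform_limit S G F sequentially"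
    by auto
  then obtain k where k: "\<And>x. x \<in> S \<Longrightarrow> dist (G k x) (F x) < e"
    using e by (auto dest!: uniform_limitD[where e = e] eventually_happens)
  show ?thesis
    by (rule that[of "\<lambda>u. of_real (G k (squash R n u))"])
       (use G(1)[of k] k[OF sq] in \<open>auto simp: Q_def dist_real_def abs_minus_commute\<close>)
qed

text \<open>The integrands differ by at most \<open>a\<close> on \<open>A\<close>, and by at most
  \<open>2 * K\<close> on its complement, which has probability at most \<open>e\<close>.\<close>

lemma (in prob_space) expectation_close:
  fixes X Z :: "'a \<Rightarrow> real"
  assumes [measurable]: "X \<in> borel_measurable M" "Z \<in> borel_measurable M" "A \<in> sets M"
    and X: "\<And>w. w \<in> space M \<Longrightarrow> \<bar>X w\<bar> \<le> K" and Z: "\<And>w. w \<in> space M \<Longrightarrow> \<bar>Z w\<bar> \<le> K"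
    and A: "1 - e \<le> prob A" and a: "0 \<le> a" "\<And>w. w \<in> A \<Longrightarrow> \<bar>X w - Z w\<bar> \<le> a"
  shows "\<bar>expectation X - expectation Z\<bar> \<le> a + 2 * K * e"
proof -
  have int: "integrable M X" "integrable M Z"
    using X Z by (auto intro!: integrable_const_bound[where B = K])
  have K: "0 \<le> K" using X not_empty by (metis abs_ge_zero all_not_in_conv order_trans)
  have "\<bar>expectation X - expectation Z\<bar> = \<bar>expectation (\<lambda>w. X w - Z w)\<bar>" using int by simp
  also have "\<dots> \<le> expectation (\<lambda>w. \<bar>X w - Z w\<bar>)"
    by (rule integral_abs_bound)
  also have "\<dots> \<le> expectation (\<lambda>w. a + 2 * K * indicator (space M - A) w)"
  proof (rule integral_mono)
    fix w assume w: "w \<in> space M"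
    show "\<bar>X w - Z w\<bar> \<le> a + 2 * K * indicator (space M - A) w"
      using a X[OF w] Z[OF w] w K by (cases "w \<in> A") (auto simp: abs_le_iff)
  next
    show "integrable M (\<lambda>w. a + 2 * K * indicator (space M - A) w)"
      using a K by (intro integrable_const_bound[where B = "a + 2 * K"]) (auto simp: indicator_def)
  qed (use int in auto)
  also have "\<dots> = expectation (\<lambda>w. a) + expectation (\<lambda>w. 2 * K * indicator (space M - A) w)"
    by (rule Bochner_Integration.integral_add)
       (auto intro!: integrable_mult_right integrable_const_bound[where B = 1])
  also have "expectation (\<lambda>w. 2 * K * indicator (space M - A) w) = 2 * K * prob ((space M - A) \<inter> space M)"
    by (simp only: integral_mult_right_zero Bochner_Integration.integral_indicator)
  also have "expectation (\<lambda>w. a) = a" by (simp add: prob_space)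
  also have "(space M - A) \<inter> space M = space M - A" by auto
  also have "a + 2 * K * prob (space M - A) \<le> a + 2 * K * e"
    using A K prob_compl[of A] by (auto intro!: mult_left_mono)
  finally show ?thesis .
qed

lemma (in path_process) trig_incr:
  assumes "h \<in> trig n"
  shows "(\<lambda>w. h (incr n w)) \<in> borel_measurable M \<and> (\<exists>K. \<forall>u. norm (h u) \<le> K)"
  using assms
proof induction
  case (cis c \<mu>)
  have "(\<lambda>w. cis (\<Sum>r<n. Re (cnj (\<mu> r) * incr n w r))) \<in> borel_measurable M"
    by (rule borel_measurable_continuous_on[where f = cis]) (auto intro!: continuous_intros)
  then show ?case by (auto simp: norm_mult)
next
  case (add f g)
  then obtain K K' where "\<And>u. norm (f u) \<le> K" "\<And>u. norm (g u) \<le> K'" by auto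
  then have "norm (f u + g u) \<le> K + K'" for u by (intro norm_triangle_mono)
  then have "\<exists>K. \<forall>u. norm (f u + g u) \<le> K" by blast
  moreover have "(\<lambda>w. f (incr n w) + g (incr n w)) \<in> borel_measurable M"
    using add.IH by (intro borel_measurable_add) auto
  ultimately show ?case by blast
qed

lemma (in path_process) trig_expectation_close:
  assumes h: "h \<in> trig n" and close: "\<And>u. \<bar>H u - Re (h u)\<bar> < e"
    and H: "integrable M (\<lambda>w. H (incr n w))"
  shows "\<bar>expectation (\<lambda>w. H (incr n w)) - Re (expectation (\<lambda>w. h (incr n w)))\<bar> \<le> e"
proof -
  have i: "integrable M (\<lambda>w. h (incr n w))"
    using trig_incr[OF h] by (auto intro!: integrable_const_bound)
  have "expectation (\<lambda>w. H (incr n w)) - Re (expectation (\<lambda>w. h (incr n w)))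
    = expectation (\<lambda>w. H (incr n w) - Re (h (incr n w)))"
    using i H by simp
  also have "\<bar>\<dots>\<bar> \<le> expectation (\<lambda>w. \<bar>H (incr n w) - Re (h (incr n w))\<bar>)"
    by (rule integral_abs_bound)
  also have "\<dots> \<le> expectation (\<lambda>w. e)"
    using close i H by (intro integral_mono) (auto intro: less_imp_le)
  finally show ?thesis by (simp add: prob_space)
qed

lemma trig_expectation_tendsto:
  assumes Y: "\<And>i. path_process M T (Y i)" and B: "path_process N T B"
    and fdd: "\<And>\<mu>. ((\<lambda>i. LINT w|M. cis (\<Sum>r<n. Re (cnj (\<mu> r) * path_process.incr T (Y i) n w r)))
      \<longlongrightarrow> (LINT w|N. cis (\<Sum>r<n. Re (cnj (\<mu> r) * path_process.incr T B n w r)))) F"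
    and h: "h \<in> trig n"
  shows "((\<lambda>i. LINT w|M. h (path_process.incr T (Y i) n w))
      \<longlongrightarrow> (LINT w|N. h (path_process.incr T B n w))) F"
  using h
proof induction
  case (cis c \<mu>)
  show ?case using tendsto_mult_left[OF fdd, of c] by simp
next
  case (add f g)
  interpret Y: path_process M T "Y i" for i by (rule Y)
  interpret B: path_process N T B by (rule B)
  have "integrable M (\<lambda>w. f (Y.incr i n w)) \<and> integrable N (\<lambda>w. f (B.incr n w))" if "f \<in> trig n" for f i
    using Y.trig_incr[OF that, of i] B.trig_incr[OF that]
    by (auto intro!: Y.integrable_const_bound B.integrable_const_bound)
  with add show ?case by (auto intro!: tendsto_intros simp: Bochner_Integration.integral_add)
qed

lemma lip_interp_squash_bound:
  assumes f: "lip_on (path_space T) L f" and T: "0 < T" and R: "0 < R"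
    and u: "\<And>r. r < n \<Longrightarrow> norm (u r) \<le> b"
  shows "\<bar>f (interp T n u) - f (interp T n (squash R n u))\<bar> \<le> (\<bar>L\<bar> + 1) * (real n * b^2) / (2 * R)"
proof -
  have "(\<Sum>r<n. norm (u r - squash R n u r)) \<le> (\<Sum>r<n. b^2 / (2 * R))"
  proof (rule sum_mono)
    fix r assume r: "r \<in> {..<n}"
    then have "norm (squash R n u r - u r) \<le> (norm (u r))^2 / (2 * R)"
      using squash_close[OF R] by auto
    also have "\<dots> \<le> b^2 / (2 * R)"
      using u[of r] r R by (intro divide_right_mono power_mono) auto
    finally show "norm (u r - squash R n u r) \<le> b^2 / (2 * R)" by (simp add: norm_minus_commute)
  qed
  then have "(\<bar>L\<bar> + 1) * (\<Sum>r<n. norm (u r - squash R n u r)) \<le> (\<bar>L\<bar> + 1) * (real n * (b^2 / (2 * R)))"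
    by (intro mult_left_mono) auto
  then show ?thesis
    using lip_interp_bound[OF f T, of n u "squash R n u"] by simp
qed

text \<open>Meant for the limit process, whose increments admit no common bound over all
  \<open>w\<close>: for each fixed \<open>w\<close> they are bounded, and domination by
  \<open>K\<close> does the rest.\<close>

lemma (in path_process) squash_expectation_tendsto:
  assumes f: "lip_on (path_space T) L f" and K: "\<And>x. x \<in> mspace (path_space T) \<Longrightarrow> \<bar>f x\<bar> \<le> K"
  shows "(\<lambda>k. expectation (\<lambda>w. f (interp T n (squash (real k) n (incr n w)))))
    \<longlonglongrightarrow> expectation (\<lambda>w. f (interp T n (incr n w)))"
proof (rule integral_dominated_convergence[where w = "\<lambda>_. K"])
  show "(\<lambda>w. f (interp T n (squash (real k) n (incr n w)))) \<in> borel_measurable M" for k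
    by (rule measurable_fun_nat[OF lip_interp_continuous[OF f]]) simp
  show "(\<lambda>w. f (interp T n (incr n w))) \<in> borel_measurable M"
    by (rule measurable_fun_nat[OF lip_interp_continuous[OF f]]) simp
  show "AE w in M. (\<lambda>k. f (interp T n (squash (real k) n (incr n w)))) \<longlonglongrightarrow> f (interp T n (incr n w))"
  proof (rule AE_I2)
    fix w
    define b where "b = Max (insert 0 ((\<lambda>r. norm (incr n w r)) ` {..<n}))"
    have b: "norm (incr n w r) \<le> b" if "r < n" for r
      unfolding b_def using that by (intro Max_ge) auto
    have "(\<lambda>k. (\<bar>L\<bar> + 1) * (real n * b^2) / (2 * real k)) \<longlonglongrightarrow> 0"
      by real_asymp
    moreover have "\<forall>\<^sub>F k in sequentially. norm (f (interp T n (squash (real k) n (incr n w))) - f (interp T n (incr n w)))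
      \<le> (\<bar>L\<bar> + 1) * (real n * b^2) / (2 * real k)"
      using eventually_gt_at_top[of 0]
    proof eventually_elim
      case (elim k)
      then show ?case
        using lip_interp_squash_bound[OF f T, of "real k" n "incr n w" b] b by (simp add: abs_minus_commute)
    qed
    ultimately have "(\<lambda>k. f (interp T n (squash (real k) n (incr n w))) - f (interp T n (incr n w))) \<longlonglongrightarrow> 0"
      by (rule Lim_null_comparison[rotated])
    then show "(\<lambda>k. f (interp T n (squash (real k) n (incr n w)))) \<longlonglongrightarrow> f (interp T n (incr n w))"
      by (simp add: LIM_zero_iff)
  qed
qed (use K interp_in_path_space[OF T] in auto)

text \<open>Tightness of the increments is not assumed separately: the oscillation bound confines them to
  the unit ball with high probability.\<close>

theorem path_convergence_criterion:
  assumes Y: "\<And>i. path_process M T (Y i)" and B: "path_process N T B"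
    and fdd: "\<And>n \<mu>. 0 < n \<Longrightarrow>
      ((\<lambda>i. LINT w|M. cis (\<Sum>r<n. Re (cnj (\<mu> r) * path_process.incr T (Y i) n w r)))
      \<longlongrightarrow> (LINT w|N. cis (\<Sum>r<n. Re (cnj (\<mu> r) * path_process.incr T B n w r)))) F"
    and osc: "\<And>d e. 0 < d \<Longrightarrow> 0 < e \<Longrightarrow> \<exists>n0. \<forall>n\<ge>n0. \<forall>\<^sub>F i in F.
      \<exists>A\<in>sets M. 1 - e \<le> measure M A \<and> (\<forall>w\<in>A. grid_osc_le T n d (\<lambda>t. Y i t w))"
  shows "weakly_converges (path_space T) (\<lambda>i. path_law M T (Y i)) (path_law N T B) F"
proof (rule weakly_convergesI_lip)
  interpret Y: path_process M T "Y i" for i by (rule Y)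
  interpret B: path_process N T B by (rule B)
  note T = B.T
  show "prob_space (path_law M T (Y i))" "prob_space (path_law N T B)" for i
    by (rule Y.prob_space_path_law B.prob_space_path_law)+
  show "sets (path_law M T (Y i)) = sets (metric_borel (path_space T))"
    "sets (path_law N T B) = sets (metric_borel (path_space T))" for i
    by (simp_all add: path_law_def)
  fix L K and f :: "(real \<Rightarrow> complex) \<Rightarrow> real"
  assume f: "lip_on (path_space T) L f" and K: "\<And>x. x \<in> mspace (path_space T) \<Longrightarrow> \<bar>f x\<bar> \<le> K"
  have K0: "0 \<le> K" using K[OF interp_in_path_space[OF T]] by (rule order_trans[OF abs_ge_zero])
  note fK = K[OF interp_in_path_space[OF T]]
  \<comment> \<open>The budget is \<open>2 * e\<close> each for interpolating and squashing
    \<open>Y\<close>, \<open>e\<close> for its trigonometric approximation, \<open>e\<close> for the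
    convergence of characteristic functions, and three times \<open>e\<close> for the way back to
    \<open>B\<close>: in total 9.\<close>
  have main: "\<forall>\<^sub>F i in F. \<bar>Y.expectation (\<lambda>w. f (Y.path i w)) - B.expectation (\<lambda>w. f (B.path w))\<bar> < 10 * e"
    if e: "0 < e" for e
  proof -
    define a where "a = e / (2 * (K + 1))"
    have a: "0 < a" "2 * K * a \<le> e" using K0 e by (auto simp: a_def field_simps)
    \<comment> \<open>The bound 1 confines the increments to the unit ball, where squashing has a
      uniform error; the other bound makes the interpolation error at most \<open>e\<close>.\<close>
    define d where "d = min 1 (e / (2 * (\<bar>L\<bar> + 1)))"
    have d: "0 < d" "d \<le> 1" "(\<bar>L\<bar> + 1) * (2 * d) \<le> e"
    proof -
      have "(\<bar>L\<bar> + 1) * (2 * d) \<le> (\<bar>L\<bar> + 1) * (2 * (e / (2 * (\<bar>L\<bar> + 1))))"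
        by (intro mult_left_mono) (auto simp: d_def)
      also have "\<dots> = e" using abs_ge_zero[of L] by (simp add: divide_simps)
      finally show "(\<bar>L\<bar> + 1) * (2 * d) \<le> e" .
    qed (use e in \<open>auto simp: d_def\<close>)
    obtain n0 where n0: "\<And>n. n \<ge> n0 \<Longrightarrow> \<forall>\<^sub>F i in F. \<exists>A\<in>sets M. 1 - a \<le> measure M A \<and>
        (\<forall>w\<in>A. grid_osc_le T n d (\<lambda>t. Y i t w))"
      using osc[OF d(1) a(1)] by blast
    have "\<forall>\<^sub>F n in sequentially. \<bar>B.expectation (\<lambda>w. f (interp T n (B.incr n w))) - B.expectation (\<lambda>w. f (B.path w))\<bar> < e"
      using B.lip_interp_expectation_tendsto[OF f K] e unfolding tendsto_iff dist_real_def by blast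
    then have "\<forall>\<^sub>F n in sequentially. n \<ge> n0 \<and> n > 0 \<and> \<bar>B.expectation (\<lambda>w. f (interp T n (B.incr n w))) - B.expectation (\<lambda>w. f (B.path w))\<bar> < e"
      using eventually_ge_at_top[of n0] eventually_gt_at_top[of 0] by eventually_elim auto
    then obtain n where n: "n \<ge> n0" "n > 0"
      "\<bar>B.expectation (\<lambda>w. f (interp T n (B.incr n w))) - B.expectation (\<lambda>w. f (B.path w))\<bar> < e"
      using eventually_happens'[OF sequentially_bot] by blast
    define G where "G u = f (interp T n u)" for u
    have Gc: "continuous_on UNIV G" unfolding G_def by (rule B.lip_interp_continuous[OF f])
    \<comment> \<open>The squashing radius is chosen after the grid, because its error bound grows
      with \<open>n\<close>.\<close>
    have "(\<lambda>k. (\<bar>L\<bar> + 1) * (real n * 1^2) / (2 * real k)) \<longlonglongrightarrow> 0"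
      by real_asymp
    then have "\<forall>\<^sub>F k in sequentially. (\<bar>L\<bar> + 1) * (real n * 1^2) / (2 * real k) < e"
      using e by (intro order_tendstoD(2))
    moreover have "\<forall>\<^sub>F k in sequentially. \<bar>B.expectation (\<lambda>w. G (squash (real k) n (B.incr n w))) - B.expectation (\<lambda>w. G (B.incr n w))\<bar> < e"
      using B.squash_expectation_tendsto[OF f K] e unfolding tendsto_iff dist_real_def G_def by blast
    ultimately have "\<forall>\<^sub>F k in sequentially. k > 0 \<and> (\<bar>L\<bar> + 1) * (real n * 1^2) / (2 * real k) < e \<and>
       \<bar>B.expectation (\<lambda>w. G (squash (real k) n (B.incr n w))) - B.expectation (\<lambda>w. G (B.incr n w))\<bar> < e"
      using eventually_gt_at_top[of 0] by eventually_elim auto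
    then obtain k where k: "k > 0" "(\<bar>L\<bar> + 1) * (real n * 1^2) / (2 * real k) < e"
       "\<bar>B.expectation (\<lambda>w. G (squash (real k) n (B.incr n w))) - B.expectation (\<lambda>w. G (B.incr n w))\<bar> < e"
      using eventually_happens'[OF sequentially_bot] by blast
    define H where "H u = G (squash (real k) n u)" for u
    obtain h where h: "h \<in> trig n" "\<And>u. \<bar>H u - Re (h u)\<bar> < e"
      using trig_dense_squash[OF Gc, of "real k" e n] k(1) e unfolding H_def by auto
    have GK: "\<bar>G u\<bar> \<le> K" "\<bar>H u\<bar> \<le> K" for u using fK by (auto simp: G_def H_def)
    have HcK: "continuous_on UNIV H"
      unfolding H_def
      by (rule continuous_on_compose2[OF Gc])
         (auto intro: squash_continuous)
    have Gm[measurable]: "(\<lambda>w. G (Y.incr i n w)) \<in> borel_measurable M" "(\<lambda>w. H (Y.incr i n w)) \<in> borel_measurable M"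
      "(\<lambda>w. H (B.incr n w)) \<in> borel_measurable N" for i
      by (auto intro!: measurable_fun_nat Gc HcK)
    have Hi: "integrable M (\<lambda>w. H (Y.incr i n w))" "integrable N (\<lambda>w. H (B.incr n w))" for i
      using GK by (auto intro!: Y.integrable_const_bound[where B = K] B.integrable_const_bound[where B = K])
    note Yh = Y.trig_expectation_close[OF h Hi(1)]
    note Bh = B.trig_expectation_close[OF h Hi(2)]
    have "((\<lambda>i. Re (Y.expectation (\<lambda>w. h (Y.incr i n w)))) \<longlongrightarrow> Re (B.expectation (\<lambda>w. h (B.incr n w)))) F"
      by (intro tendsto_Re trig_expectation_tendsto[OF Y B fdd[OF n(2)] h(1)])
    then have "\<forall>\<^sub>F i in F. \<bar>Re (Y.expectation (\<lambda>w. h (Y.incr i n w))) - Re (B.expectation (\<lambda>w. h (B.incr n w)))\<bar> < e"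
      using e unfolding tendsto_iff dist_real_def by blast
    then show ?thesis
      using n0[OF n(1)]
    proof eventually_elim
      case (elim i)
      then obtain A where A: "A \<in> sets M" "1 - a \<le> measure M A" "\<And>w. w \<in> A \<Longrightarrow> grid_osc_le T n d (\<lambda>t. Y i t w)"
        by blast
      have Asp: "w \<in> space M" if "w \<in> A" for w using that A(1) sets.sets_into_space by blast
      have 1: "\<bar>Y.expectation (\<lambda>w. f (Y.path i w)) - Y.expectation (\<lambda>w. G (Y.incr i n w))\<bar> \<le> e + 2 * K * a"
      proof (rule Y.expectation_close[OF _ _ A(1)])
        fix w assume w: "w \<in> A"
        have "\<bar>f (Y.path i w) - G (Y.incr i n w)\<bar> \<le> (\<bar>L\<bar> + 1) * (2 * d)"
          unfolding G_def
          by (intro lip_on_bound[OF f] Y.path_in_space Asp[OF w] interp_in_path_space[OF T]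
              Y.path_dist_interp[OF Asp[OF w] n(2) A(3)[OF w]])
        then show "\<bar>f (Y.path i w) - G (Y.incr i n w)\<bar> \<le> e" using d by linarith
      qed (use Y.lip_path_measurable[OF f] K Y.path_in_space GK A e in auto)
      have 2: "\<bar>Y.expectation (\<lambda>w. G (Y.incr i n w)) - Y.expectation (\<lambda>w. H (Y.incr i n w))\<bar> \<le> e + 2 * K * a"
      proof (rule Y.expectation_close[OF _ _ A(1)])
        fix w assume w: "w \<in> A"
        have "norm (Y.incr i n w r) \<le> 1" if "r < n" for r
          using grid_osc_le_incr[OF A(3)[OF w] that T] d that by (simp add: Y.incr_def)
        then show "\<bar>G (Y.incr i n w) - H (Y.incr i n w)\<bar> \<le> e"
          using lip_interp_squash_bound[OF f T, of "real k" n "Y.incr i n w" 1] k by (simp add: G_def H_def)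
      qed (use GK A e in auto)
      show ?case
        using 1 2 Yh[of i] Bh elim(1) k(3) n(3) a(2) e unfolding G_def H_def by linarith
    qed
  qed
  have "((\<lambda>i. Y.expectation (\<lambda>w. f (Y.path i w))) \<longlongrightarrow> B.expectation (\<lambda>w. f (B.path w))) F"
    unfolding tendsto_iff dist_real_def
  proof (intro allI impI)
    fix e :: real assume "0 < e"
    then show "\<forall>\<^sub>F i in F. \<bar>Y.expectation (\<lambda>w. f (Y.path i w)) - B.expectation (\<lambda>w. f (B.path w))\<bar> < e"
      using main[of "e / 10"] by simp
  qed
  then show "((\<lambda>i. LINT x|path_law M T (Y i). f x) \<longlongrightarrow> (LINT x|path_law N T B. f x)) F"
    by (simp add: Y.integral_path_law[OF f] B.integral_path_law[OF f])
qed

section \<open>Estimates for the complex exponential\<close>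

lemma cis_measurable [measurable]: "cis \<in> borel_measurable borel"
  by (rule borel_measurable_continuous_onI) (intro continuous_intros)

lemma cnj_measurable [measurable]: "cnj \<in> borel_measurable borel"
  by (rule borel_measurable_continuous_onI) (intro continuous_intros)

lemma norm_cis_minus_linear: "norm (cis x - 1 - \<i> * of_real x) \<le> x^2 / 2"
  using iexp_approx1[of x 1] by (simp add: cis_conv_exp algebra_simps power2_eq_square)

lemma norm_cis_minus_1: "norm (cis x - 1) \<le> \<bar>x\<bar>"
  using iexp_approx1[of x 0] by (simp add: cis_conv_exp)

lemma norm_cis_minus_quadratic: "norm (cis x - (1 + \<i> * of_real x - (of_real x)^2 / 2)) \<le> \<bar>x\<bar> ^ 3 / 6"
  using iexp_approx1[of x 2] by (simp add: cis_conv_exp numeral_2_eq_2 numeral_3_eq_3 algebra_simps)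

text \<open>Each term on the right is a factor built from \<open>w\<close> and \<open>u\<close>,
  which will depend on the past, times one of \<open>d\<close>, \<open>cnj d\<close>,
  \<open>d^2\<close>, \<open>(cnj d)^2\<close>, \<open>d * cnj d\<close>, which will be independent
  of it. The modulus 1 of \<open>u\<close> removes the rotation from the last term only.\<close>

lemma cis_quadratic_expand:
  fixes w u d l :: complex
  assumes "u * cnj u = 1"
  defines "x \<equiv> complex_of_real (Re (cnj l * (u * d)))"
  shows "w * (1 + \<i> * x - x^2 / 2) = w + (\<i> * cnj l / 2) * ((w * u) * d) + (\<i> * l / 2) * ((w * cnj u) * cnj d)
    - ((cnj l)^2 / 8) * ((w * u^2) * d^2) - (l^2 / 8) * ((w * (cnj u)^2) * (cnj d)^2)
    - (l * cnj l / 4) * (w * (d * cnj d))"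
proof -
  have x: "x = (cnj l * (u * d) + l * (cnj u * cnj d)) / 2"
    unfolding x_def using complex_add_cnj[of "cnj l * (u * d)"] by simp
  have "x^2 = ((cnj l)^2 * (u^2 * d^2) + l^2 * ((cnj u)^2 * (cnj d)^2) + 2 * (l * cnj l) * ((u * cnj u) * (d * cnj d))) / 4"
    unfolding x by (simp add: power2_eq_square field_simps)
  then show ?thesis unfolding assms(1) unfolding x by (simp add: field_simps)
qed

lemma exp_neg_approx:
  fixes a :: real assumes "0 \<le> a"
  shows "\<bar>1 - a - exp (- a)\<bar> \<le> a^2"
proof -
  have "1 + - a \<le> exp (- a)" by (rule exp_ge_add_one_self)
  moreover have "exp (- a) \<le> 1 - a + a^2"
  proof -
    have "1 + a \<le> exp a" by (rule exp_ge_add_one_self)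
    then have "exp (- a) \<le> 1 / (1 + a)"
      using assms by (simp add: exp_minus divide_simps)
    also have "\<dots> \<le> 1 - a + a^2"
    proof -
      have "1 \<le> (1 - a + a^2) * (1 + a)"
        using assms by (simp add: algebra_simps power2_eq_square)
      then show ?thesis using assms by (simp add: divide_simps)
    qed
    finally show ?thesis .
  qed
  ultimately show ?thesis by (simp add: abs_le_iff)
qed

lemma norm_cis_diff: "norm (cis a - cis b) \<le> \<bar>a - b\<bar>"
proof -
  have "cis a - cis b = cis b * (cis (a - b) - 1)" by (simp add: right_diff_distrib cis_mult)
  then show ?thesis using norm_cis_minus_1[of "a - b"] by (simp add: norm_mult)
qed

lemma cis_sum: "cis (\<Sum>r\<in>I. f r) = (\<Prod>r\<in>I. cis (f r))"
  by (induction I rule: infinite_finite_induct) (auto simp flip: cis_mult)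

lemma norm_exp_minus_one_le:
  fixes z :: complex assumes "Re z \<le> 0"
  shows "norm (exp z - 1) \<le> norm z"
proof -
  have "norm (exp z - exp 0) \<le> 1 * norm (z - 0)"
  proof (rule field_differentiable_bound[where S = "{w. Re w \<le> 0}" and f' = exp])
    show "convex {w. Re w \<le> 0}" by (rule convex_halfspace_Re_le)
    show "norm (exp w) \<le> 1" if "w \<in> {w. Re w \<le> 0}" for w using that by (simp add: norm_exp_eq_Re)
  qed (use assms in \<open>auto intro!: derivative_eq_intros\<close>)
  then show ?thesis by simp
qed

lemma norm_sum_sq: "(norm (s + d))^2 = (norm s)^2 + 2 * Re (cnj s * d) + (norm d)^2" for s d :: complex
  unfolding cmod_power2 by (simp add: power2_eq_square algebra_simps)

text \<open>The term linear in \<open>d\<close> is kept exact because its mean will vanish. In the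
  expansion of \<open>(|s|^2 + 2r + |d|^2)^2\<close> with \<open>r = Re (cnj s * d)\<close>, the
  constants arise as \<open>8 = 4 + 2 + 2\<close> and \<open>3 = 1 + 2\<close>, the final 2 in each
  coming from \<open>2r \<le> |s|^2 + |d|^2\<close>.\<close>

lemma fourth_power_bound:
  fixes s d :: complex and b :: real
  assumes "norm d \<le> b"
  shows "(norm (s + d)) ^ 4 \<le> (norm s) ^ 4 + 8 * ((norm s)^2 * (norm d)^2) + 3 * b^2 * (norm d)^2
    + 4 * ((norm s)^2 * Re (cnj s * d))"
proof -
  let ?a = "norm s" and ?d = "norm d" and ?r = "Re (cnj s * d)"
  have r: "\<bar>?r\<bar> \<le> ?a * ?d" using abs_Re_le_cmod[of "cnj s * d"] by (simp add: norm_mult)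
  have r2: "?r^2 \<le> ?a^2 * ?d^2"
    using power_mono[OF r, of 2] by (simp add: power_mult_distrib)
  have d2: "?d^2 \<le> b^2" using assms by (intro power_mono) auto
  have "2 * ?r \<le> ?a^2 + ?d^2"
    using r sum_squares_bound[of ?a ?d] by linarith
  then have rd: "?d^2 * (2 * ?r) \<le> ?d^2 * (?a^2 + ?d^2)" by (intro mult_left_mono) auto
  have dd: "?d^2 * ?d^2 \<le> b^2 * ?d^2" by (intro mult_right_mono d2) auto
  have "(norm (s + d)) ^ 4 = ((norm (s + d))^2)^2" by simp
  also have "\<dots> = (?a^2 + 2 * ?r + ?d^2)^2" by (simp only: norm_sum_sq)
  also have "\<dots> = ?a ^ 4 + 4 * ?r^2 + ?d^2 * ?d^2 + 4 * (?a^2 * ?r) + 2 * (?a^2 * ?d^2) + 2 * (?d^2 * (2 * ?r))"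
    by (simp add: power2_eq_square power4_eq_xxxx algebra_simps)
  also have "\<dots> \<le> ?a ^ 4 + 4 * (?a^2 * ?d^2) + b^2 * ?d^2 + 4 * (?a^2 * ?r) + 2 * (?a^2 * ?d^2) + 2 * (?d^2 * (?a^2 + ?d^2))"
    by (intro add_mono mult_left_mono r2 dd rd order_refl) auto
  also have "\<dots> \<le> ?a ^ 4 + 8 * (?a^2 * ?d^2) + 3 * b^2 * ?d^2 + 4 * (?a^2 * ?r)"
    using dd by (simp add: ring_distribs mult.commute[of "?d^2" "?a^2"])
  finally show ?thesis .
qed

text \<open>Adding up the recursion shows that \<open>(1 - r) * (\<Sum>i<n. y i) + y n\<close> grows
  by at most \<open>\<eta>\<close> per step.\<close>

lemma contraction_sum_le:
  fixes y :: "nat \<Rightarrow> real"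
  assumes "y 0 \<le> 1" "\<And>i. y (Suc i) \<le> r * y i + \<eta>" "\<And>i. 0 \<le> y i" "r < 1"
  shows "(\<Sum>i<n. y i) \<le> (1 + real n * \<eta>) / (1 - r)"
proof -
  have "(1 - r) * (\<Sum>i<n. y i) + y n \<le> 1 + real n * \<eta>"
  proof (induction n)
    case (Suc n)
    then show ?case using assms(2)[of n] by (simp add: algebra_simps)
  qed (use assms in simp)
  then have "(1 - r) * (\<Sum>i<n. y i) \<le> 1 + real n * \<eta>" using assms(3)[of n] by linarith
  then show ?thesis using assms(4) by (simp add: field_simps)
qed

text \<open>Replacing \<open>1 - \<alpha>\<close> by \<open>exp (- \<alpha>)\<close> costs
  \<open>\<alpha>^2\<close> per step since \<open>z\<close> is bounded by 1, and multiplication by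
  \<open>exp (- \<alpha>) \<le> 1\<close> does not amplify earlier errors.\<close>

lemma exp_recursion_error:
  fixes z :: "nat \<Rightarrow> complex"
  assumes "\<And>i. norm (z (Suc i) - of_real (1 - \<alpha>) * z i) \<le> e i" "\<And>i. norm (z i) \<le> 1" "0 \<le> \<alpha>"
  shows "norm (z n - of_real (exp (- \<alpha> * real n)) * z 0) \<le> (\<Sum>i<n. e i) + real n * \<alpha>^2"
proof (induction n)
  case (Suc n)
  have e: "exp (- \<alpha> * real (Suc n)) = exp (- \<alpha>) * exp (- \<alpha> * real n)"
    unfolding exp_add[symmetric] by (simp add: algebra_simps)
  have "z (Suc n) - of_real (exp (- \<alpha> * real (Suc n))) * z 0 =
    (z (Suc n) - of_real (1 - \<alpha>) * z n) + (of_real (1 - \<alpha> - exp (- \<alpha>)) * z n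
      + of_real (exp (- \<alpha>)) * (z n - of_real (exp (- \<alpha> * real n)) * z 0))"
    unfolding e of_real_mult by (simp add: algebra_simps)
  also have "norm \<dots> \<le> e n + (\<alpha>^2 * 1 + 1 * ((\<Sum>i<n. e i) + real n * \<alpha>^2))"
  proof (intro norm_triangle_mono assms(1))
    show "norm (of_real (1 - \<alpha> - exp (- \<alpha>)) * z n) \<le> \<alpha>^2 * 1"
      unfolding norm_mult norm_of_real by (intro mult_mono exp_neg_approx assms) auto
    show "norm (of_real (exp (- \<alpha>)) * (z n - of_real (exp (- \<alpha> * real n)) * z 0))
      \<le> 1 * ((\<Sum>i<n. e i) + real n * \<alpha>^2)"
      unfolding norm_mult norm_of_real using assms(3) by (intro mult_mono Suc.IH) auto
  qed
  finally show ?case by (simp add: algebra_simps)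
qed simp

section \<open>Random walks on the unit circle\<close>

text \<open>An abstract form of the sampled process. The distribution of a factor enters only
  through its first two moments \<open>p\<close> and \<open>q\<close>: \<open>norm p < 1\<close>
  makes \<open>1 - p\<close> invertible, and \<open>norm q < 1\<close> makes the square of the
  product average out.\<close>

locale unit_walk = prob_space +
  fixes V :: "nat \<Rightarrow> 'a \<Rightarrow> complex" and p q :: complex
  assumes V_indep: "indep_vars (\<lambda>_. borel) V UNIV"
    and norm_V: "w \<in> space M \<Longrightarrow> norm (V i w) = 1"
    and mean_V: "expectation (V i) = p"
    and mean_V2: "expectation (\<lambda>w. V i w ^ 2) = q"
    and p_less: "norm p < 1" and q_less: "norm q < 1"
begin

definition past :: "nat \<Rightarrow> 'a measure" where
  "past k = vimage_algebra (space M) (\<lambda>w. \<lambda>i\<in>{..<k}. V i w) (PiM {..<k} (\<lambda>_. borel))"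

definition U :: "nat \<Rightarrow> 'a \<Rightarrow> complex" where "U k w = (\<Prod>i<k. V i w)"

definition dd :: "complex \<Rightarrow> complex" where "dd z = (z - p) / (1 - p)"

definition D :: "nat \<Rightarrow> 'a \<Rightarrow> complex" where "D i w = dd (V i w)"

definition mart :: "nat \<Rightarrow> 'a \<Rightarrow> complex" where "mart k w = (\<Sum>i<k. U i w * D i w)"

text \<open>The value of \<open>E |D|^2\<close>: as \<open>V\<close> has modulus 1,
  \<open>1 - |p|^2\<close> is the variance of \<open>V\<close>.\<close>

definition vari :: real where "vari = (1 - (norm p)^2) / (norm (1 - p))^2"

text \<open>The pseudo-variance \<open>E D^2\<close>. It does not vanish in general, but in the
  second-order terms it always comes with a square of the rotating factor \<open>U\<close>.\<close>

definition pseudo :: complex where "pseudo = (q - p^2) / (1 - p)^2"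

definition bnd :: real where "bnd = 2 / norm (1 - p)"

lemma V_measurable [measurable]: "V i \<in> borel_measurable M"
  using V_indep by (auto simp: indep_vars_def)

lemma p_neq_1: "1 - p \<noteq> 0"
  using p_less by auto

lemma bnd_nonneg: "0 \<le> bnd" by (simp add: bnd_def)

lemma vari_nonneg: "0 \<le> vari"
  using p_less power_mono[of "norm p" 1 2] by (simp add: vari_def)

section \<open>The past of the walk and its independence of the next factor\<close>

lemma space_past [simp]: "space (past k) = space M"
  by (simp add: past_def)

lemma V_restrict_measurable: "(\<lambda>w. \<lambda>i\<in>{..<k}. V i w) \<in> measurable (past k) (PiM {..<k} (\<lambda>_. borel))"
  unfolding past_def by (rule measurable_vimage_algebra1) (auto simp: space_PiM)

lemma V_past: "i < k \<Longrightarrow> V i \<in> borel_measurable (past k)"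
  using measurable_compose[OF V_restrict_measurable measurable_component_singleton[of i "{..<k}"]] by simp

lemma sets_past_M: "sets (past k) \<subseteq> sets M"
  unfolding past_def by (rule sets_image_in_sets) (auto intro!: measurable_restrict)

lemma sets_past_mono: "k \<le> l \<Longrightarrow> sets (past k) \<subseteq> sets (past l)"
  unfolding past_def[of k] by (rule sets_image_in_sets) (auto intro!: measurable_restrict V_past)

lemma past_measurable_M: "G \<in> measurable (past k) N \<Longrightarrow> G \<in> measurable M N"
  using sets_past_M[of k] by (auto simp: measurable_def)

lemma past_measurable_mono: "G \<in> measurable (past k) N \<Longrightarrow> k \<le> l \<Longrightarrow> G \<in> measurable (past l) N"
  using sets_past_mono[of k l] by (auto simp: measurable_def)

text \<open>Disjoint blocks of the \<open>V i\<close> generate independent sigma-algebras; those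
  generated by \<open>G\<close> and by \<open>V k\<close> are contained in the ones of the blocks
  \<open>{..<k}\<close> and \<open>{k}\<close>.\<close>

lemma past_indep:
  fixes G :: "'a \<Rightarrow> complex"
  assumes G: "G \<in> borel_measurable (past k)"
  shows "indep_var borel G borel (V k)"
proof -
  let ?R = "\<lambda>(A :: nat set) w. \<lambda>i\<in>A. V i w"
  let ?S = "\<lambda>A. {?R A -` B \<inter> space M |B. B \<in> sets (PiM A (\<lambda>_. borel))}"
  have R: "indep_var (PiM {..<k} (\<lambda>_. borel)) (?R {..<k}) (PiM {k} (\<lambda>_. borel)) (?R {k})"
    by (rule indep_var_restrict[OF V_indep]) auto
  have "{G -` A \<inter> space M |A. A \<in> sets borel} \<subseteq> ?S {..<k}"
  proof clarify
    fix A :: "complex set" assume "A \<in> sets borel"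
    then have "G -` A \<inter> space (past k) \<in> sets (past k)" using G by (rule measurable_sets[rotated])
    then show "\<exists>B. G -` A \<inter> space M = ?R {..<k} -` B \<inter> space M \<and> B \<in> sets (PiM {..<k} (\<lambda>_. borel))"
      unfolding past_def by (subst (asm) sets_vimage_algebra2) (auto simp: space_PiM)
  qed
  then have 1: "sigma_sets (space M) {G -` A \<inter> space M |A. A \<in> sets borel} \<subseteq> sigma_sets (space M) (?S {..<k})"
    by (rule sigma_sets_mono')
  have "{V k -` A \<inter> space M |A. A \<in> sets borel} \<subseteq> ?S {k}"
  proof clarify
    fix A :: "complex set" assume "A \<in> sets borel"
    then have "(\<lambda>x. x k) -` A \<inter> space (PiM {k} (\<lambda>_. borel)) \<in> sets (PiM {k} (\<lambda>_. borel))"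
      by (intro measurable_sets[OF measurable_component_singleton]) auto
    moreover have "V k -` A \<inter> space M = ?R {k} -` ((\<lambda>x. x k) -` A \<inter> space (PiM {k} (\<lambda>_. borel))) \<inter> space M"
      by (auto simp: space_PiM)
    ultimately show "\<exists>B. V k -` A \<inter> space M = ?R {k} -` B \<inter> space M \<and> B \<in> sets (PiM {k} (\<lambda>_. borel))"
      by blast
  qed
  then have 2: "sigma_sets (space M) {V k -` A \<inter> space M |A. A \<in> sets borel} \<subseteq> sigma_sets (space M) (?S {k})"
    by (rule sigma_sets_mono')
  have "indep_set (sigma_sets (space M) (?S {..<k})) (sigma_sets (space M) (?S {k}))"
    using R unfolding indep_var_eq by blast
  then have "indep_set (sigma_sets (space M) {G -` A \<inter> space M |A. A \<in> sets borel})
      (sigma_sets (space M) {V k -` A \<inter> space M |A. A \<in> sets borel})"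
    unfolding indep_set_def
    by (rule indep_sets_mono_sets) (use 1 2 in \<open>auto split: bool.split\<close>)
  then show ?thesis
    using past_measurable_M[OF G] unfolding indep_var_eq by auto
qed

text \<open>Bounded and measurable with respect to the first \<open>k\<close> factors. Closure under
  algebraic operations turns measurability and integrability obligations into a syntactic
  check.\<close>

definition adm :: "nat \<Rightarrow> ('a \<Rightarrow> complex) \<Rightarrow> bool" where
  "adm k G \<longleftrightarrow> G \<in> borel_measurable (past k) \<and> (\<exists>K. \<forall>w\<in>space M. norm (G w) \<le> K)"

lemma admI: "G \<in> borel_measurable (past k) \<Longrightarrow> (\<And>w. w \<in> space M \<Longrightarrow> norm (G w) \<le> K) \<Longrightarrow> adm k G"
  by (auto simp: adm_def)

lemma adm_mono: "adm k G \<Longrightarrow> k \<le> l \<Longrightarrow> adm l G"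
  by (auto simp: adm_def intro: past_measurable_mono)

lemma adm_const: "adm k (\<lambda>_. c)"
  by (rule admI[where K = "norm c"]) auto

lemma adm_add:
  assumes "adm k f" "adm k g" shows "adm k (\<lambda>w. f w + g w)"
proof -
  obtain K K' where K: "\<And>w. w \<in> space M \<Longrightarrow> norm (f w) \<le> K" "\<And>w. w \<in> space M \<Longrightarrow> norm (g w) \<le> K'"
    using assms by (auto simp: adm_def)
  show ?thesis
    by (rule admI[where K = "K + K'"])
       (use assms K in \<open>auto simp: adm_def intro: borel_measurable_add norm_triangle_mono\<close>)
qed

lemma adm_mult: 
  assumes "adm k f" "adm k g" shows "adm k (\<lambda>w. f w * g w)"
proof -
  obtain K K' where K: "\<And>w. w \<in> space M \<Longrightarrow> norm (f w) \<le> K" "\<And>w. w \<in> space M \<Longrightarrow> norm (g w) \<le> K'"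
    using assms by (auto simp: adm_def)
  have "norm (f w * g w) \<le> K * K'" if "w \<in> space M" for w
    unfolding norm_mult using K[OF that] norm_ge_zero order_trans by (intro mult_mono) blast+
  then show ?thesis
    using assms by (intro admI[where K = "K * K'"]) (auto simp: adm_def intro: borel_measurable_times)
qed

lemma adm_cmult: "adm k f \<Longrightarrow> adm k (\<lambda>w. c * f w)"
  by (rule adm_mult[OF adm_const])

lemma adm_diff: "adm k f \<Longrightarrow> adm k g \<Longrightarrow> adm k (\<lambda>w. f w - g w)"
  using adm_add[of k f "\<lambda>w. - 1 * g w"] adm_cmult[of k g "- 1"] by simp

lemma adm_cnj:
  assumes "adm k f" shows "adm k (\<lambda>w. cnj (f w))"
  using assms measurable_compose[OF _ cnj_measurable, of f "past k"] unfolding adm_def by simp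

lemma adm_power: "adm k f \<Longrightarrow> adm k (\<lambda>w. f w ^ n)"
  by (induction n) (auto intro: adm_const adm_mult)

lemma adm_sum: "(\<And>i. i \<in> I \<Longrightarrow> adm k (f i)) \<Longrightarrow> adm k (\<lambda>w. \<Sum>i\<in>I. f i w)"
  by (induction I rule: infinite_finite_induct) (auto intro: adm_const adm_add)

lemma adm_prod: "(\<And>i. i \<in> I \<Longrightarrow> adm k (f i)) \<Longrightarrow> adm k (\<lambda>w. \<Prod>i\<in>I. f i w)"
  by (induction I rule: infinite_finite_induct) (auto intro: adm_const adm_mult)

lemma adm_V: "i < k \<Longrightarrow> adm k (V i)"
  by (rule admI[OF V_past, where K = 1]) (auto simp: norm_V)

lemma adm_U: "j \<le> k \<Longrightarrow> adm k (U j)"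
  unfolding U_def[abs_def] by (intro adm_prod adm_V) auto

lemma adm_D: "i < k \<Longrightarrow> adm k (D i)"
  unfolding D_def[abs_def] dd_def divide_inverse by (intro adm_mult adm_diff adm_V adm_const)

lemma adm_mart: "j \<le> k \<Longrightarrow> adm k (mart j)"
  unfolding mart_def[abs_def] by (intro adm_sum adm_mult adm_U adm_D) auto

lemma adm_cis:
  assumes "adm k f" shows "adm k (\<lambda>w. cis (Re (f w)))"
proof (rule admI[where K = 1])
  have [measurable]: "f \<in> borel_measurable (past k)" using assms by (simp add: adm_def)
  show "(\<lambda>w. cis (Re (f w))) \<in> borel_measurable (past k)" by measurable
qed simp

lemmas adm_intros = adm_const adm_add adm_mult adm_diff adm_cnj adm_power adm_U adm_D adm_V adm_mart adm_cis

lemma adm_measurable: "adm k G \<Longrightarrow> G \<in> borel_measurable M"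
  using past_measurable_M[of G k borel] unfolding adm_def by blast

lemma adm_integrable:
  assumes "adm k G" shows "integrable M G"
proof -
  obtain K where "\<And>w. w \<in> space M \<Longrightarrow> norm (G w) \<le> K"
    using assms by (auto simp: adm_def)
  then show ?thesis
    by (intro integrable_const_bound[where B = K] adm_measurable[OF assms]) auto
qed

lemma adm_integrable_norm: "adm k G \<Longrightarrow> integrable M (\<lambda>w. norm (G w) ^ n)"
  using integrable_norm[OF adm_integrable[OF adm_power[of k G n]]] by (simp add: norm_power)

text \<open>This factorisation plays the role of conditioning on the past: a function of the next
  factor may be replaced by its mean.\<close>

lemma expectation_past_mult:
  assumes G: "adm k G" and H: "H \<in> borel_measurable borel"
    and b: "\<And>z. norm z = 1 \<Longrightarrow> norm (H z) \<le> K"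
  shows "expectation (\<lambda>w. G w * H (V k w)) = expectation G * expectation (\<lambda>w. H (V k w))"
proof -
  have "indep_var borel (id \<circ> G) borel (H \<circ> V k)"
    using G H by (intro indep_var_compose[OF past_indep]) (auto simp: adm_def)
  then have ind: "indep_var borel G borel (\<lambda>w. H (V k w))" by (simp add: comp_def)
  have "integrable M (\<lambda>w. H (V k w))"
    using H b norm_V by (intro integrable_const_bound[where B = K] measurable_compose[OF V_measurable]) auto
  then show ?thesis
    using adm_integrable[OF G] by (intro indep_var_lebesgue_integral[OF ind])
qed

lemma norm_U: "w \<in> space M \<Longrightarrow> norm (U k w) = 1"
  by (induction k) (auto simp: U_def norm_mult norm_V)

lemma norm_dd: "norm z = 1 \<Longrightarrow> norm (dd z) \<le> bnd"
proof -
  assume z: "norm z = 1"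
  have "norm (z - p) \<le> 2" using norm_triangle_ineq4[of z p] z p_less by linarith
  then show ?thesis by (simp add: dd_def bnd_def norm_divide divide_right_mono)
qed

lemma norm_D: "w \<in> space M \<Longrightarrow> norm (D i w) \<le> bnd"
  unfolding D_def by (intro norm_dd norm_V)

lemma U_Suc: "U (Suc k) w = U k w * V k w"
  by (simp add: U_def)

lemma mart_Suc: "mart (Suc k) w = mart k w + U k w * D k w"
  by (simp add: mart_def)

lemma V_integrable: "integrable M (\<lambda>w. V i w ^ n)"
  by (rule adm_integrable[of "Suc i"]) (intro adm_intros, simp)

section \<open>Moments of the centred factor, alone and against the past\<close>

lemma mean_D: "expectation (D i) = 0"
  unfolding D_def dd_def using V_integrable[of i 1] by (simp add: mean_V prob_space)

lemma mean_DD: "expectation (\<lambda>w. D i w * cnj (D i w)) = of_real vari"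
proof -
  have c: "expectation (\<lambda>w. cnj (V i w)) = cnj p"
    by (simp add: mean_V)
  have "expectation (\<lambda>w. D i w * cnj (D i w)) =
    expectation (\<lambda>w. (1 - cnj p * V i w - p * cnj (V i w) + p * cnj p) / ((1 - p) * cnj (1 - p)))"
  proof (rule Bochner_Integration.integral_cong)
    fix w assume "w \<in> space M"
    then have "V i w * cnj (V i w) = 1"
      using norm_V by (metis complex_norm_square mult_1 of_real_1 power_one)
    then show "D i w * cnj (D i w) = (1 - cnj p * V i w - p * cnj (V i w) + p * cnj p) / ((1 - p) * cnj (1 - p))"
      by (simp add: D_def dd_def algebra_simps)
  qed simp
  also have "\<dots> = (1 - cnj p * p - p * cnj p + p * cnj p) / ((1 - p) * cnj (1 - p))"
  proof -
    have "integrable M (V i)" "integrable M (\<lambda>w. cnj (V i w))"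
      using V_integrable[of i 1] by auto
    then show ?thesis by (simp add: mean_V c prob_space)
  qed
  also have "\<dots> = (1 - p * cnj p) / ((1 - p) * cnj (1 - p))"
    by (simp add: mult.commute)
  also have "\<dots> = of_real vari"
    unfolding vari_def of_real_divide of_real_diff of_real_1 complex_norm_square ..
  finally show ?thesis .
qed

lemma mean_D2: "expectation (\<lambda>w. (D i w)^2) = pseudo"
proof -
  have "expectation (\<lambda>w. (D i w)^2) = expectation (\<lambda>w. ((V i w)^2 - 2 * p * V i w + p^2) / (1 - p)^2)"
    unfolding D_def dd_def power_divide power2_diff by (intro Bochner_Integration.integral_cong) (auto simp: algebra_simps)
  also have "\<dots> = (q - 2 * p * p + p^2) / (1 - p)^2"
  proof -
    have "integrable M (V i)" "integrable M (\<lambda>w. (V i w)^2)"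
      using V_integrable[of i 1] V_integrable[of i 2] by auto
    then show ?thesis by (simp add: mean_V mean_V2 prob_space)
  qed
  finally show ?thesis by (simp add: pseudo_def power2_eq_square)
qed

lemma mean_norm_D2: "expectation (\<lambda>w. (norm (D i w))^2) = vari"
proof -
  have "complex_of_real (expectation (\<lambda>w. (norm (D i w))^2)) = expectation (\<lambda>w. of_real ((norm (D i w))^2))"
    by (rule integral_complex_of_real[symmetric])
  also have "\<dots> = of_real vari" unfolding complex_norm_square by (rule mean_DD)
  finally show ?thesis by (simp only: of_real_eq_iff)
qed

lemma norm_pseudo: "norm pseudo \<le> vari"
proof -
  have "norm pseudo = norm (expectation (\<lambda>w. (D 0 w)^2))" by (simp only: mean_D2)
  also have "\<dots> \<le> expectation (\<lambda>w. norm ((D 0 w)^2))" by (rule integral_norm_bound)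
  also have "\<dots> = vari" by (simp only: norm_power mean_norm_D2)
  finally show ?thesis .
qed

lemma dd_measurable [measurable]: "dd \<in> borel_measurable borel"
  unfolding dd_def[abs_def] divide_inverse by measurable

lemma past_D:
  assumes "adm k G"
  shows "expectation (\<lambda>w. G w * D k w) = 0"
proof -
  have "expectation (\<lambda>w. G w * dd (V k w)) = expectation G * expectation (\<lambda>w. dd (V k w))"
    by (rule expectation_past_mult[OF assms dd_measurable norm_dd])
  then show ?thesis using mean_D[of k] unfolding D_def[symmetric] by simp
qed

lemma past_DD:
  assumes "adm k G"
  shows "expectation (\<lambda>w. G w * (D k w * cnj (D k w))) = expectation G * of_real vari"
  unfolding mean_DD[of k, symmetric] D_def
proof (rule expectation_past_mult[OF assms, where K = "bnd * bnd"])
  show "(\<lambda>z. dd z * cnj (dd z)) \<in> borel_measurable borel" by measurable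
  show "norm (dd z * cnj (dd z)) \<le> bnd * bnd" if "norm z = 1" for z
    unfolding norm_mult complex_mod_cnj by (intro mult_mono norm_dd that bnd_nonneg norm_ge_zero)
qed

lemma past_D2:
  assumes "adm k G"
  shows "expectation (\<lambda>w. G w * (D k w)^2) = expectation G * pseudo"
  unfolding mean_D2[of k, symmetric] D_def
proof (rule expectation_past_mult[OF assms, where K = "bnd^2"])
  show "(\<lambda>z. (dd z)^2) \<in> borel_measurable borel" by measurable
  show "norm ((dd z)^2) \<le> bnd^2" if "norm z = 1" for z
    unfolding norm_power by (intro power_mono norm_dd that norm_ge_zero)
qed

lemma past_cnj:
  assumes "expectation (\<lambda>w. cnj (G w) * H w) = c"
  shows "expectation (\<lambda>w. G w * cnj (H w)) = cnj c"
proof -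
  have "expectation (\<lambda>w. G w * cnj (H w)) = expectation (\<lambda>w. cnj (cnj (G w) * H w))" by simp
  also have "\<dots> = cnj c" unfolding assms[symmetric] by (rule Bochner_Integration.integral_cnj)
  finally show ?thesis .
qed

lemma past_cnj_D: "adm k G \<Longrightarrow> expectation (\<lambda>w. G w * cnj (D k w)) = 0"
  using past_cnj[OF past_D[OF adm_cnj[of k G]]] by simp

lemma past_cnj_D2: "adm k G \<Longrightarrow> expectation (\<lambda>w. G w * (cnj (D k w))^2) = expectation G * cnj pseudo"
  using past_cnj[OF past_D2[OF adm_cnj[of k G]]] by simp

lemma past_V2:
  assumes "adm k G"
  shows "expectation (\<lambda>w. G w * (V k w)^2) = expectation G * q"
  unfolding mean_V2[of k, symmetric]
  by (rule expectation_past_mult[OF assms, where K = 1]) (auto simp: norm_power)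

lemma past_norm_D2:
  assumes "adm k G"
  shows "expectation (\<lambda>w. (norm (G w))^2 * (norm (D k w))^2) = expectation (\<lambda>w. (norm (G w))^2) * vari"
proof -
  have "complex_of_real (expectation (\<lambda>w. (norm (G w))^2 * (norm (D k w))^2)) =
    expectation (\<lambda>w. of_real ((norm (G w))^2 * (norm (D k w))^2))"
    by (rule integral_complex_of_real[symmetric])
  also have "\<dots> = expectation (\<lambda>w. (G w * cnj (G w)) * (D k w * cnj (D k w)))"
    by (simp only: of_real_mult complex_norm_square)
  also have "\<dots> = expectation (\<lambda>w. G w * cnj (G w)) * of_real vari"
    using assms by (intro past_DD adm_intros)
  also have "\<dots> = of_real (expectation (\<lambda>w. (norm (G w))^2) * vari)"
    by (simp only: complex_norm_square[symmetric] integral_complex_of_real of_real_mult)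
  finally show ?thesis by (simp only: of_real_eq_iff)
qed

section \<open>Characteristic function of the martingale over a block of steps\<close>

definition step :: "complex \<Rightarrow> nat \<Rightarrow> 'a \<Rightarrow> real" where
  "step l j w = Re (cnj l * (U j w * D j w))"

text \<open>Half the mean of \<open>(step l j)^2\<close> without its rotating part:
  \<open>(Re z)^2\<close> is \<open>|z|^2 / 2\<close> plus a multiple of the real part of
  \<open>z^2\<close>, and the exponential series contributes the other factor
  \<open>1/2\<close>.\<close>

definition rate :: "complex \<Rightarrow> real" where "rate l = (norm l)^2 * vari / 4"

text \<open>Bounds the mean of the Taylor remainder \<open>|step|^3 / 6\<close>.\<close>

definition cubic_err :: "complex \<Rightarrow> real" where "cubic_err l = norm l ^ 3 * bnd * vari / 6"

text \<open>The amount by which tilting with \<open>cis (step l j w)\<close> disturbs the exact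
  relation that one step multiplies the mean of \<open>U^2\<close> by \<open>q\<close>.\<close>

definition mix_err :: "complex \<Rightarrow> real" where
  "mix_err l = norm l * norm (1 - p) * (3 * vari + 1) + (norm l)^2 * vari / 2"

lemma abs_step: "w \<in> space M \<Longrightarrow> \<bar>step l j w\<bar> \<le> norm l * norm (D j w)"
  using abs_Re_le_cmod[of "cnj l * (U j w * D j w)"] by (simp add: step_def norm_mult norm_U)

lemma norm_D_integrable: "integrable M (\<lambda>w. norm (D j w) ^ n)"
  by (rule adm_integrable_norm[OF adm_D]) (rule lessI)

lemma rate_nonneg: "0 \<le> rate l"
  using vari_nonneg by (simp add: rate_def)

lemma cis_step_adm: "j < k \<Longrightarrow> adm k (\<lambda>w. cis (step l j w))"
  unfolding step_def by (intro adm_intros) auto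

lemma norm_expectation_le:
  assumes "adm k f" "integrable M g" "\<And>w. w \<in> space M \<Longrightarrow> norm (f w) \<le> g w"
  shows "norm (expectation f) \<le> expectation g"
proof -
  have "norm (expectation f) \<le> expectation (\<lambda>w. norm (f w))" by (rule integral_norm_bound)
  also have "\<dots> \<le> expectation g"
    using assms adm_integrable[OF assms(1)] by (intro integral_mono) auto
  finally show ?thesis .
qed

lemma norm_expectation_le_const:
  assumes "adm k f" "\<And>w. w \<in> space M \<Longrightarrow> norm (f w) \<le> c"
  shows "norm (expectation f) \<le> c"
  using norm_expectation_le[OF assms(1), of "\<lambda>_. c"] assms(2) by (simp add: prob_space)

lemma U_cnj: "w \<in> space M \<Longrightarrow> U j w * cnj (U j w) = 1"
  using norm_U by (metis complex_norm_square mult_1 of_real_1 power_one)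

text \<open>The real part is written with a conjugate so that the closure rules for
  \<open>adm\<close> apply.\<close>

lemma step_adm: "j < k \<Longrightarrow> adm k (\<lambda>w. of_real (step l j w))"
proof -
  assume j: "j < k"
  have "(\<lambda>w. complex_of_real (step l j w)) =
    (\<lambda>w. (1/2) * (cnj l * (U j w * D j w) + cnj (cnj l * (U j w * D j w))))"
  proof
    fix w
    have "complex_of_real (Re z) = (1/2) * (z + cnj z)" for z by (simp add: complex_add_cnj)
    then show "complex_of_real (step l j w) = (1/2) * (cnj l * (U j w * D j w) + cnj (cnj l * (U j w * D j w)))"
      unfolding step_def .
  qed
  moreover have "adm k \<dots>" using j by (intro adm_intros) auto
  ultimately show "adm k (\<lambda>w. of_real (step l j w))" by simp
qed

text \<open>To second order, the terms linear in \<open>D\<close> have mean zero, the term with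
  \<open>D * cnj D\<close> produces the factor \<open>1 - rate l\<close>, and the terms with
  \<open>D^2\<close> and its conjugate keep the weights \<open>U^2\<close>. The latter are not small
  for a single step, so they are left in the bound, to be summed over a block.\<close>

lemma expectation_cis_step:
  assumes f: "adm j f" and f1: "\<And>w. w \<in> space M \<Longrightarrow> norm (f w) \<le> 1"
  shows "norm (expectation (\<lambda>w. f w * cis (step l j w)) - of_real (1 - rate l) * expectation f)
    \<le> rate l / 2 * (norm (expectation (\<lambda>w. f w * (U j w)^2)) + norm (expectation (\<lambda>w. f w * (cnj (U j w))^2)))
      + cubic_err l"
proof -
  let ?x = "\<lambda>w. complex_of_real (step l j w)"
  let ?P = "\<lambda>w. f w * (1 + \<i> * ?x w - (?x w)^2 / 2)"
  let ?y = "expectation (\<lambda>w. f w * (U j w)^2)" and ?y' = "expectation (\<lambda>w. f w * (cnj (U j w))^2)"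
  have wS: "adm (Suc j) f" using f by (rule adm_mono) simp
  have aU: "adm (Suc j) (U j)" "adm (Suc j) (D j)" by (intro adm_intros; simp)+
  have xS: "adm (Suc j) ?x" by (rule step_adm) simp
  have cS: "adm (Suc j) (\<lambda>w. cis (step l j w))" by (rule cis_step_adm) simp
  have PS: "adm (Suc j) ?P"
    unfolding divide_inverse by (intro adm_mult adm_add adm_diff adm_const adm_power wS xS)
  have "expectation ?P = expectation (\<lambda>w. f w + (\<i> * cnj l / 2) * ((f w * U j w) * D j w)
      + (\<i> * l / 2) * ((f w * cnj (U j w)) * cnj (D j w))
      - ((cnj l)^2 / 8) * ((f w * (U j w)^2) * (D j w)^2)
      - (l^2 / 8) * ((f w * (cnj (U j w))^2) * (cnj (D j w))^2)
      - (l * cnj l / 4) * (f w * (D j w * cnj (D j w))))"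
    unfolding step_def by (intro Bochner_Integration.integral_cong refl cis_quadratic_expand U_cnj)
  also have "\<dots> = expectation f + (\<i> * cnj l / 2) * expectation (\<lambda>w. (f w * U j w) * D j w)
      + (\<i> * l / 2) * expectation (\<lambda>w. (f w * cnj (U j w)) * cnj (D j w))
      - ((cnj l)^2 / 8) * expectation (\<lambda>w. (f w * (U j w)^2) * (D j w)^2)
      - (l^2 / 8) * expectation (\<lambda>w. (f w * (cnj (U j w))^2) * (cnj (D j w))^2)
      - (l * cnj l / 4) * expectation (\<lambda>w. f w * (D j w * cnj (D j w)))"
  proof -
    have i: "integrable M f" "integrable M (\<lambda>w. (f w * U j w) * D j w)"
      "integrable M (\<lambda>w. (f w * cnj (U j w)) * cnj (D j w))"
      "integrable M (\<lambda>w. (f w * (U j w)^2) * (D j w)^2)"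
      "integrable M (\<lambda>w. (f w * (cnj (U j w))^2) * (cnj (D j w))^2)"
      "integrable M (\<lambda>w. f w * (D j w * cnj (D j w)))"
      by (intro adm_integrable[of "Suc j"] adm_mult adm_power adm_cnj wS aU)+
    show ?thesis
      by (simp only: Bochner_Integration.integral_add Bochner_Integration.integral_diff
          Bochner_Integration.integrable_add Bochner_Integration.integrable_diff
          integrable_mult_right i integral_mult_right_zero)
  qed
  also have "expectation (\<lambda>w. (f w * U j w) * D j w) = 0"
    by (intro past_D adm_mult f adm_U) simp
  also have "expectation (\<lambda>w. (f w * cnj (U j w)) * cnj (D j w)) = 0"
    by (intro past_cnj_D adm_mult f adm_U adm_cnj) simp
  also have "expectation (\<lambda>w. (f w * (U j w)^2) * (D j w)^2) = ?y * pseudo"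
    by (intro past_D2 adm_mult f adm_U adm_power) simp
  also have "expectation (\<lambda>w. (f w * (cnj (U j w))^2) * (cnj (D j w))^2) = ?y' * cnj pseudo"
    by (intro past_cnj_D2 adm_mult f adm_U adm_power adm_cnj) simp
  also have "expectation (\<lambda>w. f w * (D j w * cnj (D j w))) = expectation f * of_real vari"
    by (rule past_DD[OF f])
  finally have P: "expectation ?P - of_real (1 - rate l) * expectation f =
      - (((cnj l)^2 / 8) * (?y * pseudo) + (l^2 / 8) * (?y' * cnj pseudo))"
  proof -
    assume *: "expectation ?P = expectation f + \<i> * cnj l / 2 * 0 + \<i> * l / 2 * 0
      - ((cnj l)^2 / 8) * (?y * pseudo) - (l^2 / 8) * (?y' * cnj pseudo)
      - (l * cnj l / 4) * (expectation f * of_real vari)"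
    have r: "of_real (1 - rate l) = 1 - (l * cnj l) * of_real vari / 4"
      unfolding complex_norm_square[symmetric] rate_def by simp
    show ?thesis unfolding * r by (simp add: algebra_simps)
  qed
  have c: "norm l ^ 2 / 8 * (norm y * norm pseudo) \<le> rate l / 2 * norm y" for y :: complex
  proof -
    have "norm l ^ 2 / 8 * (norm y * norm pseudo) \<le> norm l ^ 2 / 8 * (norm y * vari)"
      by (intro mult_left_mono norm_pseudo) auto
    then show ?thesis by (simp add: rate_def mult_ac)
  qed
  have P2: "norm (expectation ?P - of_real (1 - rate l) * expectation f) \<le> rate l / 2 * (norm ?y + norm ?y')"
  proof -
    have "norm (((cnj l)^2 / 8) * (?y * pseudo) + (l^2 / 8) * (?y' * cnj pseudo))
      \<le> rate l / 2 * norm ?y + rate l / 2 * norm ?y'"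
      by (intro norm_triangle_mono) (use c[of ?y] c[of ?y'] in \<open>simp_all add: norm_mult norm_power norm_divide\<close>)
    then show ?thesis unfolding P norm_minus_cancel by (simp add: ring_distribs)
  qed
  have "expectation (\<lambda>w. f w * cis (step l j w)) - expectation ?P =
      expectation (\<lambda>w. f w * cis (step l j w) - ?P w)"
    by (intro Bochner_Integration.integral_diff[symmetric] adm_integrable[OF PS] adm_integrable[OF adm_mult[OF wS cS]])
  also have "norm \<dots> \<le> expectation (\<lambda>w. (norm l ^ 3 * bnd / 6) * norm (D j w) ^ 2)"
  proof (rule norm_expectation_le[of "Suc j"])
    fix w assume s: "w \<in> space M"
    have "norm (f w * cis (step l j w) - ?P w) = norm (f w) * norm (cis (step l j w) - (1 + \<i> * ?x w - (?x w)^2 / 2))"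
      by (simp only: norm_mult[symmetric] right_diff_distrib)
    also have "\<dots> \<le> 1 * (\<bar>step l j w\<bar> ^ 3 / 6)"
      by (intro mult_mono f1 s norm_cis_minus_quadratic) auto
    also have "\<dots> \<le> 1 * ((norm l * norm (D j w)) ^ 3 / 6)"
      by (intro mult_left_mono divide_right_mono power_mono abs_step s) auto
    also have "\<dots> = norm l ^ 3 / 6 * (norm (D j w) ^ 2 * norm (D j w))"
      by (simp add: power_mult_distrib power2_eq_square power3_eq_cube)
    \<comment> \<open>Only one of the three factors \<open>norm (D j w)\<close> is estimated
      uniformly; the remaining square integrates to \<open>vari\<close>.\<close>
    also have "\<dots> \<le> norm l ^ 3 / 6 * (norm (D j w) ^ 2 * bnd)"
      by (intro mult_left_mono norm_D s) auto
    finally show "norm (f w * cis (step l j w) - ?P w) \<le> (norm l ^ 3 * bnd / 6) * norm (D j w) ^ 2"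
      by (simp add: mult_ac)
  qed (intro adm_diff adm_mult[OF wS cS] PS, intro integrable_mult_right norm_D_integrable)
  also have "\<dots> = cubic_err l" by (simp add: mean_norm_D2 cubic_err_def)
  finally have R: "norm (expectation (\<lambda>w. f w * cis (step l j w)) - expectation ?P) \<le> cubic_err l" .
  have "norm ((expectation (\<lambda>w. f w * cis (step l j w)) - expectation ?P) + (expectation ?P - of_real (1 - rate l) * expectation f))
    \<le> cubic_err l + rate l / 2 * (norm ?y + norm ?y')"
    by (intro norm_triangle_mono R P2)
  then show ?thesis by (simp add: add.commute)
qed

text \<open>One step turns \<open>U^2\<close> into \<open>U^2 * V^2\<close> and hence multiplies its
  mean by \<open>q\<close>. Bounding \<open>cis (step l j w) - 1\<close> by the modulus of the step
  would cost order \<open>norm l * sqrt vari\<close>, too much over the number of steps in use; the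
  linear part is therefore split off and has mean zero.\<close>

lemma expectation_cis_step_U2:
  assumes f: "adm j f" and f1: "\<And>w. w \<in> space M \<Longrightarrow> norm (f w) \<le> 1"
  shows "norm (expectation (\<lambda>w. f w * cis (step l j w) * (U (Suc j) w)^2))
    \<le> norm q * norm (expectation (\<lambda>w. f w * (U j w)^2)) + mix_err l"
proof -
  let ?x = "\<lambda>w. complex_of_real (step l j w)"
  define v where "v = (\<lambda>w. f w * (U j w)^2)"
  have v: "adm j v" unfolding v_def by (intro adm_mult adm_power f adm_U) simp
  have v1: "norm (v w) \<le> 1" if "w \<in> space M" for w
    using f1[OF that] by (simp add: v_def norm_mult norm_power norm_U that)
  have vS: "adm (Suc j) v" using v by (rule adm_mono) simp
  have aU: "adm (Suc j) (U j)" "adm (Suc j) (D j)" "adm (Suc j) (V j)" by (intro adm_intros; simp)+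
  have xS: "adm (Suc j) ?x" by (rule step_adm) simp
  have cS: "adm (Suc j) (\<lambda>w. cis (step l j w))" by (rule cis_step_adm) simp
  \<comment> \<open>What remains of \<open>V^2 * cis x\<close> after \<open>V^2 + \<i> * x\<close>:
    a product of two small quantities and a quadratic Taylor remainder.\<close>
  define r where "r = (\<lambda>w. v w * (((V j w)^2 - 1) * (cis (step l j w) - 1) + (cis (step l j w) - 1 - \<i> * ?x w)))"
  have rS: "adm (Suc j) r" unfolding r_def by (intro adm_mult adm_add adm_diff adm_power adm_const vS cS xS aU)
  have "expectation (\<lambda>w. f w * cis (step l j w) * (U (Suc j) w)^2) =
    expectation (\<lambda>w. v w * (V j w)^2 + \<i> * (v w * ?x w) + r w)"
    unfolding v_def r_def U_Suc by (simp add: algebra_simps power_mult_distrib)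
  also have "\<dots> = expectation (\<lambda>w. v w * (V j w)^2) + \<i> * expectation (\<lambda>w. v w * ?x w) + expectation r"
  proof -
    have i: "integrable M (\<lambda>w. v w * (V j w)^2)" "integrable M (\<lambda>w. v w * ?x w)" "integrable M r"
      by (intro adm_integrable[of "Suc j"] adm_mult adm_power vS xS aU rS)+
    then show ?thesis by simp
  qed
  also have "expectation (\<lambda>w. v w * ?x w) = 0"
  proof -
    have "expectation (\<lambda>w. v w * ?x w) = expectation (\<lambda>w. (cnj l / 2) * ((v w * U j w) * D j w)
        + (l / 2) * ((v w * cnj (U j w)) * cnj (D j w)))"
    proof (intro Bochner_Integration.integral_cong refl)
      fix w
      have "?x w = (cnj l * (U j w * D j w) + l * (cnj (U j w) * cnj (D j w))) / 2"
        unfolding step_def using complex_add_cnj[of "cnj l * (U j w * D j w)"] by simp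
      then show "v w * ?x w = (cnj l / 2) * ((v w * U j w) * D j w)
        + (l / 2) * ((v w * cnj (U j w)) * cnj (D j w))" by (simp add: field_simps)
    qed
    also have "\<dots> = (cnj l / 2) * expectation (\<lambda>w. (v w * U j w) * D j w)
        + (l / 2) * expectation (\<lambda>w. (v w * cnj (U j w)) * cnj (D j w))"
    proof -
      have i: "integrable M (\<lambda>w. (v w * U j w) * D j w)" "integrable M (\<lambda>w. (v w * cnj (U j w)) * cnj (D j w))"
        by (intro adm_integrable[of "Suc j"] adm_mult adm_cnj vS aU)+
      show ?thesis
        by (simp only: Bochner_Integration.integral_add integrable_mult_right i integral_mult_right_zero)
    qed
    also have "expectation (\<lambda>w. (v w * U j w) * D j w) = 0"
      by (intro past_D adm_mult v adm_U) simp
    also have "expectation (\<lambda>w. (v w * cnj (U j w)) * cnj (D j w)) = 0"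
      by (intro past_cnj_D adm_mult v adm_U adm_cnj) simp
    finally show ?thesis by simp
  qed
  also have "expectation (\<lambda>w. v w * (V j w)^2) = expectation v * q" by (rule past_V2[OF v])
  finally have E: "expectation (\<lambda>w. f w * cis (step l j w) * (U (Suc j) w)^2) = expectation v * q + expectation r" by simp
  have "norm (expectation r) \<le> expectation (\<lambda>w. (norm l * norm (1 - p) * 3 + (norm l)^2 / 2) * norm (D j w) ^ 2
      + norm l * norm (1 - p))"
  proof (rule norm_expectation_le[OF rS])
    fix w assume s: "w \<in> space M"
    let ?d = "norm (D j w)"
    \<comment> \<open>This puts the small factor \<open>1 - p\<close> into evidence; the mere bound
      \<open>norm (V j w - 1) \<le> 2\<close> would lose it.\<close>
    have "V j w - 1 = (1 - p) * (D j w - 1)"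
      using p_neq_1 by (simp add: D_def dd_def field_simps)
    then have V1: "norm (V j w - 1) \<le> norm (1 - p) * (?d + 1)"
      using norm_triangle_ineq4[of "D j w" 1] by (simp add: norm_mult mult_left_mono)
    have "(V j w)^2 - 1 = (V j w + 1) * (V j w - 1)" by (simp add: power2_eq_square algebra_simps)
    then have "norm ((V j w)^2 - 1) = norm (V j w + 1) * norm (V j w - 1)" by (simp only: norm_mult)
    also have "\<dots> \<le> 2 * (norm (1 - p) * (?d + 1))"
      using norm_triangle_ineq[of "V j w" 1] norm_V[OF s, of j] by (intro mult_mono V1) auto
    finally have V2: "norm ((V j w)^2 - 1) \<le> 2 * (norm (1 - p) * (?d + 1))" .
    have c1: "norm (cis (step l j w) - 1) \<le> norm l * ?d"
      using norm_cis_minus_1[of "step l j w"] abs_step[OF s, of l j] by linarith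
    have "(step l j w)^2 \<le> (norm l * ?d)^2"
      using abs_step[OF s, of l j] power_mono[of "\<bar>step l j w\<bar>" "norm l * ?d" 2] by simp
    then have c2: "norm (cis (step l j w) - 1 - \<i> * ?x w) \<le> (norm l * ?d)^2 / 2"
      using norm_cis_minus_linear[of "step l j w"] by linarith
    have "norm (r w) \<le> 1 * (2 * (norm (1 - p) * (?d + 1)) * (norm l * ?d) + (norm l * ?d)^2 / 2)"
      unfolding r_def norm_mult[of "v w"]
    proof (intro mult_mono v1 s norm_triangle_mono c2)
      show "norm (((V j w)^2 - 1) * (cis (step l j w) - 1)) \<le> 2 * (norm (1 - p) * (?d + 1)) * (norm l * ?d)"
        unfolding norm_mult by (intro mult_mono V2 c1) auto
    qed auto
    also have "\<dots> = norm l * norm (1 - p) * (2 * ?d^2 + 2 * ?d) + (norm l)^2 / 2 * ?d^2"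
      by (simp add: power2_eq_square algebra_simps)
    \<comment> \<open>By \<open>2 * ?d \<le> ?d^2 + 1\<close> only the second moment of
      \<open>D\<close> is left to integrate.\<close>
    also have "\<dots> \<le> norm l * norm (1 - p) * (2 * ?d^2 + (?d^2 + 1)) + (norm l)^2 / 2 * ?d^2"
      using sum_squares_bound[of ?d 1] by (intro add_right_mono mult_left_mono) auto
    finally show "norm (r w) \<le> (norm l * norm (1 - p) * 3 + (norm l)^2 / 2) * norm (D j w) ^ 2 + norm l * norm (1 - p)"
      by (simp add: algebra_simps)
  qed (use norm_D_integrable[of j 2] in auto)
  also have "\<dots> = mix_err l"
    using norm_D_integrable[of j 2] by (simp add: mean_norm_D2 prob_space mix_err_def algebra_simps)
  finally have "norm (expectation r) \<le> mix_err l" .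
  then have "norm (expectation v * q + expectation r) \<le> norm (expectation v * q) + mix_err l"
    by (intro norm_triangle_mono) auto
  then show ?thesis unfolding E v_def[symmetric] by (simp add: norm_mult mult.commute)
qed

text \<open>The weight \<open>G\<close> will be the product of the exponentials of earlier blocks,
  which lets blocks be chained.\<close>

definition tilt :: "('a \<Rightarrow> complex) \<Rightarrow> nat \<Rightarrow> complex \<Rightarrow> nat \<Rightarrow> 'a \<Rightarrow> complex" where
  "tilt G k l i w = G w * cis (Re (cnj l * (mart (k + i) w - mart k w)))"

lemma adm_tilt: "adm k G \<Longrightarrow> adm (k + i) (tilt G k l i)"
  unfolding tilt_def by (intro adm_mult adm_cis adm_const adm_diff adm_mart) (auto intro: adm_mono)

lemma norm_tilt: "norm (G w) \<le> 1 \<Longrightarrow> norm (tilt G k l i w) \<le> 1"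
  by (simp add: tilt_def norm_mult)

lemma tilt_Suc: "tilt G k l (Suc i) w = tilt G k l i w * cis (step l (k + i) w)"
  unfolding tilt_def step_def mult.assoc cis_mult add_Suc_right mart_Suc by (simp add: algebra_simps)

text \<open>The tilted means of \<open>U^2\<close> start at most at 1 and contract by
  \<open>norm q\<close> up to \<open>mix_err\<close>, so apart from that error their sum is bounded
  independently of the block length.\<close>

lemma rotation_sum_bound:
  assumes G: "adm k G" and G1: "\<And>w. w \<in> space M \<Longrightarrow> norm (G w) \<le> 1"
  shows "(\<Sum>i<n. norm (expectation (\<lambda>w. tilt G k l i w * (U (k + i) w)^2)))
    \<le> (1 + real n * mix_err l) / (1 - norm q)"
proof (rule contraction_sum_le)
  let ?f = "tilt G k l"
  note f = adm_tilt[OF G]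
  have f1: "norm (?f i w) \<le> 1" if "w \<in> space M" for i w
    by (rule norm_tilt) (rule G1[OF that])
  show "norm (expectation (\<lambda>w. ?f (Suc i) w * (U (k + Suc i) w)^2)) \<le>
    norm q * norm (expectation (\<lambda>w. ?f i w * (U (k + i) w)^2)) + mix_err l" for i
    unfolding tilt_Suc add_Suc_right by (rule expectation_cis_step_U2[OF f f1])
  show "norm (expectation (\<lambda>w. ?f 0 w * (U (k + 0) w)^2)) \<le> 1"
  proof (rule norm_expectation_le_const)
    show "adm (k + 0) (\<lambda>w. ?f 0 w * (U (k + 0) w)^2)" by (intro adm_mult f adm_power adm_U) simp
    show "norm (?f 0 w * (U (k + 0) w)^2) \<le> 1" if "w \<in> space M" for w
      using f1[OF that, of 0] by (simp add: norm_mult norm_power norm_U that)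
  qed
qed (use q_less in auto)

text \<open>Each step multiplies the tilted mean by nearly \<open>1 - rate l\<close>, hence the
  block by nearly \<open>exp (- rate l * real n)\<close>. The rotating errors are summed over the
  whole block before being estimated.\<close>

lemma block_characteristic:
  assumes G: "adm k G" and G1: "\<And>w. w \<in> space M \<Longrightarrow> norm (G w) \<le> 1"
  shows "norm (expectation (\<lambda>w. G w * cis (Re (cnj l * (mart (k + n) w - mart k w))))
      - of_real (exp (- rate l * real n)) * expectation G)
    \<le> real n * (cubic_err l + (rate l)^2) + rate l * (1 + real n * mix_err l) / (1 - norm q)"
proof -
  let ?f = "tilt G k l"
  let ?y = "\<lambda>i. norm (expectation (\<lambda>w. ?f i w * (U (k + i) w)^2))"
  let ?y' = "\<lambda>i. norm (expectation (\<lambda>w. ?f i w * (cnj (U (k + i) w))^2))"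
  note f = adm_tilt[OF G]
  have f1: "norm (?f i w) \<le> 1" if "w \<in> space M" for i w
    by (rule norm_tilt) (rule G1[OF that])
  have "norm (expectation (?f n) - of_real (exp (- rate l * real n)) * expectation (?f 0))
    \<le> (\<Sum>i<n. rate l / 2 * (?y i + ?y' i) + cubic_err l) + real n * (rate l)^2"
  proof (rule exp_recursion_error)
    show "norm (expectation (?f (Suc i)) - of_real (1 - rate l) * expectation (?f i))
      \<le> rate l / 2 * (?y i + ?y' i) + cubic_err l" for i
      unfolding tilt_Suc by (rule expectation_cis_step[OF f f1])
    show "norm (expectation (?f i)) \<le> 1" for i
      by (rule norm_expectation_le_const[OF f f1])
  qed (rule rate_nonneg)
  also have "(\<Sum>i<n. rate l / 2 * (?y i + ?y' i) + cubic_err l) =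
    rate l / 2 * ((\<Sum>i<n. ?y i) + (\<Sum>i<n. ?y' i)) + real n * cubic_err l"
    by (simp only: sum.distrib sum_distrib_left[symmetric] sum_constant card_lessThan)
  \<comment> \<open>Conjugation exchanges \<open>(cnj U)^2\<close> for \<open>U^2\<close> at the
    price of replacing \<open>G\<close> by its conjugate and \<open>l\<close> by \<open>- l\<close>;
    \<open>mix_err\<close> is even in \<open>l\<close>.\<close>
  also have "(\<Sum>i<n. ?y' i) = (\<Sum>i<n. norm (expectation (\<lambda>w. tilt (\<lambda>w. cnj (G w)) k (- l) i w * (U (k + i) w)^2)))"
  proof (rule sum.cong[OF refl])
    fix i
    have "norm (expectation (\<lambda>w. ?f i w * (cnj (U (k + i) w))^2)) =
      norm (expectation (\<lambda>w. cnj (?f i w * (cnj (U (k + i) w))^2)))"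
      unfolding Bochner_Integration.integral_cnj complex_mod_cnj ..
    also have "(\<lambda>w. cnj (?f i w * (cnj (U (k + i) w))^2)) =
      (\<lambda>w. tilt (\<lambda>w. cnj (G w)) k (- l) i w * (U (k + i) w)^2)"
      by (simp add: cis_cnj tilt_def)
    finally show "?y' i = norm (expectation (\<lambda>w. tilt (\<lambda>w. cnj (G w)) k (- l) i w * (U (k + i) w)^2))" .
  qed
  also have "rate l / 2 * ((\<Sum>i<n. ?y i) + \<dots>) \<le> rate l / 2 *
      ((1 + real n * mix_err l) / (1 - norm q) + (1 + real n * mix_err (- l)) / (1 - norm q))"
    using rate_nonneg G1
    by (intro mult_left_mono add_mono rotation_sum_bound G adm_cnj) auto
  also have "\<dots> = rate l * (1 + real n * mix_err l) / (1 - norm q)"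
  proof -
    have "mix_err (- l) = mix_err l" by (simp add: mix_err_def)
    moreover have "a / 2 * (x + x) = a * x" for a x :: real by simp
    ultimately show ?thesis by (simp only: times_divide_eq_right)
  qed
  finally show ?thesis by (simp add: tilt_def algebra_simps)
qed

section \<open>Moments of martingale increments and a maximal inequality\<close>

definition mincr :: "nat \<Rightarrow> nat \<Rightarrow> 'a \<Rightarrow> complex" where
  "mincr k n w = mart (k + n) w - mart k w"

lemma mincr_Suc: "mincr k (Suc n) w = mincr k n w + U (k + n) w * D (k + n) w"
  by (simp add: mincr_def mart_Suc)

lemma adm_mincr: "k + n \<le> m \<Longrightarrow> adm m (mincr k n)"
  unfolding mincr_def[abs_def] by (intro adm_diff adm_mart) auto

lemma expectation_Re:
  assumes "adm k f" "expectation f = 0"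
  shows "expectation (\<lambda>w. Re (f w)) = 0"
  using adm_integrable[OF assms(1)] assms(2) by simp

lemma past_inner_D:
  assumes g: "adm j g"
  shows "expectation (\<lambda>w. Re (g w * (U j w * D j w))) = 0"
proof (rule expectation_Re)
  show "adm (Suc j) (\<lambda>w. g w * (U j w * D j w))"
    by (intro adm_mult adm_mono[OF g] adm_U adm_D) auto
  show "expectation (\<lambda>w. g w * (U j w * D j w)) = 0"
    unfolding mult.assoc[symmetric] by (intro past_D adm_mult g adm_U) simp
qed

lemma adm_Re_integrable:
  assumes "adm k f"
  shows "integrable M (\<lambda>w. Re (f w))"
  using adm_integrable[OF assms] by simp

text \<open>Martingale differences are orthogonal, and the rotation \<open>U\<close> of modulus 1
  does not affect their size.\<close>

lemma second_moment: "expectation (\<lambda>w. (norm (mincr k n w))^2) = real n * vari"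
proof (induction n)
  case 0
  show ?case by (simp add: mincr_def)
next
  case (Suc n)
  let ?S = "mincr k n" and ?j = "k + n"
  have S: "adm ?j ?S" by (rule adm_mincr) simp
  have SS: "adm (Suc ?j) ?S" by (rule adm_mincr) simp
  have i: "integrable M (\<lambda>w. (norm (?S w))^2)" "integrable M (\<lambda>w. (norm (D ?j w))^2)"
    "integrable M (\<lambda>w. Re (cnj (?S w) * (U ?j w * D ?j w)))"
    by (intro adm_integrable_norm[OF S] norm_D_integrable adm_Re_integrable[of "Suc ?j"] adm_mult adm_cnj SS adm_U adm_D; simp)+
  have "expectation (\<lambda>w. (norm (mincr k (Suc n) w))^2) =
    expectation (\<lambda>w. (norm (?S w))^2 + 2 * Re (cnj (?S w) * (U ?j w * D ?j w)) + (norm (D ?j w))^2)"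
    unfolding mincr_Suc norm_sum_sq
    by (intro Bochner_Integration.integral_cong refl) (simp only: norm_mult norm_U mult_1_left)
  also have "\<dots> = real n * vari + 2 * 0 + vari"
    using i by (simp only: Bochner_Integration.integral_add Bochner_Integration.integrable_add
       integrable_mult_right integral_mult_right_zero Suc.IH mean_norm_D2 past_inner_D[OF adm_cnj[OF S]])
  finally show ?case by (simp add: algebra_simps)
qed

text \<open>One step adds \<open>8 * vari^2 * real n\<close> through the product of
  \<open>|S|^2\<close> with the independent \<open>|D|^2\<close>, which the growth of
  \<open>4 * vari^2 * (real n)^2\<close> absorbs; the linear term has mean zero.\<close>

lemma fourth_moment:
  "expectation (\<lambda>w. (norm (mincr k n w)) ^ 4) \<le> 4 * vari^2 * (real n)^2 + 3 * bnd^2 * vari * real n"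
proof (induction n)
  case 0
  show ?case by (simp add: mincr_def)
next
  case (Suc n)
  let ?S = "mincr k n" and ?j = "k + n"
  let ?g = "\<lambda>w. ?S w * cnj (?S w) * cnj (?S w)"
  have S: "adm ?j ?S" by (rule adm_mincr) simp
  have g: "adm ?j ?g" by (intro adm_mult adm_cnj S)
  have gS: "adm (Suc ?j) ?g" by (rule adm_mono[OF g]) simp
  have SD: "integrable M (\<lambda>w. (norm (?S w))^2 * (norm (D ?j w))^2)"
  proof -
    have "adm (Suc ?j) (\<lambda>w. ?S w * D ?j w)" by (intro adm_mult adm_mincr adm_D) auto
    from adm_integrable_norm[OF this, of 2] show ?thesis by (simp add: norm_mult power_mult_distrib)
  qed
  have R: "integrable M (\<lambda>w. Re (?g w * (U ?j w * D ?j w)))"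
    by (intro adm_Re_integrable[of "Suc ?j"] adm_mult[OF gS] adm_mult adm_U adm_D) auto
  have S4: "integrable M (\<lambda>w. (norm (?S w)) ^ 4)" by (rule adm_integrable_norm[OF S])
  have D2: "integrable M (\<lambda>w. (norm (D ?j w))^2)" by (rule norm_D_integrable)
  have "expectation (\<lambda>w. (norm (mincr k (Suc n) w)) ^ 4) \<le>
    expectation (\<lambda>w. (norm (?S w)) ^ 4 + 8 * ((norm (?S w))^2 * (norm (D ?j w))^2) + 3 * bnd^2 * (norm (D ?j w))^2
      + 4 * Re (?g w * (U ?j w * D ?j w)))"
  proof (rule integral_mono)
    show "integrable M (\<lambda>w. (norm (mincr k (Suc n) w)) ^ 4)"
      by (rule adm_integrable_norm[OF adm_mincr[OF order_refl]])
    show "integrable M (\<lambda>w. (norm (?S w)) ^ 4 + 8 * ((norm (?S w))^2 * (norm (D ?j w))^2) + 3 * bnd^2 * (norm (D ?j w))^2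
      + 4 * Re (?g w * (U ?j w * D ?j w)))"
      by (intro Bochner_Integration.integrable_add integrable_mult_right S4 SD D2 R)
    fix w assume s: "w \<in> space M"
    have n: "norm (U ?j w * D ?j w) = norm (D ?j w)" by (simp add: norm_mult norm_U s)
    have "?g w * (U ?j w * D ?j w) = of_real ((norm (?S w))^2) * (cnj (?S w) * (U ?j w * D ?j w))"
      unfolding complex_norm_square by (simp add: mult_ac)
    then have "Re (?g w * (U ?j w * D ?j w)) = (norm (?S w))^2 * Re (cnj (?S w) * (U ?j w * D ?j w))"
      by (simp only: Re_complex_of_real times_complex.sel Im_complex_of_real, simp?)
    then show "(norm (mincr k (Suc n) w)) ^ 4 \<le> (norm (?S w)) ^ 4 + 8 * ((norm (?S w))^2 * (norm (D ?j w))^2)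
      + 3 * bnd^2 * (norm (D ?j w))^2 + 4 * Re (?g w * (U ?j w * D ?j w))"
      using fourth_power_bound[of "U ?j w * D ?j w" bnd "?S w"] norm_D[OF s, of ?j] unfolding mincr_Suc n by simp
  qed
  also have "\<dots> = expectation (\<lambda>w. (norm (?S w)) ^ 4) + 8 * (real n * vari * vari) + 3 * bnd^2 * vari + 4 * 0"
    using S4 SD D2 R by (simp only: Bochner_Integration.integral_add Bochner_Integration.integrable_add
       integrable_mult_right integral_mult_right_zero past_norm_D2[OF S] second_moment mean_norm_D2 past_inner_D[OF g])
  also have "\<dots> \<le> (4 * vari^2 * (real n)^2 + 3 * bnd^2 * vari * real n) + 8 * (real n * vari * vari) + 3 * bnd^2 * vari + 4 * 0"
    using Suc.IH by simp
  also have "\<dots> \<le> 4 * vari^2 * (real (Suc n))^2 + 3 * bnd^2 * vari * real (Suc n)"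
  proof -
    have "0 \<le> 4 * vari^2" by simp
    then show ?thesis by (simp add: power2_eq_square algebra_simps)
  qed
  finally show ?case .
qed

text \<open>Doob's inequality for the fourth power, by decomposing according to the first time the
  level \<open>a\<close> is reached. Convexity bounds \<open>|t|^4\<close> below by its tangent at
  the stopped value, and the linear part of the tangent has mean zero on an event of the
  past.\<close>

lemma maximal_inequality:
  assumes a: "0 < a"
  shows "{w \<in> space M. \<exists>j\<le>n. a \<le> norm (mincr k j w)} \<in> events"
    and "a ^ 4 * prob {w \<in> space M. \<exists>j\<le>n. a \<le> norm (mincr k j w)} \<le> expectation (\<lambda>w. (norm (mincr k n w)) ^ 4)"
proof -
  \<comment> \<open>The level is reached at time \<open>j\<close> for the first time; this depends
    on the first \<open>k + j\<close> factors only and makes the events disjoint.\<close>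
  define A where "A j = {w \<in> space M. a \<le> norm (mincr k j w) \<and> (\<forall>i<j. norm (mincr k i w) < a)}" for j
  have meas: "mincr k i \<in> borel_measurable (past (k + j))" if "i \<le> j" for i j
    using adm_mincr[of k i "k + j"] that by (simp add: adm_def)
  have A_past: "A j \<in> sets (past (k + j))" for j
  proof -
    have norm_meas: "(\<lambda>w. norm (mincr k i w)) \<in> borel_measurable (past (k + j))" if "i \<le> j" for i
      by (rule measurable_compose[OF meas[OF that] borel_measurable_norm])
    have "A j = {w \<in> space (past (k + j)). a \<le> norm (mincr k j w)} \<inter>
      {w \<in> space (past (k + j)). \<forall>i\<in>{..<j}. norm (mincr k i w) < a}"
      by (auto simp: A_def)
    also have "\<dots> \<in> sets (past (k + j))"
    proof (rule sets.Int)
      show "{w \<in> space (past (k + j)). a \<le> norm (mincr k j w)} \<in> sets (past (k + j))"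
        by (intro borel_measurable_le borel_measurable_const norm_meas order_refl)
      show "{w \<in> space (past (k + j)). \<forall>i\<in>{..<j}. norm (mincr k i w) < a} \<in> sets (past (k + j))"
      proof (rule sets.sets_Collect_finite_All)
        fix i assume "i \<in> {..<j}"
        then show "{w \<in> space (past (k + j)). norm (mincr k i w) < a} \<in> sets (past (k + j))"
          by (intro borel_measurable_less borel_measurable_const norm_meas) simp
      qed simp
    qed
    finally show ?thesis .
  qed
  have A_ev[measurable]: "A j \<in> events" for j using A_past sets_past_M by blast
  have eq: "{w \<in> space M. \<exists>j\<le>n. a \<le> norm (mincr k j w)} = (\<Union>j\<in>{..n}. A j)"
  proof (intro set_eqI iffI)
    fix w assume "w \<in> {w \<in> space M. \<exists>j\<le>n. a \<le> norm (mincr k j w)}"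
    then obtain j where j: "w \<in> space M" "j \<le> n" "a \<le> norm (mincr k j w)" by auto
    define J where "J = (LEAST i. a \<le> norm (mincr k i w))"
    have "a \<le> norm (mincr k J w)" "J \<le> j" "\<forall>i<J. norm (mincr k i w) < a"
      unfolding J_def using j by (auto intro: LeastI Least_le dest: not_less_Least)
    then show "w \<in> (\<Union>j\<in>{..n}. A j)" using j by (auto simp: A_def intro!: bexI[of _ J])
  qed (auto simp: A_def)
  show "{w \<in> space M. \<exists>j\<le>n. a \<le> norm (mincr k j w)} \<in> events"
    unfolding eq by auto
  have disj: "disjoint_family_on A {..n}"
    unfolding disjoint_family_on_def A_def
    by (auto simp: linorder_neq_iff)
  have I4: "integrable M (\<lambda>w. (norm (mincr k n w)) ^ 4)"
    by (rule adm_integrable_norm[OF adm_mincr[OF order_refl]])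
  have I4A: "integrable M (\<lambda>w. indicator (A j) w * (norm (mincr k n w)) ^ 4)" for j
    using integrable_mult_indicator[OF A_ev I4] by simp
  have part: "a ^ 4 * prob (A j) \<le> expectation (\<lambda>w. indicator (A j) w * (norm (mincr k n w)) ^ 4)"
    if j: "j \<le> n" for j
  proof -
    \<comment> \<open>The weight \<open>|s|^2 * cnj s\<close>, restricted to \<open>A j\<close>:
      four times the real part of its product with an increment is the linear term of the fourth
      power.\<close>
    define g where "g = (\<lambda>w. complex_of_real (indicator (A j) w) * (mincr k j w * cnj (mincr k j w) * cnj (mincr k j w)))"
    have ind: "adm (k + j) (\<lambda>w. complex_of_real (indicator (A j) w))"
    proof (rule admI[where K = 1])
      have "(\<lambda>w. indicator (A j) w :: real) \<in> borel_measurable (past (k + j))"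
        by (rule borel_measurable_indicator[OF A_past])
      then show "(\<lambda>w. complex_of_real (indicator (A j) w)) \<in> borel_measurable (past (k + j))"
        by (rule measurable_compose) simp
    qed (auto simp: indicator_def)
    have g: "adm (k + j) g"
      unfolding g_def by (intro adm_mult ind adm_cnj adm_mincr) auto
    have inc: "mincr k n w - mincr k j w = (\<Sum>i\<in>{k + j..<k + n}. U i w * D i w)" for w
    proof -
      have "(\<Sum>i\<in>{k + j..<k + n}. U i w * D i w) = mart (k + n) w - mart (k + j) w"
        using j sum_diff_nat_ivl[of 0 "k + j" "k + n" "\<lambda>i. U i w * D i w"]
        by (simp add: mart_def atLeast0LessThan)
      then show ?thesis by (simp add: mincr_def)
    qed
    have term0: "expectation (\<lambda>w. Re (g w * (U i w * D i w))) = 0"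
      "integrable M (\<lambda>w. Re (g w * (U i w * D i w)))" if "i \<in> {k + j..<k + n}" for i
    proof -
      show "expectation (\<lambda>w. Re (g w * (U i w * D i w))) = 0"
        using that by (intro past_inner_D adm_mono[OF g]) auto
      show "integrable M (\<lambda>w. Re (g w * (U i w * D i w)))"
        using that by (intro adm_Re_integrable[of "Suc i"] adm_mult adm_mono[OF g] adm_U adm_D) auto
    qed
    \<comment> \<open>The added sum has mean zero termwise and completes the tangent for a pointwise
      comparison.\<close>
    have "a ^ 4 * prob (A j) = expectation (\<lambda>w. a ^ 4 * indicator (A j) w) + 4 * (\<Sum>i\<in>{k + j..<k + n}. expectation (\<lambda>w. Re (g w * (U i w * D i w))))"
      using sets.sets_into_space[OF A_ev[of j]]
      by (simp add: term0 Int_absorb2 del: times_complex.sel)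
    also have "\<dots> = expectation (\<lambda>w. a ^ 4 * indicator (A j) w + 4 * (\<Sum>i\<in>{k + j..<k + n}. Re (g w * (U i w * D i w))))"
    proof -
      have "integrable M (\<lambda>w. a ^ 4 * indicator (A j) w :: real)"
        by (intro integrable_mult_right integrable_const_bound[where B = 1]) auto
      then show ?thesis
        by (subst Bochner_Integration.integral_add) (auto simp: term0 Bochner_Integration.integral_sum simp del: times_complex.sel)
    qed
    also have "\<dots> \<le> expectation (\<lambda>w. indicator (A j) w * (norm (mincr k n w)) ^ 4)"
    proof (rule integral_mono[OF _ I4A])
      show "integrable M (\<lambda>w. a ^ 4 * indicator (A j) w + 4 * (\<Sum>i\<in>{k + j..<k + n}. Re (g w * (U i w * D i w))))"
        by (intro Bochner_Integration.integrable_add integrable_mult_right Bochner_Integration.integrable_sum term0(2)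
             integrable_const_bound[where B = 1]) auto
      fix w assume s: "w \<in> space M"
      let ?s = "mincr k j w" and ?t = "mincr k n w"
      have e: "(\<Sum>i\<in>{k + j..<k + n}. Re (g w * (U i w * D i w))) = Re (g w * (?t - ?s))"
        unfolding inc sum_distrib_left Re_sum ..
      show "a ^ 4 * indicator (A j) w + 4 * (\<Sum>i\<in>{k + j..<k + n}. Re (g w * (U i w * D i w)))
        \<le> indicator (A j) w * (norm ?t) ^ 4"
      proof (cases "w \<in> A j")
        case True
        let ?b = "(norm ?s)^2" and ?r = "Re (cnj ?s * (?t - ?s))"
        have "g w * (?t - ?s) = of_real ?b * (cnj ?s * (?t - ?s))"
          unfolding complex_norm_square using True by (simp add: g_def mult_ac)
        then have gr: "Re (g w * (?t - ?s)) = ?b * ?r"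
          by (simp only: Re_complex_of_real times_complex.sel Im_complex_of_real, simp?)
        have "(norm ?t)^2 = ?b + 2 * ?r + (norm (?t - ?s))^2"
          using norm_sum_sq[of ?s "?t - ?s"] by simp
        then have "?b * (?b + 2 * ?r) \<le> ?b * (norm ?t)^2" by (intro mult_left_mono) auto
        \<comment> \<open>The tangent inequality follows from two convexity bounds: this one for
          squaring, and the preceding one for the squared modulus.\<close>
        moreover have "0 \<le> ((norm ?t)^2 - ?b)^2" by simp
        ultimately have "?b * ?b + 4 * (?b * ?r) \<le> (norm ?t)^2 * (norm ?t)^2"
          unfolding power2_diff by (simp add: power2_eq_square[of "(norm ?t)^2"] power2_eq_square[of ?b] algebra_simps)
        moreover have "a ^ 4 \<le> ?b * ?b"
        proof -
          have "a ^ 4 \<le> (norm ?s) ^ 4" using True a by (intro power_mono) (auto simp: A_def)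
          then show ?thesis by (simp add: power4_eq_xxxx power2_eq_square)
        qed
        ultimately show ?thesis using True unfolding e gr by (simp add: power4_eq_xxxx power2_eq_square)
      next
        case False
        then show ?thesis by (simp add: g_def)
      qed
    qed
    finally show ?thesis .
  qed
  have "a ^ 4 * prob {w \<in> space M. \<exists>j\<le>n. a \<le> norm (mincr k j w)} = (\<Sum>j\<in>{..n}. a ^ 4 * prob (A j))"
    unfolding eq sum_distrib_left[symmetric] by (subst finite_measure_finite_Union[OF _ _ disj]) auto
  also have "\<dots> \<le> (\<Sum>j\<in>{..n}. expectation (\<lambda>w. indicator (A j) w * (norm (mincr k n w)) ^ 4))"
    by (intro sum_mono part) auto
  also have "\<dots> = expectation (\<lambda>w. \<Sum>j\<in>{..n}. indicator (A j) w * (norm (mincr k n w)) ^ 4)"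
    by (intro Bochner_Integration.integral_sum[symmetric] I4A)
  also have "\<dots> \<le> expectation (\<lambda>w. (norm (mincr k n w)) ^ 4)"
  proof (rule integral_mono[OF _ I4])
    show "integrable M (\<lambda>w. \<Sum>j\<in>{..n}. indicator (A j) w * (norm (mincr k n w)) ^ 4)"
      by (intro Bochner_Integration.integrable_sum I4A)
    fix w
    have "(\<Sum>j\<in>{..n}. indicator (A j) w :: real) = indicator (\<Union>j\<in>{..n}. A j) w"
      using disj by (intro indicator_UN_disjoint[symmetric]) auto
    also have "\<dots> \<le> 1" by (simp add: indicator_def)
    finally have "(\<Sum>j\<in>{..n}. indicator (A j) w) * (norm (mincr k n w)) ^ 4 \<le> 1 * (norm (mincr k n w)) ^ 4"
      by (intro mult_right_mono) auto
    then show "(\<Sum>j\<in>{..n}. indicator (A j) w * (norm (mincr k n w)) ^ 4) \<le> (norm (mincr k n w)) ^ 4"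
      by (simp add: sum_distrib_right)
  qed
  finally show "a ^ 4 * prob {w \<in> space M. \<exists>j\<le>n. a \<le> norm (mincr k j w)} \<le> expectation (\<lambda>w. (norm (mincr k n w)) ^ 4)" .
qed

end

section \<open>Characteristic function of Brownian increments\<close>

lemma (in prob_space) normal_char:
  assumes "distributed M lborel X (normal_density 0 \<sigma>)" "0 < \<sigma>"
  shows "expectation (\<lambda>w. cis (a * X w)) = of_real (exp (- (a^2 * \<sigma>^2) / 2))"
proof -
  have d: "distributed M lborel (\<lambda>x. (X x - 0) / \<sigma>) std_normal_density"
    using assms normal_standard_normal_convert[of \<sigma> X 0] by simp
  then have m: "(\<lambda>x. X x / \<sigma>) \<in> measurable M lborel"
    by (auto simp: distributed_def)
  have e: "distr M lborel (\<lambda>x. X x / \<sigma>) = std_normal_distribution"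
    using d by (simp add: distributed_def)
  have "expectation (\<lambda>w. cis (a * X w)) = expectation (\<lambda>w. iexp ((a * \<sigma>) * (X w / \<sigma>)))"
    using assms(2) by (simp add: cis_conv_exp)
  also have "\<dots> = (CLINT x|distr M lborel (\<lambda>x. X x / \<sigma>). iexp ((a * \<sigma>) * x))"
    by (rule integral_distr[symmetric, OF m]) simp
  also have "\<dots> = char std_normal_distribution (a * \<sigma>)"
    unfolding e char_def ..
  also have "\<dots> = of_real (exp (- (a^2 * \<sigma>^2) / 2))"
    by (simp add: char_std_normal_distribution power_mult_distrib)
  finally show ?thesis .
qed

lemma (in std_brownian_motion) increments_char:
  assumes T: "0 < T" and n: "0 < n"
  shows "expectation (\<lambda>w. cis (\<Sum>r<n. a r * (W (T * real (Suc r) / real n) w - W (T * real r / real n) w)))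
    = of_real (exp (- (\<Sum>r<n. (a r)^2) * T / (2 * real n)))"
proof -
  define \<tau> where "\<tau> k = T * real k / real n" for k
  define I where "I k w = W (\<tau> (Suc k)) w - W (\<tau> k) w" for k w
  have "indep_vars (\<lambda>_. borel) (\<lambda>k w. W (\<tau> (Suc k)) w - W (\<tau> k) w) {..<n}"
  proof (rule independent_increments)
    show "mono_on {..n} \<tau>"
      unfolding \<tau>_def using T by (intro mono_onI divide_right_mono mult_left_mono) auto
  qed (use T n in \<open>auto simp: \<tau>_def\<close>)
  then have ind: "indep_vars (\<lambda>_. borel) (\<lambda>r w. I r w) {..<n}" unfolding I_def .
  have cis_m: "(\<lambda>x. cis (c * x)) \<in> borel_measurable borel" for c
    by (rule borel_measurable_continuous_onI) (intro continuous_intros)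
  have ind2: "indep_vars (\<lambda>_. borel) (\<lambda>r w. cis (a r * I r w)) {..<n}"
    by (rule indep_vars_compose2[OF ind cis_m])
  have int: "integrable M (\<lambda>w. cis (a r * I r w))" if "r \<in> {..<n}" for r
  proof (rule integrable_const_bound[where B = 1])
    show "(\<lambda>w. cis (a r * I r w)) \<in> borel_measurable M"
      using ind2 that by (auto simp: indep_vars_def)
  qed simp
  have single: "expectation (\<lambda>w. cis (a r * I r w)) = of_real (exp (- ((a r)^2 * (T / real n)) / 2))"
    if "r < n" for r
  proof -
    have d: "\<tau> (Suc r) - \<tau> r = T / real n"
      by (simp add: \<tau>_def ring_distribs add_divide_distrib)
    have pos: "0 < T / real n" using T n by simp
    have "\<tau> (Suc r) \<le> T" "0 \<le> \<tau> r"
      using grid_point[OF T, of "Suc r" n] grid_point[OF T, of r n] that by (auto simp: \<tau>_def)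
    then have "distributed M lborel (I r) (normal_density 0 (sqrt (\<tau> (Suc r) - \<tau> r)))"
      unfolding I_def using d pos by (intro gaussian_increments) linarith+
    from normal_char[OF this, of "a r"] show ?thesis
      using pos unfolding d by simp
  qed
  have "expectation (\<lambda>w. cis (\<Sum>r<n. a r * I r w)) = expectation (\<lambda>w. \<Prod>r\<in>{..<n}. cis (a r * I r w))"
    by (simp add: cis_sum)
  also have "\<dots> = (\<Prod>r\<in>{..<n}. expectation (\<lambda>w. cis (a r * I r w)))"
    by (rule indep_vars_lebesgue_integral[OF _ ind2 int]) simp
  also have "\<dots> = (\<Prod>r\<in>{..<n}. of_real (exp (- ((a r)^2 * (T / real n)) / 2)))"
    by (intro prod.cong refl single) simp
  also have "\<dots> = of_real (exp (\<Sum>r<n. - ((a r)^2 * (T / real n)) / 2))"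
    by (simp add: exp_sum)
  also have "(\<Sum>r<n. - ((a r)^2 * (T / real n)) / 2) = (\<Sum>r<n. (a r)^2 * (- T / (2 * real n)))"
    by (intro sum.cong refl) simp
  also have "\<dots> = (\<Sum>r<n. (a r)^2) * (- T / (2 * real n))"
    by (rule sum_distrib_right[symmetric])
  finally show ?thesis unfolding I_def \<tau>_def by simp
qed

lemma complex_brownian_path_process:
  assumes T: "0 < T" and B: "complex_brownian_motion N T B"
  shows "path_process N T B"
proof -
  interpret R: std_brownian_motion N T "\<lambda>t w. Re (B t w)"
    using B by (simp add: complex_brownian_motion_def)
  interpret I: std_brownian_motion N T "\<lambda>t w. Im (B t w)"
    using B by (simp add: complex_brownian_motion_def)
  show ?thesis
  proof
    fix w assume w: "w \<in> space N"
    have "continuous_on {0..T} (\<lambda>t. of_real (Re (B t w)) + \<i> * of_real (Im (B t w)))"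
      by (intro continuous_intros R.continuous_paths[OF w] I.continuous_paths[OF w])
    then show "continuous_on {0..T} (\<lambda>t. B t w)" by (simp flip: complex_eq)
    show "B 0 w = 0" using R.start[OF w] I.start[OF w] by (simp add: complex_eq_iff)
  next
    fix t assume "t \<in> {0..T}"
    then show "B t \<in> borel_measurable N"
      using R.random_variable I.random_variable by (simp add: borel_measurable_complex_iff)
  qed (rule T)
qed

text \<open>The inner product splits the phase into a functional of the real part and one of the
  imaginary part; independence of the two processes factorises the mean, and squared coordinates
  recombine to \<open>(norm (\<mu> r))^2\<close>.\<close>

lemma complex_brownian_increments_char:
  assumes T: "0 < T" and B: "complex_brownian_motion N T B" and n: "0 < n"
  shows "(LINT w|N. cis (\<Sum>r<n. Re (cnj (\<mu> r) * path_process.incr T B n w r)))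
    = of_real (exp (- (\<Sum>r<n. (norm (\<mu> r))^2) * T / (2 * real n)))"
proof -
  interpret R: std_brownian_motion N T "\<lambda>t w. Re (B t w)"
    using B by (simp add: complex_brownian_motion_def)
  interpret I: std_brownian_motion N T "\<lambda>t w. Im (B t w)"
    using B by (simp add: complex_brownian_motion_def)
  interpret path_process N T B by (rule complex_brownian_path_process[OF T B])
  let ?P = "\<Pi>\<^sub>M t\<in>{0..T}. borel :: real measure"
  have ind: "R.indep_var ?P (\<lambda>w. \<lambda>t\<in>{0..T}. Re (B t w)) ?P (\<lambda>w. \<lambda>t\<in>{0..T}. Im (B t w))"
    using B by (simp add: complex_brownian_motion_def)
  \<comment> \<open>Written as a functional of a whole real path, to be composed with the random
    elements of the product space whose independence is assumed. It reads grid points in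
    \<open>{0..T}\<close> only, so the restriction is invisible to it.\<close>
  define \<phi> where "\<phi> a x = cis (\<Sum>r<n. a r * (x (T * real (Suc r) / real n) - x (T * real r / real n)))"
    for a :: "nat \<Rightarrow> real" and x :: "real \<Rightarrow> real"
  have grid: "T * real (Suc r) / real n \<in> {0..T}" "T * real r / real n \<in> {0..T}" if "r < n" for r
    using that by (auto intro!: grid_point T simp del: of_nat_Suc atLeastAtMost_iff)
  have \<phi>_m: "\<phi> a \<in> borel_measurable ?P" for a
  proof -
    have "(\<lambda>x. \<Sum>r<n. a r * (x (T * real (Suc r) / real n) - x (T * real r / real n))) \<in> borel_measurable ?P"
      using grid by (intro borel_measurable_sum borel_measurable_times borel_measurable_diff measurable_component_singleton) auto
    then show ?thesis unfolding \<phi>_def[abs_def] by (rule measurable_compose[OF _ cis_measurable])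
  qed
  have r: "\<phi> a (\<lambda>t\<in>{0..T}. x t) = \<phi> a x" for a x
    unfolding \<phi>_def using grid by (intro arg_cong[where f = cis] sum.cong refl) auto
  have "R.indep_var borel (\<phi> (\<lambda>r. Re (\<mu> r)) \<circ> (\<lambda>w. \<lambda>t\<in>{0..T}. Re (B t w))) borel
     (\<phi> (\<lambda>r. Im (\<mu> r)) \<circ> (\<lambda>w. \<lambda>t\<in>{0..T}. Im (B t w)))"
    by (rule R.indep_var_compose[OF ind \<phi>_m \<phi>_m])
  then have ind2: "R.indep_var borel (\<lambda>w. \<phi> (\<lambda>r. Re (\<mu> r)) (\<lambda>t. Re (B t w))) borel
     (\<lambda>w. \<phi> (\<lambda>r. Im (\<mu> r)) (\<lambda>t. Im (B t w)))"
    by (simp add: comp_def r)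
  have int: "integrable N (\<lambda>w. \<phi> (\<lambda>r. Re (\<mu> r)) (\<lambda>t. Re (B t w)))" "integrable N (\<lambda>w. \<phi> (\<lambda>r. Im (\<mu> r)) (\<lambda>t. Im (B t w)))"
    using R.indep_var_rv1[OF ind2] R.indep_var_rv2[OF ind2]
    by (auto intro!: R.integrable_const_bound[where B = 1] simp: \<phi>_def)
  have "(LINT w|N. cis (\<Sum>r<n. Re (cnj (\<mu> r) * incr n w r))) =
    (LINT w|N. \<phi> (\<lambda>r. Re (\<mu> r)) (\<lambda>t. Re (B t w)) * \<phi> (\<lambda>r. Im (\<mu> r)) (\<lambda>t. Im (B t w)))"
    unfolding \<phi>_def cis_mult sum.distrib[symmetric]
    by (intro Bochner_Integration.integral_cong refl arg_cong[where f = cis] sum.cong)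
       (simp add: incr_def grid_incr_def)
  also have "\<dots> = (LINT w|N. \<phi> (\<lambda>r. Re (\<mu> r)) (\<lambda>t. Re (B t w))) * (LINT w|N. \<phi> (\<lambda>r. Im (\<mu> r)) (\<lambda>t. Im (B t w)))"
    by (rule R.indep_var_lebesgue_integral[OF ind2 int])
  also have "\<dots> = of_real (exp (- (\<Sum>r<n. (Re (\<mu> r))^2) * T / (2 * real n))) * of_real (exp (- (\<Sum>r<n. (Im (\<mu> r))^2) * T / (2 * real n)))"
    unfolding \<phi>_def R.increments_char[OF T n] I.increments_char[OF T n] ..
  also have "\<dots> = of_real (exp (- (\<Sum>r<n. (norm (\<mu> r))^2) * T / (2 * real n)))"
    unfolding of_real_mult[symmetric] exp_add[symmetric] cmod_power2 sum.distrib
    by (simp add: algebra_simps add_divide_distrib diff_divide_distrib)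
  finally show ?thesis .
qed

section \<open>The rotated Levy process\<close>

text \<open>By the choice of the denominator \<open>1 - p\<close> in \<open>dd\<close>,
  \<open>U k * D k\<close> equals \<open>U k\<close> plus
  \<open>(U (Suc k) - U k) / (1 - p)\<close>, and the second part telescopes. This is the discrete
  Poisson equation, with a boundary term of modulus at most \<open>bnd\<close>.\<close>

lemma (in unit_walk) mart_eq:
  "mart k w = (\<Sum>i<k. U i w) + (U k w - 1) / (1 - p)"
proof (induction k)
  case (Suc k)
  have "U k w * D k w = U k w + (U (Suc k) w - U k w) / (1 - p)"
    using p_neq_1 by (simp add: U_Suc D_def dd_def field_simps)
  then show ?case by (simp add: mart_Suc Suc.IH add_divide_distrib diff_divide_distrib)
qed (simp add: mart_def U_def)

section \<open>The Levy process sampled on a mesh\<close>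

locale levy_rotation = levy_process +
  fixes \<psi> :: "real \<Rightarrow> complex" and \<theta> :: real
  assumes exponent: "levy_exponent M X \<psi>"
    and nonzero: "Re (\<psi> \<theta>) * Re (\<psi> (2 * \<theta>)) \<noteq> 0"
begin

lemma char_increment:
  assumes "0 \<le> s" "s \<le> t"
  shows "expectation (\<lambda>w. cis (u * (X t w - X s w))) = exp (- (of_real (t - s) * \<psi> u))"
proof -
  have m: "(\<lambda>x. cis (u * x)) \<in> borel_measurable borel"
    by (rule borel_measurable_continuous_onI) (intro continuous_intros)
  have rv: "X r \<in> borel_measurable M" if "0 \<le> r" for r using random_variable[OF that] .
  have "expectation (\<lambda>w. cis (u * (X t w - X s w))) = (LINT x|distr M borel (\<lambda>w. X t w - X s w). cis (u * x))"
    using assms by (intro integral_distr[symmetric] m borel_measurable_diff rv) auto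
  also have "\<dots> = (LINT x|distr M borel (\<lambda>w. X (t - s) w - X 0 w). cis (u * x))"
    using stationary_increments[OF assms] by simp
  also have "\<dots> = expectation (\<lambda>w. cis (u * (X (t - s) w - X 0 w)))"
    using assms by (intro integral_distr m borel_measurable_diff rv) auto
  also have "\<dots> = (CLINT w|M. iexp (u * X (t - s) w))"
    by (intro Bochner_Integration.integral_cong refl) (simp add: start cis_conv_exp)
  also have "\<dots> = exp (- (of_real (t - s) * \<psi> u))"
    using exponent assms unfolding levy_exponent_def by simp
  finally show ?thesis .
qed

lemma norm_exp_psi: "norm (exp (- (of_real t * \<psi> u))) = exp (- t * Re (\<psi> u))"
  by (simp add: norm_exp_eq_Re)

text \<open>Characteristic functions have modulus at most 1. This turns the nonvanishing of the two
  real parts into strict positivity.\<close>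

lemma Re_psi_nonneg: "0 \<le> Re (\<psi> u)"
proof -
  have "norm (expectation (\<lambda>w. cis (u * (X 1 w - X 0 w)))) \<le> expectation (\<lambda>w. norm (cis (u * (X 1 w - X 0 w))))"
    by (rule integral_norm_bound)
  also have "\<dots> = 1" by (simp add: prob_space)
  finally have "norm (exp (- (of_real (1 - 0) * \<psi> u))) \<le> 1"
    using char_increment[of 0 1 u] by simp
  then show ?thesis unfolding norm_exp_psi by simp
qed

lemma Re_psi_pos: "0 < Re (\<psi> \<theta>)" "0 < Re (\<psi> (2 * \<theta>))"
  using Re_psi_nonneg[of \<theta>] Re_psi_nonneg[of "2 * \<theta>"] nonzero by (auto simp: less_le)

lemma psi_nonzero: "\<psi> \<theta> \<noteq> 0"
  using Re_psi_pos by auto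

definition walk :: "real \<Rightarrow> nat \<Rightarrow> 'a \<Rightarrow> complex" where
  "walk h i w = cis (\<theta> * (X (real (Suc i) * h) w - X (real i * h) w))"

lemma unit_walk_walk:
  assumes h: "0 < h"
  shows "unit_walk M (walk h) (exp (- (of_real h * \<psi> \<theta>))) (exp (- (of_real h * \<psi> (2 * \<theta>))))"
proof
  let ?I = "\<lambda>k w. X (real (Suc k) * h) w - X (real k * h) w"
  have fin: "indep_vars (\<lambda>_. borel) ?I {..<n}" for n :: nat
  proof (rule independent_increments)
    show "mono_on {..n} (\<lambda>k. real k * h)"
      using h by (intro mono_onI mult_right_mono) auto
  qed simp
  \<comment> \<open>Increments are independent along finite grids by assumption; an infinite family
    is independent once its finite subfamilies are, and each of these lies in an initial
    segment.\<close>
  have "indep_vars (\<lambda>_. borel) ?I UNIV"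
    unfolding indep_vars_def2
  proof (intro conjI ballI)
    show "?I i \<in> borel_measurable M" for i
      using fin[of "Suc i"] by (auto simp: indep_vars_def2)
    show "indep_sets (\<lambda>i. {?I i -` A \<inter> space M |A. A \<in> sets borel}) UNIV"
    proof (subst indep_sets_finite_index_sets, intro allI impI)
      fix J :: "nat set" assume J: "J \<subseteq> UNIV" "J \<noteq> {}" "finite J"
      then have "J \<subseteq> {..<Suc (Max J)}" by (auto simp: less_Suc_eq_le)
      then show "indep_sets (\<lambda>i. {?I i -` A \<inter> space M |A. A \<in> sets borel}) J"
        using fin[of "Suc (Max J)"] unfolding indep_vars_def2 by (auto intro: indep_sets_mono_index)
    qed
  qed
  moreover have "(\<lambda>x. cis (\<theta> * x)) \<in> borel_measurable borel"
    by (rule borel_measurable_continuous_onI) (intro continuous_intros)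
  ultimately show "indep_vars (\<lambda>_. borel) (walk h) UNIV"
    unfolding walk_def[abs_def] by (rule indep_vars_compose2)
  have d: "0 \<le> real i * h" "real i * h \<le> real (Suc i) * h" "real (Suc i) * h - real i * h = h" for i
    using h by (auto simp: algebra_simps)
  show "expectation (walk h i) = exp (- (of_real h * \<psi> \<theta>))" for i
    unfolding walk_def[abs_def] char_increment[OF d(1,2)] d(3) ..
  have "(walk h i w)^2 = cis ((2 * \<theta>) * (X (real (Suc i) * h) w - X (real i * h) w))" for i w
    unfolding walk_def power2_eq_square cis_mult by (simp add: algebra_simps)
  then show "expectation (\<lambda>w. (walk h i w)^2) = exp (- (of_real h * \<psi> (2 * \<theta>)))" for i
    using char_increment[OF d(1,2)[of i], of "2 * \<theta>"] unfolding d(3) by simp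
  show "norm (exp (- (of_real h * \<psi> \<theta>))) < 1" "norm (exp (- (of_real h * \<psi> (2 * \<theta>)))) < 1"
    unfolding norm_exp_psi using h Re_psi_pos by auto
qed (auto simp: walk_def)

lemma walk_U:
  assumes "0 < h" "w \<in> space M"
  shows "unit_walk.U (walk h) k w = cis (\<theta> * X (real k * h) w)"
proof -
  interpret unit_walk M "walk h" "exp (- (of_real h * \<psi> \<theta>))" "exp (- (of_real h * \<psi> (2 * \<theta>)))"
    by (rule unit_walk_walk[OF assms(1)])
  show ?thesis
  proof (induction k)
    case 0
    show ?case using start[OF assms(2)] by (simp add: U_def)
  next
    case (Suc k)
    show ?case unfolding U_Suc Suc.IH unfolding walk_def cis_mult by (simp add: algebra_simps)
  qed
qed

text \<open>Clipping at 0 avoids the unconstrained values of \<open>X\<close> at negative times, so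
  that joint measurability can be stated on the whole line.\<close>

definition rot :: "real \<Rightarrow> 'a \<Rightarrow> complex" where "rot s w = cis (\<theta> * X (max 0 s) w)"

text \<open>Right continuity makes the process the pointwise limit of processes that are constant in
  time on the cells of finer and finer grids.\<close>

lemma X_jointly_measurable: "(\<lambda>(w, s :: real). X (max 0 s) w) \<in> borel_measurable (M \<Otimes>\<^sub>M lborel)"
proof (rule borel_measurable_LIMSEQ_real)
  \<comment> \<open>The outer \<open>Suc\<close> puts the sampling time strictly to the right of
    \<open>max 0 s\<close>, as convergence along \<open>at_right\<close> demands.\<close>
  define g :: "nat \<Rightarrow> real \<Rightarrow> nat" where "g n s = Suc (nat \<lfloor>max 0 s * real (Suc n)\<rfloor>)" for n s
  have gm: "(\<lambda>(w, s). g n s) \<in> measurable (M \<Otimes>\<^sub>M lborel) (count_space UNIV)" for n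
    unfolding g_def by measurable
  have Xm: "X (real k / real (Suc n)) \<in> borel_measurable M" for k n
    by (rule random_variable) simp
  have "(\<lambda>x. (\<lambda>k (w, s). X (real k / real (Suc n)) w) ((\<lambda>(w, s). g n s) x) x) \<in> borel_measurable (M \<Otimes>\<^sub>M lborel)" for n
  proof (rule measurable_compose_countable[OF _ gm])
    fix k
    have "(\<lambda>x. X (real k / real (Suc n)) (fst x)) \<in> borel_measurable (M \<Otimes>\<^sub>M lborel)"
      by (rule measurable_compose[OF measurable_fst Xm])
    then show "(\<lambda>(w, s). X (real k / real (Suc n)) w) \<in> borel_measurable (M \<Otimes>\<^sub>M lborel)"
      by (simp add: case_prod_beta')
  qed
  then show "(\<lambda>(w, s). X (real (g n s) / real (Suc n)) w) \<in> borel_measurable (M \<Otimes>\<^sub>M lborel)" for n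
    by (simp add: case_prod_beta')
  fix x assume "x \<in> space (M \<Otimes>\<^sub>M (lborel :: real measure))"
  then obtain w and s :: real where x: "x = (w, s)" "w \<in> space M" by (auto simp: space_pair_measure)
  let ?s = "max 0 s"
  have gs: "?s < real (g n s) / real (Suc n)" "real (g n s) / real (Suc n) \<le> ?s + 1 / real (Suc n)" for n
  proof -
    have "0 \<le> max 0 s * real (Suc n)" by simp
    then have "real (nat \<lfloor>max 0 s * real (Suc n)\<rfloor>) = of_int \<lfloor>max 0 s * real (Suc n)\<rfloor>" by simp
    then have "max 0 s * real (Suc n) < real (g n s)" "real (g n s) \<le> max 0 s * real (Suc n) + 1"
      unfolding g_def using floor_correct[of "max 0 s * real (Suc n)"] by linarith+
    then show "?s < real (g n s) / real (Suc n)"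
      by (simp only: pos_less_divide_eq of_nat_0_less_iff zero_less_Suc)
    have "real (g n s) / real (Suc n) \<le> (?s * real (Suc n) + 1) / real (Suc n)"
      using \<open>real (g n s) \<le> max 0 s * real (Suc n) + 1\<close> by (intro divide_right_mono) auto
    then show "real (g n s) / real (Suc n) \<le> ?s + 1 / real (Suc n)"
      by (simp add: add_divide_distrib del: of_nat_Suc)
  qed
  have "(\<lambda>n. real (g n s) / real (Suc n)) \<longlonglongrightarrow> ?s"
  proof (rule tendsto_sandwich[where f = "\<lambda>n. ?s" and h = "\<lambda>n. ?s + 1 / real (Suc n)"])
    have "(\<lambda>n. 1 / real (Suc n)) \<longlonglongrightarrow> 0" by real_asymp
    from tendsto_add[OF tendsto_const[of ?s] this]
    show "(\<lambda>n. ?s + 1 / real (Suc n)) \<longlonglongrightarrow> ?s" by simp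
    show "(\<lambda>n. ?s) \<longlonglongrightarrow> ?s" by simp
  qed (use gs in \<open>auto intro!: always_eventually less_imp_le\<close>)
  then have "filterlim (\<lambda>n. real (g n s) / real (Suc n)) (at_right ?s) sequentially"
    unfolding filterlim_at
    by (intro conjI always_eventually allI)
       (simp_all only: greaterThan_iff gs(1) less_imp_neq[OF gs(1), THEN not_sym] not_False_eq_True)
  moreover have "((\<lambda>r. X r w) \<longlongrightarrow> X ?s w) (at_right ?s)"
    by (rule right_continuous[OF x(2)]) simp
  ultimately have "(\<lambda>n. X (real (g n s) / real (Suc n)) w) \<longlonglongrightarrow> X ?s w"
    by (rule filterlim_compose[rotated])
  then show "(\<lambda>n. case x of (w, s) \<Rightarrow> X (real (g n s) / real (Suc n)) w) \<longlonglongrightarrow> (case x of (w, s) \<Rightarrow> X (max 0 s) w)"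
    by (simp add: x)
qed

lemma rot_jointly_measurable: "(\<lambda>(w, s). rot s w) \<in> borel_measurable (M \<Otimes>\<^sub>M lborel)"
proof -
  have "(\<lambda>x. cis (\<theta> * x)) \<in> borel_measurable borel"
    by (rule borel_measurable_continuous_onI) (intro continuous_intros)
  from measurable_compose[OF X_jointly_measurable this] show ?thesis
    unfolding rot_def[abs_def] by (simp add: case_prod_beta')
qed

lemma rot_measurable_time:
  assumes "w \<in> space M"
  shows "(\<lambda>s. rot s w) \<in> borel_measurable lborel"
  using measurable_compose[OF measurable_Pair1'[OF assms] rot_jointly_measurable] by simp

lemma rot_measurable: "rot s \<in> borel_measurable M"
proof -
  have "(\<lambda>x. cis (\<theta> * x)) \<in> borel_measurable borel"
    by (rule borel_measurable_continuous_onI) (intro continuous_intros)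
  moreover have "X (max 0 s) \<in> borel_measurable M" by (rule random_variable) simp
  ultimately show ?thesis unfolding rot_def[abs_def] by (rule measurable_compose[rotated])
qed

lemma norm_rot [simp]: "norm (rot s w) = 1"
  by (simp add: rot_def)

section \<open>The time integral and its Riemann sums\<close>

definition J :: "real \<Rightarrow> 'a \<Rightarrow> complex" where
  "J a w = (CLBINT s:{0..a}. iexp (\<theta> * X s w))"

lemma J_eq: "J a w = (CLBINT s:{0..a}. rot s w)"
  unfolding J_def by (rule set_lebesgue_integral_cong) (auto simp: rot_def cis_conv_exp)

lemma rot_set_integrable:
  assumes "w \<in> space M" "S \<in> sets lborel" "emeasure lborel S < \<infinity>"
  shows "set_integrable lborel S (\<lambda>s. rot s w)"
  unfolding set_integrable_def
proof (rule integrableI_bounded_set_indicator[where B = 1])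
  show "(\<lambda>s. rot s w) \<in> borel_measurable lborel" by (rule rot_measurable_time[OF assms(1)])
qed (use assms in auto)

lemma J_measurable: "J a \<in> borel_measurable M"
proof -
  have "(\<lambda>(w, s). indicator {0..a} s *\<^sub>R rot s w) \<in> borel_measurable (M \<Otimes>\<^sub>M lborel)"
    using rot_jointly_measurable by (simp add: case_prod_beta') measurable
  then show ?thesis
    unfolding J_eq[abs_def] set_lebesgue_integral_def by (rule lborel.borel_measurable_lebesgue_integral)
qed

lemma J_diff:
  assumes "w \<in> space M" "0 \<le> a" "a \<le> b"
  shows "J b w - J a w = (CLBINT s:{a<..b}. rot s w)"
proof -
  have "{0..b} = {0..a} \<union> {a<..b}" using assms by auto
  then have "J b w = (CLBINT s:{0..a}. rot s w) + (CLBINT s:{a<..b}. rot s w)"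
    unfolding J_eq using assms by (auto intro!: set_integral_Un rot_set_integrable)
  then show ?thesis by (simp add: J_eq)
qed

lemma J_lipschitz:
  assumes "w \<in> space M" "0 \<le> a" "a \<le> b"
  shows "norm (J b w - J a w) \<le> b - a"
proof -
  have "norm (J b w - J a w) \<le> (LBINT s:{a<..b}. norm (rot s w))"
    unfolding J_diff[OF assms]
    by (rule set_integral_norm_bound) (use assms in \<open>auto intro!: rot_set_integrable\<close>)
  also have "\<dots> = b - a" using assms by (simp add: set_lebesgue_integral_def)
  finally show ?thesis .
qed

lemma J_0: "w \<in> space M \<Longrightarrow> J 0 w = 0"
proof -
  assume w: "w \<in> space M"
  have "norm (J 0 w) \<le> (LBINT s:{0..0 :: real}. norm (rot s w))"
    unfolding J_eq by (rule set_integral_norm_bound) (use w in \<open>auto intro!: rot_set_integrable\<close>)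
  also have "\<dots> = measure lborel ({0..0 :: real} \<inter> space lborel)"
    unfolding set_lebesgue_integral_def norm_rot real_scaleR_def mult_1_right
    by (rule Bochner_Integration.integral_indicator)
  also have "\<dots> = 0" by simp
  finally show "J 0 w = 0" by simp
qed

definition cell_err :: "real \<Rightarrow> nat \<Rightarrow> 'a \<Rightarrow> real" where
  "cell_err h i w = (LBINT s:{real i * h<..real (Suc i) * h}. norm (rot s w - rot (real i * h) w))"

lemma cell_err_nonneg: "0 \<le> cell_err h i w"
  unfolding cell_err_def set_lebesgue_integral_def by (rule integral_nonneg_AE) auto

lemma J_cell:
  assumes w: "w \<in> space M" and h: "0 < h"
  shows "norm (J (real (Suc i) * h) w - J (real i * h) w - of_real h * rot (real i * h) w) \<le> cell_err h i w"
proof -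
  let ?S = "{real i * h<..real (Suc i) * h}"
  have le: "0 \<le> real i * h" "real i * h \<le> real (Suc i) * h" using h by auto
  have c: "(CLBINT s:?S. rot (real i * h) w) = of_real h * rot (real i * h) w"
    using le unfolding set_lebesgue_integral_def by (simp add: algebra_simps scaleR_conv_of_real)
  have ic: "set_integrable lborel ?S (\<lambda>s. rot (real i * h) w)"
    unfolding set_integrable_def using le by (intro integrableI_bounded_set_indicator[where B = 1]) auto
  have ir: "set_integrable lborel ?S (\<lambda>s. rot s w)"
    using le by (intro rot_set_integrable w) auto
  have "J (real (Suc i) * h) w - J (real i * h) w - of_real h * rot (real i * h) w =
    (CLBINT s:?S. rot s w - rot (real i * h) w)"
    unfolding J_diff[OF w le] c[symmetric] by (rule set_integral_diff(2)[OF ir ic, symmetric])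
  also have "norm \<dots> \<le> cell_err h i w"
    unfolding cell_err_def by (rule set_integral_norm_bound[OF set_integral_diff(1)[OF ir ic]])
  finally show ?thesis .
qed

text \<open>For a unit number \<open>z\<close>, \<open>|z - 1|^2 = 2 - 2 * Re z\<close>, whose mean
  is governed by the exponent. The inequality
  \<open>|y| \<le> y^2 / (2 * \<beta>) + \<beta> / 2\<close> replaces Cauchy-Schwarz; a choice of
  \<open>\<beta>\<close> near \<open>sqrt (s - r)\<close> gives the right order.\<close>

lemma expectation_rot_diff:
  assumes "0 \<le> r" "r \<le> s" "0 < \<beta>"
  shows "expectation (\<lambda>w. norm (rot s w - rot r w)) \<le> (s - r) * norm (\<psi> \<theta>) / \<beta> + \<beta> / 2"
proof -
  define f where "f w = cis (\<theta> * (X s w - X r w))" for w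
  have X: "X s \<in> borel_measurable M" "X r \<in> borel_measurable M"
    using random_variable assms by auto
  have wm: "f \<in> borel_measurable M"
    unfolding f_def[abs_def] using X
    by (intro measurable_compose[OF _ borel_measurable_continuous_onI[of cis]] borel_measurable_times borel_measurable_diff
          continuous_intros) auto
  have wi: "integrable M f" using wm by (intro integrable_const_bound[where B = 1]) (auto simp: f_def)
  have eq: "norm (rot s w - rot r w) = norm (f w - 1)" for w
  proof -
    have "rot s w - rot r w = rot r w * (f w - 1)"
      using assms by (simp add: rot_def f_def right_diff_distrib cis_mult)
    then show ?thesis by (simp add: norm_mult)
  qed
  have sq: "(norm (f w - 1))^2 = 2 - 2 * Re (f w)" for w
  proof -
    have "(Re (f w))^2 + (Im (f w))^2 = 1" by (simp add: f_def)
    then show ?thesis unfolding cmod_power2 by (simp add: power2_eq_square algebra_simps)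
  qed
  have am: "norm (f w - 1) \<le> (1 - Re (f w)) / \<beta> + \<beta> / 2" for w
  proof -
    have "0 \<le> (norm (f w - 1) - \<beta>)^2" by simp
    then have "2 * \<beta> * norm (f w - 1) \<le> 2 * (1 - Re (f w)) + \<beta>^2"
      unfolding power2_diff sq by (simp add: algebra_simps)
    then show ?thesis using assms(3) by (simp add: field_simps power2_eq_square)
  qed
  have "expectation (\<lambda>w. norm (rot s w - rot r w)) \<le> expectation (\<lambda>w. (1 - Re (f w)) / \<beta> + \<beta> / 2)"
    unfolding eq using am wi by (intro integral_mono) auto
  also have "\<dots> = (1 - Re (expectation f)) / \<beta> + \<beta> / 2"
    using wi by (simp add: prob_space)
  also have "expectation f = exp (- (of_real (s - r) * \<psi> \<theta>))"
    unfolding f_def using assms by (intro char_increment) auto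
  also have "1 - Re (exp (- (of_real (s - r) * \<psi> \<theta>))) \<le> (s - r) * norm (\<psi> \<theta>)"
  proof -
    have "1 - Re (exp (- (of_real (s - r) * \<psi> \<theta>))) = - Re (exp (- (of_real (s - r) * \<psi> \<theta>)) - 1)" by simp
    also have "\<dots> \<le> norm (exp (- (of_real (s - r) * \<psi> \<theta>)) - 1)"
      using abs_Re_le_cmod[of "exp (- (of_real (s - r) * \<psi> \<theta>)) - 1"] by linarith
    also have "\<dots> \<le> norm (- (of_real (s - r) * \<psi> \<theta>))"
      using assms Re_psi_pos by (intro norm_exp_minus_one_le) simp
    also have "\<dots> = (s - r) * norm (\<psi> \<theta>)" using assms by (simp add: norm_mult del: of_real_diff)
    finally show ?thesis .
  qed
  finally show ?thesis using assms(3) by (simp add: divide_right_mono)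
qed

text \<open>Fubini moves the expectation inside the time integral, where the preceding estimate
  applies with \<open>s - r \<le> h\<close>.\<close>

lemma cell_err_expectation:
  assumes h: "0 < h" and \<beta>: "0 < \<beta>"
  shows "integrable M (cell_err h i)"
    and "expectation (cell_err h i) \<le> h * (h * norm (\<psi> \<theta>) / \<beta> + \<beta> / 2)"
proof -
  interpret P: pair_sigma_finite M lborel ..
  let ?S = "{real i * h<..real (Suc i) * h}"
  let ?f = "\<lambda>w s. indicator ?S s * norm (rot s w - rot (real i * h) w)"
  have S: "0 \<le> real i * h" "real i * h \<le> real (Suc i) * h" using h by auto
  have f: "integrable (M \<Otimes>\<^sub>M lborel) (case_prod ?f)"
  proof (rule integrableI_bounded_set[where A = "space M \<times> ?S" and B = 2])
    have "rot (real i * h) \<in> borel_measurable M" by (rule rot_measurable)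
    then have "(\<lambda>x. rot (real i * h) (fst x)) \<in> borel_measurable (M \<Otimes>\<^sub>M lborel)"
      by (rule measurable_compose[OF measurable_fst])
    moreover have "(\<lambda>x. rot (snd x) (fst x)) \<in> borel_measurable (M \<Otimes>\<^sub>M lborel)"
      using rot_jointly_measurable by (simp add: case_prod_beta')
    ultimately show "case_prod ?f \<in> borel_measurable (M \<Otimes>\<^sub>M lborel)"
      unfolding case_prod_beta' by measurable
    have "emeasure (M \<Otimes>\<^sub>M lborel) (space M \<times> ?S) = emeasure M (space M) * emeasure lborel ?S"
      by (rule lborel.emeasure_pair_measure_Times) auto
    then show "emeasure (M \<Otimes>\<^sub>M lborel) (space M \<times> ?S) < \<infinity>"
      using S by (simp add: emeasure_space_1)
    show "AE x in M \<Otimes>\<^sub>M lborel. x \<in> space M \<times> ?S \<longrightarrow> norm (case_prod ?f x) \<le> 2"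
    proof (rule AE_I2, clarify)
      fix w s
      have "norm (rot s w - rot (real i * h) w) \<le> 2"
        using norm_triangle_ineq4[of "rot s w" "rot (real i * h) w"] by simp
      then show "norm (?f w s) \<le> 2" by (simp add: indicator_def)
    qed
  qed (auto simp: space_pair_measure indicator_def)
  have c: "cell_err h i w = (LBINT s. ?f w s)" for w
    unfolding cell_err_def set_lebesgue_integral_def by simp
  show "integrable M (cell_err h i)"
    using P.integrable_fst[OF f] unfolding c[abs_def] .
  have "expectation (cell_err h i) = (LBINT s. expectation (\<lambda>w. ?f w s))"
    unfolding c[abs_def] by (rule P.Fubini_integral[OF f, symmetric])
  also have "\<dots> \<le> (LBINT s. indicator ?S s * (h * norm (\<psi> \<theta>) / \<beta> + \<beta> / 2))"
  proof (rule integral_mono)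
    show "integrable lborel (\<lambda>s. expectation (\<lambda>w. ?f w s))"
      by (rule P.integrable_snd[OF f])
    show "integrable lborel (\<lambda>s. indicator ?S s * (h * norm (\<psi> \<theta>) / \<beta> + \<beta> / 2))"
      using S by (intro integrable_mult_left integrable_real_indicator) auto
    fix s
    show "expectation (\<lambda>w. ?f w s) \<le> indicator ?S s * (h * norm (\<psi> \<theta>) / \<beta> + \<beta> / 2)"
    proof (cases "s \<in> ?S")
      case True
      then have "expectation (\<lambda>w. norm (rot s w - rot (real i * h) w)) \<le> (s - real i * h) * norm (\<psi> \<theta>) / \<beta> + \<beta> / 2"
        using S \<beta> by (intro expectation_rot_diff) auto
      also have "\<dots> \<le> h * norm (\<psi> \<theta>) / \<beta> + \<beta> / 2"
        using True \<beta> by (intro add_right_mono divide_right_mono mult_right_mono) (auto simp: algebra_simps)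
      finally show ?thesis using True by simp
    qed simp
  qed
  also have "\<dots> = measure lborel (?S \<inter> space lborel) * (h * norm (\<psi> \<theta>) / \<beta> + \<beta> / 2)"
    by (simp only: integral_mult_left_zero Bochner_Integration.integral_indicator)
  also have "measure lborel (?S \<inter> space lborel) = h"
    using S by (simp add: algebra_simps)
  finally show "expectation (cell_err h i) \<le> h * (h * norm (\<psi> \<theta>) / \<beta> + \<beta> / 2)" .
qed

abbreviation pp :: "real \<Rightarrow> complex" where "pp h \<equiv> exp (- (of_real h * \<psi> \<theta>))"
abbreviation qq :: "real \<Rightarrow> complex" where "qq h \<equiv> exp (- (of_real h * \<psi> (2 * \<theta>)))"

text \<open>Three errors: the Riemann sum over complete cells, the incomplete last cell, and the
  boundary term of \<open>mart_eq\<close>. Extending the sum to \<open>m\<close> makes the bound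
  uniform over all \<open>A\<close> with at most \<open>m\<close> complete cells.\<close>

lemma J_mart:
  assumes h: "0 < h" and w: "w \<in> space M" and A: "0 \<le> A" "nat \<lfloor>A / h\<rfloor> \<le> m"
  shows "norm (J A w - of_real h * unit_walk.mart (walk h) (pp h) (nat \<lfloor>A / h\<rfloor>) w)
    \<le> (\<Sum>i<m. cell_err h i w) + h + h * unit_walk.bnd (pp h)"
proof -
  interpret W: unit_walk M "walk h" "pp h" "qq h" by (rule unit_walk_walk[OF h])
  define N where "N = nat \<lfloor>A / h\<rfloor>"
  have "0 \<le> A / h" using A h by simp
  then have "real N = of_int \<lfloor>A / h\<rfloor>" by (simp add: N_def)
  then have "real N \<le> A / h" "A / h \<le> real N + 1"
    using floor_correct[of "A / h"] by linarith+
  then have N: "real N * h \<le> A" "A - real N * h \<le> h"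
    using h by (auto simp: field_simps)
  have U: "W.U k w = rot (real k * h) w" for k
    using walk_U[OF h w, of k] h by (simp add: rot_def)
  have tele: "J (real N * h) w = (\<Sum>i<N. J (real (Suc i) * h) w - J (real i * h) w)"
    using sum_lessThan_telescope[of "\<lambda>i. J (real i * h) w" N] by (simp add: J_0[OF w])
  have eq: "J A w - of_real h * W.mart N w =
     (\<Sum>i<N. J (real (Suc i) * h) w - J (real i * h) w - of_real h * W.U i w)
     + (J A w - J (real N * h) w) - of_real h * ((W.U N w - 1) / (1 - pp h))"
    unfolding W.mart_eq tele by (simp add: sum_subtractf sum.distrib sum_distrib_left algebra_simps)
  have "norm (J A w - of_real h * W.mart N w) \<le> (\<Sum>i<N. cell_err h i w) + h + h * W.bnd"
    unfolding eq
  proof (rule order_trans[OF norm_triangle_ineq4], intro add_mono norm_triangle_mono)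
    show "norm (\<Sum>i<N. J (real (Suc i) * h) w - J (real i * h) w - of_real h * W.U i w) \<le> (\<Sum>i<N. cell_err h i w)"
      unfolding U by (intro sum_norm_le J_cell[OF w h])
    show "norm (J A w - J (real N * h) w) \<le> h"
      using J_lipschitz[OF w _ N(1)] N(2) h by simp
    have "norm (W.U N w - 1) \<le> 2"
      using norm_triangle_ineq4[of "W.U N w" 1] W.norm_U[OF w, of N] by simp
    then have "h * (norm (W.U N w - 1) / norm (1 - pp h)) \<le> h * (2 / norm (1 - pp h))"
      using h by (intro mult_left_mono divide_right_mono) auto
    then show "norm (of_real h * ((W.U N w - 1) / (1 - pp h))) \<le> h * W.bnd"
      using h by (simp add: norm_mult norm_divide W.bnd_def)
  qed
  also have "\<dots> \<le> (\<Sum>i<m. cell_err h i w) + h + h * W.bnd"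
  proof (intro add_right_mono sum_mono2)
    show "{..<N} \<subseteq> {..<m}" using A(2) unfolding N_def by auto
  qed (simp_all add: cell_err_nonneg)
  finally show ?thesis unfolding N_def .
qed

section \<open>Asymptotics of the walk parameters as the mesh vanishes\<close>

lemma lim_p: "((\<lambda>e. norm (1 - pp (e ^ 4)) / e ^ 4) \<longlongrightarrow> norm (\<psi> \<theta>)) (at_right 0)"
proof -
  let ?z = "\<lambda>e :: real. - (complex_of_real (e ^ 4) * \<psi> \<theta>)"
  have z0: "(?z \<longlongrightarrow> 0) (at_right 0)"
    by (rule tendsto_eq_intros | simp)+
  have "filterlim ?z (at 0) (at_right 0)"
    unfolding filterlim_at
  proof
    show "\<forall>\<^sub>F e in at_right 0. ?z e \<in> UNIV \<and> ?z e \<noteq> 0"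
      using eventually_at_right_less[of "0::real"] by eventually_elim (simp add: psi_nonzero)
  qed (rule z0)
  from filterlim_compose[OF lim_exp_minus_1 this]
  have "((\<lambda>e. norm ((exp (?z e) - 1) / ?z e) * norm (\<psi> \<theta>)) \<longlongrightarrow> norm (1 :: complex) * norm (\<psi> \<theta>)) (at_right 0)"
    by (intro tendsto_intros)
  moreover have "\<forall>\<^sub>F e in at_right 0. norm ((exp (?z e) - 1) / ?z e) * norm (\<psi> \<theta>) = norm (1 - pp (e ^ 4)) / e ^ 4"
    using eventually_at_right_less[of "0::real"]
  proof eventually_elim
    case (elim e)
    then show ?case using psi_nonzero
      by (simp add: norm_divide norm_mult norm_power norm_minus_commute[of 1])
  qed
  ultimately show ?thesis by (simp add: filterlim_cong)
qed

lemma lim_p2: "((\<lambda>e. (1 - (norm (pp (e ^ 4)))^2) / e ^ 4) \<longlongrightarrow> 2 * Re (\<psi> \<theta>)) (at_right 0)"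
proof -
  define r where "r = Re (\<psi> \<theta>)"
  have r: "0 < r" using Re_psi_pos by (simp add: r_def)
  have "((\<lambda>e :: real. (1 - (exp (- (e ^ 4 * r)))^2) / e ^ 4) \<longlongrightarrow> 2 * r) (at_right 0)"
    using r by real_asymp
  then show ?thesis by (simp add: norm_exp_eq_Re r_def)
qed

lemma lim_q: "((\<lambda>e. (1 - norm (qq (e ^ 4))) / e ^ 4) \<longlongrightarrow> Re (\<psi> (2 * \<theta>))) (at_right 0)"
proof -
  define r where "r = Re (\<psi> (2 * \<theta>))"
  have r: "0 < r" using Re_psi_pos by (simp add: r_def)
  have "((\<lambda>e :: real. (1 - exp (- (e ^ 4 * r))) / e ^ 4) \<longlongrightarrow> r) (at_right 0)"
    using r by real_asymp
  then show ?thesis by (simp add: norm_exp_eq_Re r_def)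
qed

abbreviation coeff :: real where "coeff \<equiv> levy_coeff \<psi> \<theta>"

lemma coeff_pos: "0 < coeff"
  using Re_psi_pos psi_nonzero by (simp add: levy_coeff_def)

lemma coeff_sq: "coeff^2 * (2 * Re (\<psi> \<theta>)) = (norm (\<psi> \<theta>))^2"
  using Re_psi_pos by (simp add: levy_coeff_def)

text \<open>The prefactor of \<open>levy_approx\<close> times the mesh width by which a sum
  approximates the integral.\<close>

definition scale :: "real \<Rightarrow> real" where "scale e = e * coeff * e ^ 4"

text \<open>Second moment of a scaled martingale step per unit of \<open>e^6\<close>. Its limit 1 is
  where the definition of \<open>levy_coeff\<close> enters.\<close>

definition nvar :: "real \<Rightarrow> real" where "nvar e = (scale e)^2 * unit_walk.vari (pp (e ^ 4)) / e ^ 6"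

lemma vari_eq: "0 < h \<Longrightarrow> unit_walk.vari (pp h) = (1 - (norm (pp h))^2) / (norm (1 - pp h))^2"
  by (rule unit_walk.vari_def[OF unit_walk_walk])

lemma lim_nvar: "(nvar \<longlongrightarrow> 1) (at_right 0)"
proof -
  have "((\<lambda>e. coeff^2 * ((1 - (norm (pp (e ^ 4)))^2) / e ^ 4) / (norm (1 - pp (e ^ 4)) / e ^ 4)^2) \<longlongrightarrow>
    coeff^2 * (2 * Re (\<psi> \<theta>)) / (norm (\<psi> \<theta>))^2) (at_right 0)"
    using psi_nonzero by (intro tendsto_intros lim_p lim_p2) simp
  then have "((\<lambda>e. coeff^2 * ((1 - (norm (pp (e ^ 4)))^2) / e ^ 4) / (norm (1 - pp (e ^ 4)) / e ^ 4)^2) \<longlongrightarrow> 1) (at_right 0)"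
    unfolding coeff_sq using psi_nonzero by simp
  moreover have "\<forall>\<^sub>F e in at_right 0. coeff^2 * ((1 - (norm (pp (e ^ 4)))^2) / e ^ 4) / (norm (1 - pp (e ^ 4)) / e ^ 4)^2 = nvar e"
    using eventually_at_right_less[of "0::real"]
  proof eventually_elim
    case (elim e)
    then have "0 < e ^ 4" by simp
    note v = vari_eq[OF this]
    have g: "c^2 * (a / e ^ 4) / (b / e ^ 4)^2 = (e * c * e ^ 4)^2 * (a / b^2) / e ^ 6" for a b c :: real
      using elim by (simp add: power_divide power_mult_distrib power2_eq_square power4_eq_xxxx eval_nat_numeral)
    show ?case unfolding nvar_def scale_def v by (rule g)
  qed
  ultimately show ?thesis by (simp add: filterlim_cong)
qed

lemma scale_sq: "0 < e \<Longrightarrow> (scale e)^2 * unit_walk.vari (pp (e ^ 4)) = nvar e * e ^ 6"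
  by (simp add: nvar_def)

lemma scale_pos: "0 < e \<Longrightarrow> 0 < scale e"
  using coeff_pos by (simp add: scale_def)

text \<open>The uniform bound of a scaled martingale step. It vanishes linearly in \<open>e\<close>,
  which makes the cubic terms negligible as in a Lindeberg condition.\<close>

definition sbnd :: "real \<Rightarrow> real" where "sbnd e = 2 * e * coeff / (norm (1 - pp (e ^ 4)) / e ^ 4)"

lemma sbnd_eq:
  assumes "0 < e" shows "scale e * unit_walk.bnd (pp (e ^ 4)) = sbnd e"
proof -
  interpret W: unit_walk M "walk (e ^ 4)" "pp (e ^ 4)" "qq (e ^ 4)"
    by (rule unit_walk_walk) (use assms in simp)
  have "e * c * e ^ 4 * (2 / y) = 2 * e * c / (y / e ^ 4)" for c y :: real by simp
  then show ?thesis unfolding scale_def sbnd_def W.bnd_def .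
qed

lemma lim_sbnd: "(sbnd \<longlongrightarrow> 0) (at_right 0)"
proof -
  have "(sbnd \<longlongrightarrow> 2 * 0 * coeff / norm (\<psi> \<theta>)) (at_right 0)"
    unfolding sbnd_def[abs_def] using psi_nonzero by (intro tendsto_intros lim_p) simp
  then show ?thesis by simp
qed

text \<open>The error bound of \<open>block_characteristic\<close> for \<open>scale e * l\<close> in place of \<open>l\<close>, rewritten with
  quotients that converge as \<open>e\<close> tends to \<open>0\<close>; \<open>K\<close> is a bound for \<open>n e\<^sup>6\<close>.\<close>

definition berr :: "real \<Rightarrow> complex \<Rightarrow> real \<Rightarrow> real" where
  "berr K l e = K * (norm l ^ 3 * sbnd e * nvar e / 6 + (norm l ^ 4 * (nvar e)^2 / 16) * e ^ 6)
    + (norm l)^2 * nvar e / 4 * (e^2 + K * (3 * (norm l * (e / coeff) * (norm (1 - pp (e ^ 4)) / e ^ 4) * nvar e)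
        + norm l * e * coeff * norm (1 - pp (e ^ 4)) + (norm l)^2 * nvar e * e^2 / 2))
      / ((1 - norm (qq (e ^ 4))) / e ^ 4)"

lemma lim_berr: "(berr K l \<longlongrightarrow> 0) (at_right 0)"
proof -
  have e: "((\<lambda>e :: real. e) \<longlongrightarrow> 0) (at_right 0)" by (rule tendsto_ident_at)
  have n: "((\<lambda>e. norm (1 - pp (e ^ 4))) \<longlongrightarrow> norm (1 - exp (- (of_real (0 ^ 4) * \<psi> \<theta>)))) (at_right 0)"
    by (intro tendsto_intros e)
  have "(berr K l \<longlongrightarrow> K * (norm l ^ 3 * 0 * 1 / 6 + (norm l ^ 4 * 1^2 / 16) * 0 ^ 6)
    + (norm l)^2 * 1 / 4 * (0^2 + K * (3 * (norm l * (0 / coeff) * norm (\<psi> \<theta>) * 1)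
        + norm l * 0 * coeff * norm (1 - exp (- (of_real (0 ^ 4) * \<psi> \<theta>))) + (norm l)^2 * 1 * 0^2 / 2))
      / Re (\<psi> (2 * \<theta>))) (at_right 0)"
    unfolding berr_def[abs_def] using Re_psi_pos(2) coeff_pos
    by (intro tendsto_intros lim_sbnd lim_nvar lim_p lim_q n e) auto
  then show ?thesis by simp
qed

lemma block_error_le:
  assumes e: "0 < e" and n: "real n * e ^ 6 \<le> K"
  defines "s \<equiv> scale e" and "p \<equiv> pp (e ^ 4)" and "q \<equiv> qq (e ^ 4)"
  shows "real n * (unit_walk.cubic_err p (of_real s * l) + (unit_walk.rate p (of_real s * l))^2)
    + unit_walk.rate p (of_real s * l) * (1 + real n * unit_walk.mix_err p (of_real s * l)) / (1 - norm q) \<le> berr K l e"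
    and "unit_walk.rate p (of_real s * l) = (norm l)^2 * nvar e / 4 * e ^ 6"
proof -
  interpret W: unit_walk M "walk (e ^ 4)" p q
    unfolding p_def q_def by (rule unit_walk_walk) (use e in simp)
  have s: "0 < s" using scale_pos[OF e] by (simp add: s_def)
  have sv: "s^2 * W.vari = nvar e * e ^ 6" using scale_sq[OF e] by (simp add: s_def p_def)
  have sb: "s * W.bnd = sbnd e" using sbnd_eq[OF e] by (simp add: s_def p_def)
  have nv: "0 \<le> nvar e" using W.vari_nonneg e by (simp add: nvar_def p_def)
  have sb0: "0 \<le> sbnd e" unfolding sb[symmetric] using s W.bnd_nonneg by simp
  define h where "h = e ^ 4"
  have h: "0 < h" using e by (simp add: h_def)
  show rate: "W.rate (of_real s * l) = (norm l)^2 * nvar e / 4 * e ^ 6"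
    using s sv by (simp add: W.rate_def norm_mult power_mult_distrib mult_ac)
  have cubic: "W.cubic_err (of_real s * l) = norm l ^ 3 * sbnd e * nvar e / 6 * e ^ 6"
  proof -
    have "W.cubic_err (of_real s * l) = norm l ^ 3 * (s * W.bnd) * (s^2 * W.vari) / 6"
      using s by (simp add: W.cubic_err_def norm_mult power_mult_distrib power3_eq_cube power2_eq_square)
    then show ?thesis unfolding sv sb by simp
  qed
  \<comment> \<open>The \<open>h\<close> taken out here combines with the \<open>e^2\<close> of the
    rate \<open>e^6 = e^2 * h\<close> to form \<open>e^6\<close>, which is paired with
    \<open>n\<close>; the other \<open>h\<close> of the rate offsets the small denominator
    \<open>1 - norm q\<close>.\<close>
  have mix: "W.mix_err (of_real s * l) = h * (3 * (norm l * (e / coeff) * (norm (1 - p) / h) * nvar e)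
        + norm l * e * coeff * norm (1 - p) + (norm l)^2 * nvar e * e^2 / 2)"
  proof -
    have sc: "s = e * coeff * h" by (simp add: s_def scale_def h_def)
    have e6: "e ^ 6 = e^2 * h" by (simp add: h_def flip: power_add)
    have v: "W.vari = nvar e * (e^2 * h) / s^2" using sv s by (simp add: e6 field_simps)
    have "W.mix_err (of_real s * l) = s * norm l * norm (1 - p) * (3 * W.vari) + s * norm l * norm (1 - p) + (norm l)^2 * (s^2 * W.vari) / 2"
      using s by (simp add: W.mix_err_def norm_mult power_mult_distrib algebra_simps)
    also have "s * norm l * norm (1 - p) * (3 * W.vari) = 3 * norm l * norm (1 - p) * (nvar e * e^2 * h / s)"
      unfolding v using s by (simp add: power2_eq_square)
    also have "nvar e * e^2 * h / s = nvar e * e / coeff"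
      unfolding sc using e h coeff_pos by (simp add: power2_eq_square)
    also have "s^2 * W.vari = nvar e * (e^2 * h)" using sv e6 by simp
    also have "s * norm l * norm (1 - p) = h * (norm l * e * coeff * norm (1 - p))" by (simp add: sc)
    finally show ?thesis using h by (simp add: field_simps)
  qed
  define m where "m = 3 * (norm l * (e / coeff) * (norm (1 - p) / h) * nvar e)
        + norm l * e * coeff * norm (1 - p) + (norm l)^2 * nvar e * e^2 / 2"
  have m0: "0 \<le> m" unfolding m_def using nv coeff_pos h e by (intro add_nonneg_nonneg mult_nonneg_nonneg divide_nonneg_nonneg) auto
  have q1: "0 < 1 - norm q" using W.q_less by simp
  have e6: "e ^ 6 = e^2 * h" by (simp add: h_def flip: power_add)
  have "real n * (W.cubic_err (of_real s * l) + (W.rate (of_real s * l))^2) =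
    (real n * e ^ 6) * (norm l ^ 3 * sbnd e * nvar e / 6 + (norm l ^ 4 * (nvar e)^2 / 16) * e ^ 6)"
    unfolding cubic rate by (simp add: power2_eq_square power4_eq_xxxx algebra_simps)
  also have "\<dots> \<le> K * (norm l ^ 3 * sbnd e * nvar e / 6 + (norm l ^ 4 * (nvar e)^2 / 16) * e ^ 6)"
    using sb0 nv e by (intro mult_right_mono n add_nonneg_nonneg mult_nonneg_nonneg divide_nonneg_nonneg) auto
  finally have 1: "real n * (W.cubic_err (of_real s * l) + (W.rate (of_real s * l))^2) \<le>
    K * (norm l ^ 3 * sbnd e * nvar e / 6 + (norm l ^ 4 * (nvar e)^2 / 16) * e ^ 6)" .
  have "W.rate (of_real s * l) * (1 + real n * W.mix_err (of_real s * l)) / (1 - norm q) =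
    (norm l)^2 * nvar e / 4 * (e^2 + (real n * e ^ 6) * m) / ((1 - norm q) / h)"
    unfolding rate mix m_def[symmetric] e6 using h q1 by (simp add: field_simps power2_eq_square)
  also have "\<dots> \<le> (norm l)^2 * nvar e / 4 * (e^2 + K * m) / ((1 - norm q) / h)"
    using nv m0 q1 h by (intro divide_right_mono mult_left_mono add_left_mono mult_right_mono n) auto
  finally have 2: "W.rate (of_real s * l) * (1 + real n * W.mix_err (of_real s * l)) / (1 - norm q) \<le>
    (norm l)^2 * nvar e / 4 * (e^2 + K * m) / ((1 - norm q) / h)" .
  show "real n * (W.cubic_err (of_real s * l) + (W.rate (of_real s * l))^2)
    + W.rate (of_real s * l) * (1 + real n * W.mix_err (of_real s * l)) / (1 - norm q) \<le> berr K l e"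
    using add_mono[OF 1 2] unfolding berr_def m_def p_def q_def h_def .
qed

text \<open>A step of the walk lasts \<open>h = e\<^sup>4\<close>, that is \<open>e\<^sup>6 / 2\<close> on the time scale of \<open>levy_approx\<close>.\<close>

definition steps :: "real \<Rightarrow> real \<Rightarrow> nat" where "steps e t = nat \<lfloor>2 * t / e ^ 6\<rfloor>"

lemma steps_bounds:
  assumes "0 < e" "0 \<le> t"
  shows "real (steps e t) * e ^ 6 \<le> 2 * t" "2 * t < real (steps e t) * e ^ 6 + e ^ 6"
proof -
  have "0 \<le> 2 * t / e ^ 6" using assms by simp
  then have "real (steps e t) = of_int \<lfloor>2 * t / e ^ 6\<rfloor>" by (simp add: steps_def)
  then have "real (steps e t) \<le> 2 * t / e ^ 6" "2 * t / e ^ 6 < real (steps e t) + 1"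
    using floor_correct[of "2 * t / e ^ 6"] by linarith+
  then show "real (steps e t) * e ^ 6 \<le> 2 * t" "2 * t < real (steps e t) * e ^ 6 + e ^ 6"
    using assms by (simp_all add: field_simps)
qed

lemma steps_mono: "0 < e \<Longrightarrow> s \<le> t \<Longrightarrow> steps e s \<le> steps e t"
  unfolding steps_def by (intro nat_mono floor_mono divide_right_mono) auto

lemma lim_steps:
  assumes "0 \<le> t"
  shows "((\<lambda>e. real (steps e t) * e ^ 6) \<longlongrightarrow> 2 * t) (at_right 0)"
proof (rule tendsto_sandwich[where f = "\<lambda>e. 2 * t - e ^ 6" and h = "\<lambda>e. 2 * t"])
  have "((\<lambda>e. 2 * t - e ^ 6) \<longlongrightarrow> 2 * t - 0 ^ 6) (at_right 0)"
    by (intro tendsto_intros)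
  then show "((\<lambda>e. 2 * t - e ^ 6) \<longlongrightarrow> 2 * t) (at_right 0)" by simp
  show "\<forall>\<^sub>F e in at_right 0. 2 * t - e ^ 6 \<le> real (steps e t) * e ^ 6"
    using eventually_at_right_less[of "0::real"]
    by eventually_elim (use steps_bounds(2)[OF _ assms] in \<open>force simp: algebra_simps intro: less_imp_le\<close>)
  show "\<forall>\<^sub>F e in at_right 0. real (steps e t) * e ^ 6 \<le> 2 * t"
    using eventually_at_right_less[of "0::real"]
    by eventually_elim (rule steps_bounds(1)[OF _ assms])
qed simp

section \<open>Comparison of the approximating process with the scaled martingale\<close>

abbreviation approx :: "real \<Rightarrow> real \<Rightarrow> 'a \<Rightarrow> complex" where "approx \<equiv> levy_approx X \<psi> \<theta>"

lemma approx_eq: "approx e t w = of_real (e * coeff) * J (2 * t / e^2) w"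
  by (simp add: levy_approx_def J_def)

abbreviation emart :: "real \<Rightarrow> nat \<Rightarrow> 'a \<Rightarrow> complex" where
  "emart e \<equiv> unit_walk.mart (walk (e ^ 4)) (pp (e ^ 4))"

text \<open>A pathwise bound that is uniform over \<open>t \<le> T\<close>, since all cells up to
  \<open>T\<close> are counted. Its vanishing mean serves both the characteristic functions and the
  oscillation.\<close>

definition err :: "real \<Rightarrow> real \<Rightarrow> 'a \<Rightarrow> real" where
  "err T e w = e * coeff * ((\<Sum>i<steps e T. cell_err (e ^ 4) i w) + e ^ 4) + sbnd e"

lemma approx_mart:
  assumes e: "0 < e" and w: "w \<in> space M" and t: "0 \<le> t" "t \<le> T"
  shows "norm (approx e t w - of_real (scale e) * emart e (steps e t) w) \<le> err T e w"
proof -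
  have h: "0 < e ^ 4" using e by simp
  have st: "nat \<lfloor>2 * t / e^2 / e ^ 4\<rfloor> = steps e t"
    by (simp add: steps_def flip: power_add)
  have "approx e t w - of_real (scale e) * emart e (steps e t) w =
    of_real (e * coeff) * (J (2 * t / e^2) w - of_real (e ^ 4) * emart e (steps e t) w)"
    by (simp add: approx_eq scale_def algebra_simps)
  also have "norm \<dots> = e * coeff * norm (J (2 * t / e^2) w - of_real (e ^ 4) * emart e (steps e t) w)"
    using e coeff_pos by (simp add: norm_mult)
  also have "\<dots> \<le> e * coeff * ((\<Sum>i<steps e T. cell_err (e ^ 4) i w) + e ^ 4 + e ^ 4 * unit_walk.bnd (pp (e ^ 4)))"
    using J_mart[OF h w, of "2 * t / e^2" "steps e T"] t e coeff_pos steps_mono[OF e t(2)] unfolding st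
    by (intro mult_left_mono) auto
  also have "\<dots> = err T e w"
    unfolding err_def sbnd_eq[OF e, symmetric] scale_def by (simp add: algebra_simps)
  finally show ?thesis .
qed

lemma err_nonneg: "0 < e \<Longrightarrow> 0 \<le> err T e w"
  unfolding err_def sbnd_def using coeff_pos cell_err_nonneg
  by (intro add_nonneg_nonneg mult_nonneg_nonneg sum_nonneg divide_nonneg_nonneg) auto

lemma err_integrable:
  assumes "0 < e" shows "integrable M (err T e)"
  unfolding err_def[abs_def] using assms
  by (intro Bochner_Integration.integrable_add integrable_mult_right Bochner_Integration.integrable_sum
      cell_err_expectation(1)[where \<beta> = 1]) auto

lemma lim_err:
  assumes T: "0 < T"
  shows "((\<lambda>e. expectation (err T e)) \<longlongrightarrow> 0) (at_right 0)"
proof (rule tendsto_sandwich[where f = "\<lambda>_. 0"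
      and h = "\<lambda>e. e * coeff * (2 * T * (norm (\<psi> \<theta>) + 1 / 2) + e ^ 4) + sbnd e"])
  show "\<forall>\<^sub>F e in at_right 0. 0 \<le> expectation (err T e)"
    using eventually_at_right_less[of "0::real"] by eventually_elim (intro integral_nonneg_AE AE_I2 err_nonneg)
  have "((\<lambda>e. e * coeff * (2 * T * (norm (\<psi> \<theta>) + 1 / 2) + e ^ 4) + sbnd e) \<longlongrightarrow>
    0 * coeff * (2 * T * (norm (\<psi> \<theta>) + 1 / 2) + 0 ^ 4) + 0) (at_right 0)"
    by (intro tendsto_intros lim_sbnd)
  then show "((\<lambda>e. e * coeff * (2 * T * (norm (\<psi> \<theta>) + 1 / 2) + e ^ 4) + sbnd e) \<longlongrightarrow> 0) (at_right 0)"
    by simp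
  show "\<forall>\<^sub>F e in at_right 0. expectation (err T e) \<le> e * coeff * (2 * T * (norm (\<psi> \<theta>) + 1 / 2) + e ^ 4) + sbnd e"
    using eventually_at_right_less[of "0::real"]
  proof eventually_elim
    case (elim e)
    \<comment> \<open>With \<open>\<beta> = e^2\<close>, the square root of the mesh, both terms of
      the cell bound are of order \<open>e^2\<close>. The at most \<open>2 * T / e^6\<close> cells
      of width \<open>e^4\<close> then contribute a bounded sum, and the prefactor \<open>e\<close>
      sends it to 0.\<close>
    then have h: "0 < e ^ 4" and b: "0 < e^2" by simp_all
    note ce = cell_err_expectation[OF h b]
    have k: "e ^ 4 * norm (\<psi> \<theta>) / e^2 + e^2 / 2 = e^2 * (norm (\<psi> \<theta>) + 1 / 2)"
      using elim by (simp add: power2_eq_square power4_eq_xxxx field_simps)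
    have i: "integrable M (\<lambda>w. \<Sum>i<steps e T. cell_err (e ^ 4) i w)"
      by (intro Bochner_Integration.integrable_sum ce)
    have "expectation (err T e) = e * coeff * ((\<Sum>i<steps e T. expectation (cell_err (e ^ 4) i)) + e ^ 4) + sbnd e"
      unfolding err_def[abs_def] using i ce(1)
      by (simp add: prob_space Bochner_Integration.integral_sum)
    also have "\<dots> \<le> e * coeff * ((\<Sum>i<steps e T. e ^ 4 * (e^2 * (norm (\<psi> \<theta>) + 1 / 2))) + e ^ 4) + sbnd e"
      using ce(2) elim coeff_pos unfolding k by (intro add_right_mono mult_left_mono sum_mono) auto
    also have "(\<Sum>i<steps e T. e ^ 4 * (e^2 * (norm (\<psi> \<theta>) + 1 / 2))) = (real (steps e T) * e ^ 6) * (norm (\<psi> \<theta>) + 1 / 2)"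
      by (simp add: eval_nat_numeral)
    also have "e * coeff * ((real (steps e T) * e ^ 6) * (norm (\<psi> \<theta>) + 1 / 2) + e ^ 4) + sbnd e \<le>
      e * coeff * (2 * T * (norm (\<psi> \<theta>) + 1 / 2) + e ^ 4) + sbnd e"
      using elim coeff_pos T by (intro add_right_mono mult_left_mono mult_right_mono steps_bounds(1)) auto
    finally show ?case .
  qed
qed simp

text \<open>Stated for every real \<open>e\<close>, as the convergence criterion asks for a path
  process at every index; at \<open>e = 0\<close> the path is identically zero. Continuity comes
  from the integral being 1-Lipschitz in its upper limit.\<close>

lemma approx_path_process:
  assumes T: "0 < T"
  shows "path_process M T (approx e)"
proof
  show "approx e t \<in> borel_measurable M" for t
    unfolding approx_eq[abs_def] by (intro borel_measurable_times J_measurable borel_measurable_const)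
next
  fix w assume w: "w \<in> space M"
  then show "approx e 0 w = 0" by (simp add: approx_eq J_0)
  have L: "1-lipschitz_on {0..} (\<lambda>a. J a w)"
  proof (rule lipschitz_onI)
    fix a b :: real assume ab: "a \<in> {0..}" "b \<in> {0..}"
    show "dist (J a w) (J b w) \<le> 1 * dist a b"
      using J_lipschitz[OF w, of a b] J_lipschitz[OF w, of b a] ab
      by (cases "a \<le> b") (auto simp: dist_norm norm_minus_commute)
  qed simp
  have "continuous_on {0..T} (\<lambda>t. J (2 * t / e^2) w)"
    by (rule continuous_on_compose2[OF lipschitz_on_continuous_on[OF L]])
       (auto simp: divide_inverse intro!: continuous_intros)
  then show "continuous_on {0..T} (\<lambda>t. approx e t w)"
    unfolding approx_eq by (intro continuous_intros)
qed (rule T)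

section \<open>Convergence of the joint characteristic functions of increments\<close>

definition grid :: "real \<Rightarrow> nat \<Rightarrow> nat \<Rightarrow> real" where "grid T n r = T * real r / real n"

text \<open>The number \<open>m\<close> of blocks is separate from the grid size \<open>n\<close>,
  to allow induction on the blocks of a fixed grid.\<close>

definition phase :: "real \<Rightarrow> nat \<Rightarrow> (nat \<Rightarrow> complex) \<Rightarrow> nat \<Rightarrow> real \<Rightarrow> 'a \<Rightarrow> real" where
  "phase T n \<mu> m e w = (\<Sum>r<m. Re (cnj (of_real (scale e) * \<mu> r) *
    (emart e (steps e (grid T n (Suc r))) w - emart e (steps e (grid T n r)) w)))"

lemma grid_bounds:
  assumes "0 < T" "0 < n" "r \<le> n"
  shows "0 \<le> grid T n r" "grid T n r \<le> T" "grid T n r \<le> grid T n (Suc r)"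
proof -
  show "0 \<le> grid T n r" "grid T n r \<le> T"
    using grid_point[OF assms(1,3)] by (auto simp: grid_def)
  have "T * real r \<le> T * real (Suc r)" using assms by (intro mult_left_mono) auto
  then show "grid T n r \<le> grid T n (Suc r)" unfolding grid_def by (intro divide_right_mono) auto
qed

lemma grid_diff: "0 < n \<Longrightarrow> grid T n (Suc r) - grid T n r = T / real n"
  by (simp add: grid_def ring_distribs add_divide_distrib)

definition rate_sum :: "real \<Rightarrow> nat \<Rightarrow> (nat \<Rightarrow> complex) \<Rightarrow> nat \<Rightarrow> real \<Rightarrow> real" where
  "rate_sum T n \<mu> m e = (\<Sum>r<m. (norm (\<mu> r))^2 * nvar e / 4 *
    (real (steps e (grid T n (Suc r))) * e ^ 6 - real (steps e (grid T n r)) * e ^ 6))"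

text \<open>The exponential of the first \<open>m\<close> blocks depends on the past of the next
  block and serves as its weight \<open>G\<close>. Multiplication by the exponential of a
  nonpositive number keeps old errors from growing, so block errors simply add.\<close>

lemma phase_characteristic:
  assumes e: "0 < e" and T: "0 < T" and m: "m \<le> n"
  shows "norm (expectation (\<lambda>w. cis (phase T n \<mu> m e w)) - of_real (exp (- rate_sum T n \<mu> m e)))
    \<le> (\<Sum>r<m. berr (2 * T) (\<mu> r) e)"
  using m
proof (induction m)
  case 0
  show ?case by (simp add: phase_def rate_sum_def prob_space)
next
  case (Suc m)
  interpret W: unit_walk M "walk (e ^ 4)" "pp (e ^ 4)" "qq (e ^ 4)"
    by (rule unit_walk_walk) (use e in simp)
  have n: "0 < n" "m \<le> n" "Suc m \<le> n" using Suc.prems by auto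
  define k where "k r = steps e (grid T n r)" for r
  define l where "l r = of_real (scale e) * \<mu> r" for r
  have kmono: "k r \<le> k (Suc r)" if "r \<le> n" for r
    unfolding k_def using grid_bounds[OF T n(1) that] by (intro steps_mono e)
  have kmono': "k r \<le> k m" if "r \<le> m" for r
    using that
  proof (induction rule: inc_induct)
    case (step r)
    then show ?case using kmono[of r] n(2) by simp
  qed simp
  define d where "d = k (Suc m) - k m"
  have kd: "k (Suc m) = k m + d" using kmono[OF n(2)] by (simp add: d_def)
  define G where "G = (\<lambda>w. cis (phase T n \<mu> m e w))"
  have "phase T n \<mu> m e = (\<lambda>w. Re (\<Sum>r<m. cnj (l r) * (W.mart (k (Suc r)) w - W.mart (k r) w)))"
    by (intro ext) (simp only: phase_def l_def k_def Re_sum)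
  then have "G = (\<lambda>w. cis (Re (\<Sum>r<m. cnj (l r) * (W.mart (k (Suc r)) w - W.mart (k r) w))))"
    unfolding G_def by (simp only:)
  moreover have "W.adm (k m) \<dots>"
    by (intro W.adm_cis W.adm_sum W.adm_mult W.adm_const W.adm_diff W.adm_mart kmono') auto
  ultimately have G: "W.adm (k m) G" by (simp only:)
  have G1: "norm (G w) \<le> 1" for w by (simp add: G_def)
  have step: "cis (phase T n \<mu> (Suc m) e w) = G w * cis (Re (cnj (l m) * (W.mart (k m + d) w - W.mart (k m) w)))" for w
    unfolding G_def cis_mult kd[symmetric] by (simp only: phase_def l_def k_def sum.lessThan_Suc)
  have dK: "real d * e ^ 6 \<le> 2 * T"
  proof -
    have "real d * e ^ 6 \<le> real (k (Suc m)) * e ^ 6"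
      using e by (intro mult_right_mono) (auto simp: d_def)
    also have "\<dots> \<le> 2 * grid T n (Suc m)"
      unfolding k_def using grid_bounds[OF T n(1) n(3)] by (intro steps_bounds e)
    also have "\<dots> \<le> 2 * T" using grid_bounds[OF T n(1) n(3)] by simp
    finally show ?thesis .
  qed
  note be = block_error_le[OF e dK, of "\<mu> m", folded l_def]
  have b: "norm (expectation (\<lambda>w. cis (phase T n \<mu> (Suc m) e w)) - of_real (exp (- W.rate (l m) * real d)) * expectation G)
    \<le> berr (2 * T) (\<mu> m) e"
    unfolding step by (rule order_trans[OF W.block_characteristic[OF G G1] be(1)])
  have rs: "rate_sum T n \<mu> (Suc m) e = rate_sum T n \<mu> m e + W.rate (l m) * real d"
  proof -
    have "W.rate (l m) * real d = (norm (\<mu> m))^2 * nvar e / 4 * (real (k (Suc m)) * e ^ 6 - real (k m) * e ^ 6)"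
      unfolding be(2) kd by (simp add: algebra_simps)
    then show ?thesis by (simp only: rate_sum_def k_def sum.lessThan_Suc)
  qed
  have rn: "0 \<le> W.rate (l m) * real d" using W.rate_nonneg by simp
  have ex: "exp (- rate_sum T n \<mu> (Suc m) e) = exp (- W.rate (l m) * real d) * exp (- rate_sum T n \<mu> m e)"
    unfolding rs exp_add[symmetric] by simp
  have "norm (expectation (\<lambda>w. cis (phase T n \<mu> (Suc m) e w)) - of_real (exp (- rate_sum T n \<mu> (Suc m) e))) =
    norm ((expectation (\<lambda>w. cis (phase T n \<mu> (Suc m) e w)) - of_real (exp (- W.rate (l m) * real d)) * expectation G)
     + of_real (exp (- W.rate (l m) * real d)) * (expectation G - of_real (exp (- rate_sum T n \<mu> m e))))"
    unfolding ex by (simp add: algebra_simps)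
  also have "\<dots> \<le> berr (2 * T) (\<mu> m) e + 1 * (\<Sum>r<m. berr (2 * T) (\<mu> r) e)"
  proof (intro norm_triangle_mono b)
    show "norm (of_real (exp (- W.rate (l m) * real d)) * (expectation G - of_real (exp (- rate_sum T n \<mu> m e))))
      \<le> 1 * (\<Sum>r<m. berr (2 * T) (\<mu> r) e)"
      unfolding norm_mult G_def using rn by (intro mult_mono Suc.IH n(2)) auto
  qed
  finally show ?case by simp
qed

lemma phase_measurable:
  assumes "0 < e" shows "(\<lambda>w. cis (phase T n \<mu> m e w)) \<in> borel_measurable M"
proof -
  interpret W: unit_walk M "walk (e ^ 4)" "pp (e ^ 4)" "qq (e ^ 4)"
    by (rule unit_walk_walk) (use assms in simp)
  have [measurable]: "W.mart j \<in> borel_measurable M" for j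
    by (rule W.adm_measurable[OF W.adm_mart[OF order_refl]])
  show ?thesis unfolding phase_def by measurable
qed

text \<open>Since \<open>cis\<close> is 1-Lipschitz, it suffices to compare phases; each increment
  involves two end points, hence the factor 2.\<close>

lemma approx_characteristic_diff:
  assumes e: "0 < e" and T: "0 < T" and n: "0 < n"
  shows "norm (expectation (\<lambda>w. cis (\<Sum>r<n. Re (cnj (\<mu> r) * path_process.incr T (approx e) n w r)))
      - expectation (\<lambda>w. cis (phase T n \<mu> n e w))) \<le> (2 * (\<Sum>r<n. norm (\<mu> r))) * expectation (err T e)"
proof -
  interpret Y: path_process M T "approx e" by (rule approx_path_process[OF T])
  let ?c = "\<lambda>w. cis (\<Sum>r<n. Re (cnj (\<mu> r) * Y.incr n w r))" and ?d = "\<lambda>w. cis (phase T n \<mu> n e w)"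
  have "(\<lambda>w. 1 * ?c w) \<in> borel_measurable M"
    using Y.trig_incr[OF trig.cis[of 1 \<mu> n]] by blast
  then have c: "integrable M ?c" by (intro integrable_const_bound[where B = 1]) auto
  have d: "integrable M ?d" using phase_measurable[OF e] by (intro integrable_const_bound[where B = 1]) auto
  have pw: "norm (?c w - ?d w) \<le> (2 * (\<Sum>r<n. norm (\<mu> r))) * err T e w" if w: "w \<in> space M" for w
  proof -
    let ?z = "\<lambda>r. of_real (scale e) * emart e (steps e (grid T n r)) w"
    have i: "Y.incr n w r = approx e (grid T n (Suc r)) w - approx e (grid T n r) w" if "r < n" for r
      using that by (simp add: Y.incr_def grid_incr_def grid_def)
    have a: "norm (approx e (grid T n r) w - ?z r) \<le> err T e w" if "r \<le> n" for r
      using grid_bounds[OF T n that] by (intro approx_mart e w)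
    have "norm (?c w - ?d w) \<le> \<bar>(\<Sum>r<n. Re (cnj (\<mu> r) * Y.incr n w r)) - phase T n \<mu> n e w\<bar>"
      by (rule norm_cis_diff)
    also have "\<dots> = \<bar>\<Sum>r<n. Re (cnj (\<mu> r) * (Y.incr n w r - (?z (Suc r) - ?z r)))\<bar>"
      unfolding phase_def sum_subtractf[symmetric]
      by (intro arg_cong[where f = abs] sum.cong refl) (simp add: algebra_simps)
    also have "\<dots> \<le> (\<Sum>r<n. \<bar>Re (cnj (\<mu> r) * (Y.incr n w r - (?z (Suc r) - ?z r)))\<bar>)"
      by (rule sum_abs)
    also have "\<dots> \<le> (\<Sum>r<n. norm (\<mu> r) * (2 * err T e w))"
    proof (rule sum_mono)
      fix r assume "r \<in> {..<n}"
      then have r: "r < n" "r \<le> n" "Suc r \<le> n" by auto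
      have eq: "Y.incr n w r - (?z (Suc r) - ?z r) =
        (approx e (grid T n (Suc r)) w - ?z (Suc r)) - (approx e (grid T n r) w - ?z r)"
        unfolding i[OF r(1)] by simp
      have "norm (Y.incr n w r - (?z (Suc r) - ?z r)) \<le> err T e w + err T e w"
        unfolding eq by (rule order_trans[OF norm_triangle_ineq4 add_mono[OF a[OF r(3)] a[OF r(2)]]])
      then have "norm (Y.incr n w r - (?z (Suc r) - ?z r)) \<le> 2 * err T e w"
        by (simp only: mult_2)
      then have "norm (cnj (\<mu> r) * (Y.incr n w r - (?z (Suc r) - ?z r))) \<le> norm (\<mu> r) * (2 * err T e w)"
        unfolding norm_mult complex_mod_cnj by (intro mult_left_mono) auto
      then show "\<bar>Re (cnj (\<mu> r) * (Y.incr n w r - (?z (Suc r) - ?z r)))\<bar> \<le> norm (\<mu> r) * (2 * err T e w)"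
        by (rule order_trans[OF abs_Re_le_cmod])
    qed
    also have "\<dots> = (2 * (\<Sum>r<n. norm (\<mu> r))) * err T e w"
      unfolding sum_distrib_right[symmetric] by simp
    finally show ?thesis .
  qed
  have "norm (expectation ?c - expectation ?d) = norm (expectation (\<lambda>w. ?c w - ?d w))"
    using c d by simp
  also have "\<dots> \<le> expectation (\<lambda>w. norm (?c w - ?d w))" by (rule integral_norm_bound)
  also have "\<dots> \<le> expectation (\<lambda>w. (2 * (\<Sum>r<n. norm (\<mu> r))) * err T e w)"
  proof (rule integral_mono)
    show "integrable M (\<lambda>w. norm (?c w - ?d w))" by (intro integrable_norm Bochner_Integration.integrable_diff c d)
    show "integrable M (\<lambda>w. (2 * (\<Sum>r<n. norm (\<mu> r))) * err T e w)"
      by (intro integrable_mult_right err_integrable e)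
  qed (rule pw)
  also have "\<dots> = (2 * (\<Sum>r<n. norm (\<mu> r))) * expectation (err T e)" by simp
  finally show ?thesis .
qed

text \<open>A block of length \<open>T / n\<close> has about \<open>2 * T / (n * e^6)\<close> steps,
  each of rate close to \<open>(norm (\<mu> r))^2 * e^6 / 4\<close>; the product is the Brownian
  exponent \<open>(norm (\<mu> r))^2 * T / (2 * n)\<close>.\<close>

lemma lim_characteristic:
  assumes T: "0 < T" and n: "0 < n"
  shows "((\<lambda>e. expectation (\<lambda>w. cis (\<Sum>r<n. Re (cnj (\<mu> r) * path_process.incr T (approx e) n w r))))
    \<longlongrightarrow> of_real (exp (- (\<Sum>r<n. (norm (\<mu> r))^2) * T / (2 * real n)))) (at_right 0)"
proof -
  let ?A = "\<lambda>e. expectation (\<lambda>w. cis (\<Sum>r<n. Re (cnj (\<mu> r) * path_process.incr T (approx e) n w r)))"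
  let ?R = "\<lambda>e. complex_of_real (exp (- rate_sum T n \<mu> n e))"
  have "(rate_sum T n \<mu> n \<longlongrightarrow> (\<Sum>r<n. (norm (\<mu> r))^2 * 1 / 4 * (2 * grid T n (Suc r) - 2 * grid T n r))) (at_right 0)"
    unfolding rate_sum_def[abs_def] using grid_bounds[OF T n]
    by (intro tendsto_intros lim_nvar lim_steps) (auto simp: Suc_le_eq)
  also have "(\<Sum>r<n. (norm (\<mu> r))^2 * 1 / 4 * (2 * grid T n (Suc r) - 2 * grid T n r)) =
    (\<Sum>r<n. (norm (\<mu> r))^2 * (T / (2 * real n)))"
  proof (intro sum.cong refl)
    fix r
    have "2 * grid T n (Suc r) - 2 * grid T n r = 2 * (T / real n)"
      using grid_diff[OF n, of T r] by linarith
    then show "(norm (\<mu> r))^2 * 1 / 4 * (2 * grid T n (Suc r) - 2 * grid T n r) = (norm (\<mu> r))^2 * (T / (2 * real n))"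
      by simp
  qed
  also have "\<dots> = (\<Sum>r<n. (norm (\<mu> r))^2) * (T / (2 * real n))" by (rule sum_distrib_right[symmetric])
  finally have rs: "(rate_sum T n \<mu> n \<longlongrightarrow> (\<Sum>r<n. (norm (\<mu> r))^2) * (T / (2 * real n))) (at_right 0)" .
  have R: "(?R \<longlongrightarrow> of_real (exp (- ((\<Sum>r<n. (norm (\<mu> r))^2) * (T / (2 * real n)))))) (at_right 0)"
    by (intro tendsto_intros rs)
  have b: "((\<lambda>e. (2 * (\<Sum>r<n. norm (\<mu> r))) * expectation (err T e) + (\<Sum>r<n. berr (2 * T) (\<mu> r) e)) \<longlongrightarrow>
    (2 * (\<Sum>r<n. norm (\<mu> r))) * 0 + (\<Sum>r<n. 0)) (at_right 0)"
    by (intro tendsto_intros lim_err[OF T] lim_berr)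
  have "((\<lambda>e. ?A e - ?R e) \<longlongrightarrow> 0) (at_right 0)"
  proof (rule Lim_null_comparison)
    show "\<forall>\<^sub>F e in at_right 0. norm (?A e - ?R e) \<le>
      (2 * (\<Sum>r<n. norm (\<mu> r))) * expectation (err T e) + (\<Sum>r<n. berr (2 * T) (\<mu> r) e)"
      using eventually_at_right_less[of "0::real"]
    proof eventually_elim
      case (elim e)
      let ?B = "expectation (\<lambda>w. cis (phase T n \<mu> n e w))"
      have "norm ((?A e - ?B) + (?B - ?R e)) \<le>
        (2 * (\<Sum>r<n. norm (\<mu> r))) * expectation (err T e) + (\<Sum>r<n. berr (2 * T) (\<mu> r) e)"
        by (intro norm_triangle_mono approx_characteristic_diff phase_characteristic elim T n order_refl)
      then show ?case by simp
    qed
  qed (use b in simp)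
  from tendsto_add[OF this R] show ?thesis by simp
qed

section \<open>Oscillation between grid points\<close>

definition bad :: "real \<Rightarrow> nat \<Rightarrow> real \<Rightarrow> real \<Rightarrow> nat \<Rightarrow> 'a set" where
  "bad T n a e r = {w \<in> space M. \<exists>j\<le>steps e (grid T n (Suc r)) - steps e (grid T n r).
     a / scale e \<le> norm (unit_walk.mincr (walk (e ^ 4)) (pp (e ^ 4)) (steps e (grid T n r)) j w)}"

text \<open>The maximal inequality with the fourth moment bound, rewritten in scaled quantities. As
  \<open>e\<close> tends to 0, \<open>m\<close> tends to \<open>2 * T / n\<close> and the part
  linear in \<open>m\<close> disappears with \<open>sbnd\<close>, leaving order
  \<open>1 / n^2\<close> per cell.\<close>

lemma bad_prob:
  assumes e: "0 < e" and T: "0 < T" and r: "r < n" and a: "0 < a"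
  defines "m \<equiv> real (steps e (grid T n (Suc r))) * e ^ 6 - real (steps e (grid T n r)) * e ^ 6"
  shows "bad T n a e r \<in> events"
    and "prob (bad T n a e r) \<le> (4 * (nvar e)^2 * m^2 + 3 * (sbnd e)^2 * nvar e * m) / a ^ 4"
proof -
  interpret W: unit_walk M "walk (e ^ 4)" "pp (e ^ 4)" "qq (e ^ 4)"
    by (rule unit_walk_walk) (use e in simp)
  define s where "s = scale e"
  have s: "0 < s" using scale_pos[OF e] by (simp add: s_def)
  define k where "k = steps e (grid T n r)"
  define d where "d = steps e (grid T n (Suc r)) - k"
  have "grid T n r \<le> grid T n (Suc r)" using grid_bounds(3)[OF T, of n r] r by simp
  then have "k \<le> steps e (grid T n (Suc r))" unfolding k_def by (intro steps_mono e)
  then have m: "m = real d * e ^ 6" by (simp add: m_def d_def k_def of_nat_diff algebra_simps)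
  have sv: "s^2 * W.vari = nvar e * e ^ 6" using scale_sq[OF e] by (simp add: s_def)
  have sb: "s * W.bnd = sbnd e" using sbnd_eq[OF e] by (simp add: s_def)
  have as: "0 < a / s" using a s by simp
  have bad: "bad T n a e r = {w \<in> space M. \<exists>j\<le>d. a / s \<le> norm (W.mincr k j w)}"
    by (simp add: bad_def d_def k_def s_def)
  show "bad T n a e r \<in> events" unfolding bad by (rule W.maximal_inequality(1)[OF as])
  have "(a / s) ^ 4 * prob (bad T n a e r) \<le> 4 * W.vari^2 * (real d)^2 + 3 * W.bnd^2 * W.vari * real d"
    unfolding bad by (rule order_trans[OF W.maximal_inequality(2)[OF as] W.fourth_moment])
  then have "s ^ 4 * ((a / s) ^ 4 * prob (bad T n a e r)) \<le> s ^ 4 * (4 * W.vari^2 * (real d)^2 + 3 * W.bnd^2 * W.vari * real d)"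
    using s by (intro mult_left_mono) auto
  moreover have "s ^ 4 * ((a / s) ^ 4 * prob (bad T n a e r)) = a ^ 4 * prob (bad T n a e r)"
    using s by (simp add: power_divide)
  moreover have "s ^ 4 * (4 * W.vari^2 * (real d)^2 + 3 * W.bnd^2 * W.vari * real d) =
    4 * (s^2 * W.vari)^2 * (real d)^2 + 3 * (s * W.bnd)^2 * (s^2 * W.vari) * real d"
    by (simp add: power2_eq_square power4_eq_xxxx algebra_simps)
  moreover have "\<dots> = 4 * (nvar e)^2 * m^2 + 3 * (sbnd e)^2 * nvar e * m"
    unfolding sv sb m by (simp add: power_mult_distrib mult_ac)
  ultimately show "prob (bad T n a e r) \<le> (4 * (nvar e)^2 * m^2 + 3 * (sbnd e)^2 * nvar e * m) / a ^ 4"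
    using a by (simp add: field_simps)
qed

text \<open>A displacement within a cell splits into the approximation errors at its two ends and a
  martingale displacement, each less than \<open>d / 4\<close>.\<close>

lemma good_oscillation:
  assumes e: "0 < e" and T: "0 < T" and n: "0 < n" and w: "w \<in> space M"
    and err: "err T e w < d / 4" and good: "\<And>r. r < n \<Longrightarrow> w \<notin> bad T n (d / 4) e r"
  shows "grid_osc_le T n d (\<lambda>t. approx e t w)"
  unfolding grid_osc_le_def
proof (intro allI impI ballI)
  interpret W: unit_walk M "walk (e ^ 4)" "pp (e ^ 4)" "qq (e ^ 4)"
    by (rule unit_walk_walk) (use e in simp)
  fix r t assume r: "r < n" and "t \<in> {T * real r / real n..T * real (Suc r) / real n}"
  then have t: "grid T n r \<le> t" "t \<le> grid T n (Suc r)" by (auto simp: grid_def)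
  have g: "0 \<le> grid T n r" "grid T n r \<le> T" "grid T n (Suc r) \<le> T"
    using grid_bounds[OF T n, of r] grid_bounds[OF T n, of "Suc r"] r by auto
  define s where "s = scale e"
  have s: "0 < s" using scale_pos[OF e] by (simp add: s_def)
  define k where "k = steps e (grid T n r)"
  define j where "j = steps e t - k"
  have kt: "k \<le> steps e t" "steps e t \<le> steps e (grid T n (Suc r))"
    unfolding k_def using t by (auto intro!: steps_mono e)
  then have j: "steps e t = k + j" "j \<le> steps e (grid T n (Suc r)) - k" by (auto simp: j_def)
  have "\<not> d / 4 / s \<le> norm (W.mincr k j w)"
    using good[OF r] j(2) w unfolding bad_def k_def s_def by blast
  then have "s * norm (W.mincr k j w) < d / 4"
    unfolding not_le using s by (simp add: pos_less_divide_eq mult.commute)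
  then have mi: "norm (of_real s * W.mincr k j w) < d / 4" using s by (simp add: norm_mult)
  let ?z = "\<lambda>t. of_real s * W.mart (steps e t) w"
  have eq: "approx e t w - approx e (grid T n r) w =
    ((approx e t w - ?z t) - (approx e (grid T n r) w - ?z (grid T n r))) + of_real s * W.mincr k j w"
    unfolding W.mincr_def j(1)[symmetric] unfolding k_def by (simp add: algebra_simps)
  have "norm (approx e t w - approx e (grid T n r) w) \<le> (err T e w + err T e w) + d / 4"
    unfolding eq
  proof (intro norm_triangle_mono order_trans[OF norm_triangle_ineq4 add_mono])
    show "norm (approx e t w - ?z t) \<le> err T e w"
      unfolding s_def using t g by (intro approx_mart e w) auto
    show "norm (approx e (grid T n r) w - ?z (grid T n r)) \<le> err T e w"
      unfolding s_def using g by (intro approx_mart e w) auto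
  qed (use mi in simp)
  also have "\<dots> \<le> d" using err err_nonneg[OF e, of T w] by linarith
  finally show "norm (approx e t w - approx e (T * real r / real n) w) \<le> d"
    unfolding grid_def .
qed

lemma oscillation:
  assumes T: "0 < T" and d: "0 < d" and \<eta>: "0 < \<eta>"
  shows "\<exists>n0. \<forall>n\<ge>n0. \<forall>\<^sub>F e in at_right 0.
      \<exists>A\<in>events. 1 - \<eta> \<le> prob A \<and> (\<forall>w\<in>A. grid_osc_le T n d (\<lambda>t. approx e t w))"
proof -
  define c where "c = d / 4"
  have c: "0 < c" using d by (simp add: c_def)
  \<comment> \<open>In the limit each of the \<open>n\<close> cells contributes
    \<open>4 * (2 * T / n)^2 / c^4\<close>, altogether \<open>16 * T^2 / (c^4 * n)\<close>.\<close>
  obtain n0 :: nat where n0: "16 * T^2 / c ^ 4 / \<eta> < real n0" using reals_Archimedean2 by blast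
  have "\<forall>\<^sub>F e in at_right 0. \<exists>A\<in>events. 1 - \<eta> \<le> prob A \<and> (\<forall>w\<in>A. grid_osc_le T n d (\<lambda>t. approx e t w))"
    if "n \<ge> Suc n0" for n
  proof -
    have n: "0 < n" using that by simp
    let ?m = "\<lambda>e r. real (steps e (grid T n (Suc r))) * e ^ 6 - real (steps e (grid T n r)) * e ^ 6"
    let ?F = "\<lambda>e. expectation (err T e) / c +
      (\<Sum>r<n. (4 * (nvar e)^2 * (?m e r)^2 + 3 * (sbnd e)^2 * nvar e * ?m e r) / c ^ 4)"
    let ?M = "\<lambda>r. 2 * grid T n (Suc r) - 2 * grid T n r"
    have "(?F \<longlongrightarrow> 0 / c + (\<Sum>r<n. (4 * 1^2 * (?M r)^2 + 3 * 0^2 * 1 * ?M r) / c ^ 4)) (at_right 0)"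
      using grid_bounds[OF T n] c
      by (intro tendsto_intros lim_err[OF T] lim_nvar lim_sbnd lim_steps) (auto simp: Suc_le_eq)
    also have "0 / c + (\<Sum>r<n. (4 * 1^2 * (?M r)^2 + 3 * 0^2 * 1 * ?M r) / c ^ 4) = 16 * T^2 / c ^ 4 / real n"
    proof -
      have "?M r = 2 * (T / real n)" for r using grid_diff[OF n, of T r] by linarith
      then show ?thesis using n by (simp add: power2_eq_square)
    qed
    finally have F: "(?F \<longlongrightarrow> 16 * T^2 / c ^ 4 / real n) (at_right 0)" .
    have swap: "x / y < \<eta>" if "x / \<eta> < y" "0 < y" for x y :: real
      using that \<eta> by (simp add: pos_divide_less_eq mult.commute)
    have "16 * T^2 / c ^ 4 / \<eta> < real n" using n0 that by linarith
    then have "16 * T^2 / c ^ 4 / real n < \<eta>" by (rule swap) (use n in simp)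
    from order_tendstoD(2)[OF F this] show ?thesis
      using eventually_at_right_less[of "0::real"]
    proof eventually_elim
      case (elim e)
      then have e: "0 < e" by simp
      define E where "E = {w \<in> space M. c \<le> err T e w}"
      define C where "C = E \<union> (\<Union>r\<in>{..<n}. bad T n c e r)"
      have [measurable]: "err T e \<in> borel_measurable M" using err_integrable[OF e] by auto
      have Ee: "E \<in> events" unfolding E_def by measurable
      have be: "bad T n c e r \<in> events" if "r < n" for r by (rule bad_prob(1)[OF e T that c])
      have Ce: "C \<in> events" unfolding C_def using Ee be by auto
      have "prob E \<le> expectation (err T e) / c"
        unfolding E_def
        by (rule integral_Markov_inequality_measure[OF err_integrable[OF e], where A = "space M"])
           (use c err_nonneg[OF e] in auto)
      have "prob C \<le> prob E + prob (\<Union>r\<in>{..<n}. bad T n c e r)"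
        unfolding C_def using Ee be by (intro measure_Un_le) auto
      also have "prob (\<Union>r\<in>{..<n}. bad T n c e r) \<le> (\<Sum>r<n. prob (bad T n c e r))"
        using be by (intro finite_measure_subadditive_finite) auto
      finally have "prob C \<le> prob E + (\<Sum>r<n. prob (bad T n c e r))" by simp
      also have "\<dots> \<le> ?F e"
        using bad_prob(2)[OF e T _ c] by (intro add_mono sum_mono \<open>prob E \<le> _\<close>) auto
      finally have "prob C < \<eta>" using elim by simp
      then have "1 - \<eta> \<le> prob (space M - C)" using prob_compl[OF Ce] by simp
      moreover have "grid_osc_le T n d (\<lambda>t. approx e t w)" if "w \<in> space M - C" for w
      proof (rule good_oscillation[OF e T n])
        show "w \<in> space M" "err T e w < d / 4" "\<And>r. r < n \<Longrightarrow> w \<notin> bad T n (d / 4) e r"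
          using that by (auto simp: C_def E_def c_def)
      qed
      ultimately show ?case using Ce by (intro bexI[of _ "space M - C"]) auto
    qed
  qed
  then show ?thesis by blast
qed

end

theorem theorem3p2:
  fixes T \<theta> :: real
    and M :: "'a measure" and X :: "real \<Rightarrow> 'a \<Rightarrow> real" and \<psi> :: "real \<Rightarrow> complex"
    and N :: "'b measure" and B :: "real \<Rightarrow> 'b \<Rightarrow> complex"
  assumes "0 < T"
    and "levy_process M X"
    and "levy_exponent M X \<psi>"
    and "Re (\<psi> \<theta>) * Re (\<psi> (2 * \<theta>)) \<noteq> 0"
    and "complex_brownian_motion N T B"
  shows "weakly_converges (path_space T)
    (\<lambda>\<epsilon>. path_law M T (levy_approx X \<psi> \<theta> \<epsilon>)) (path_law N T B) (at_right 0)"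
proof -
  interpret levy_process M X by fact
  interpret levy_rotation M X \<psi> \<theta>
    by unfold_locales fact+
  show ?thesis
  proof (rule path_convergence_criterion)
    show "path_process M T (levy_approx X \<psi> \<theta> \<epsilon>)" for \<epsilon>
      by (rule approx_path_process) fact
    show "path_process N T B"
      by (rule complex_brownian_path_process) fact+
    show "((\<lambda>\<epsilon>. CLINT \<omega>|M. cis (\<Sum>r<n. Re (cnj (\<mu> r) * path_process.incr T (levy_approx X \<psi> \<theta> \<epsilon>) n \<omega> r)))
      \<longlongrightarrow> (CLINT \<omega>|N. cis (\<Sum>r<n. Re (cnj (\<mu> r) * path_process.incr T B n \<omega> r)))) (at_right 0)"
      if "0 < n" for n \<mu>
      unfolding complex_brownian_increments_char[OF assms(1,5) that]
      by (rule lim_characteristic[OF assms(1) that])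
  qed (rule oscillation[OF assms(1)])
qed

end
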